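(* Let $X,Y$ be complex Banach spaces and let $Z$ be a subspace of $Y^*$ that $\tau$-norms $Y$ ($\tau\ge1$). Let $\theta\in[1,\infty)$, $\frac1q-\frac1p=1-\frac1\theta$ and $1\le q<\frac{\theta}{\theta-1}\le\infty$. Suppose $k:\mathbb{R}^n\to B(X,Y)$ is strongly measurable on $X$, $k^*:\mathbb{R}^n\to B(Y^*,X^* )$ is strongly measurable on $Z$, and $$\|kx\|_{L_\theta(\mathbb{R}^n,Y)}\le C_1\|x\|_X\quad\text{for all }x\in X,$$ $$\|k^*y^*\|_{L_\theta(\mathbb{R}^n,X^* )}\le C_2\|y^*\|_{Y^*}\quad\text{for all }y^*\in Y^*.$$ Then the convolution operator defined (for $f\in\mathcal{E}(\mathbb{R}^n,X)$) by $$(Kf)(t)=\int_{\mathbb{R}^n}k(t-s)f(s)\,ds,\qquad t\in\mathbb{R}^n,$$ extends to a bounded linear operator $K:L_q(\mathbb{R}^n,X)\to L_p(\mathbb{R}^n,Y)$ satisfying $$\|K\|_{L_q\to L_p}\le (C_1)^{\theta/p}(C_2)^{1-\theta/p}.$$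
   Context: $B(X,Y)$ is the space of bounded linear operators from $X$ to $Y$; $k^*(t)=k(t)^*\in B(Y^*,X^* )$ is the adjoint. $\mathbb{R}^n$ carries Lebesgue measure. $\frac{\theta}{\theta-1}$ means $\infty$ when $\theta=1$. "$k$ is strongly measurable on $X$" means that $t\mapsto k(t)x$ is a measurable $Y$-valued function for every $x\in X$; "$k^*$ is strongly measurable on $Z$" means that $t\mapsto k^*(t)y^*$ is a measurable $X^*$-valued function for every $y^*\in Z$ (measurable: pointwise a.e. norm limit of a sequence of finitely-valued measurable functions supported on sets of finite measure). $kx$ and $k^*y^*$ denote the functions $t\mapsto k(t)x$ and $t\mapsto k^*(t)y^*$; $L_\theta(\mathbb{R}^n,Y)$ and $L_\theta(\mathbb{R}^n,X^* )$ are Bochner spaces. $\mathcal{E}(\mathbb{R}^n,X)=\{\sum_{i=1}^N x_i1_{A_i}:x_i\in X,\ A_i\text{ measurable of finite measure},\ N\in\mathbb{N}\}$. A subspace $Z\subset Y^*$ $\tau$-norms $Y$ if $\|y\|_Y\le\tau\sup\{|y^*(y)|:y^*\in Z,\ \|y^*\|\le1\}$ for all $y\in Y$. *)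

theory Defs
  imports "HOL-Analysis.Analysis"
begin

section \<open>Complex Banach spaces\<close>

class scaleC = scaleR +
  fixes scaleC :: "complex \<Rightarrow> 'a \<Rightarrow> 'a" (infixr \<open>*\<^sub>C\<close> 75)
  assumes scaleR_scaleC: "r *\<^sub>R x = complex_of_real r *\<^sub>C x"

class complex_normed_vector = real_normed_vector + scaleC +
  assumes scaleC_add_right: "a *\<^sub>C (x + y) = a *\<^sub>C x + a *\<^sub>C y"
    and scaleC_add_left: "(a + b) *\<^sub>C x = a *\<^sub>C x + b *\<^sub>C x"
    and scaleC_scaleC: "a *\<^sub>C (b *\<^sub>C x) = (a * b) *\<^sub>C x"
    and scaleC_one: "1 *\<^sub>C x = x"
    and norm_scaleC: "norm (a *\<^sub>C x) = cmod a * norm x"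

class complex_banach = complex_normed_vector + banach

instantiation complex :: complex_banach
begin

definition scaleC_complex :: "complex \<Rightarrow> complex \<Rightarrow> complex" where
  "scaleC_complex a x = a * x"

instance
  by standard
    (simp_all add: scaleC_complex_def algebra_simps norm_mult scaleR_conv_of_real)

end

definition csubspace :: "'a::complex_normed_vector set \<Rightarrow> bool" where
  "csubspace S \<longleftrightarrow>
     0 \<in> S \<and> (\<forall>x\<in>S. \<forall>y\<in>S. x + y \<in> S) \<and> (\<forall>c. \<forall>x\<in>S. c *\<^sub>C x \<in> S)"

lemma scaleC_scaleR_commute:
  fixes x :: "'a::complex_normed_vector"
  shows "a *\<^sub>C (r *\<^sub>R x) = r *\<^sub>R (a *\<^sub>C x)"
  by (simp add: scaleR_scaleC scaleC_scaleC mult.commute)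

lemma scaleC_zero_right [simp]: "a *\<^sub>C (0::'a::complex_normed_vector) = 0"
  using scaleC_add_right[of a 0 0] by simp

lemma scaleC_minus_right: "a *\<^sub>C (- x) = - (a *\<^sub>C (x::'a::complex_normed_vector))"
  using scaleC_scaleR_commute[of a "-1" x] by simp

lemma scaleC_diff_right:
  "a *\<^sub>C (x - y) = a *\<^sub>C x - a *\<^sub>C (y::'a::complex_normed_vector)"
  using scaleC_add_right[of a x "- y"] by (simp add: scaleC_minus_right)

lemma bounded_linear_scaleC: "bounded_linear (\<lambda>x::'a::complex_normed_vector. a *\<^sub>C x)"
  by (rule bounded_linear_intro[where K = "cmod a"])
    (simp_all add: scaleC_add_right scaleC_scaleR_commute norm_scaleC mult.commute)


section \<open>Bounded complex-linear operators\<close>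

typedef (overloaded) ('a, 'b) cblinfun (\<open>(_ \<Rightarrow>\<^sub>C\<^sub>L /_)\<close> [22, 21] 21) =
  "{f :: 'a::complex_normed_vector \<Rightarrow>\<^sub>L 'b::complex_normed_vector.
     \<forall>c x. blinfun_apply f (c *\<^sub>C x) = c *\<^sub>C blinfun_apply f x}"
  by (rule exI[of _ 0]) simp

setup_lifting type_definition_cblinfun

lift_definition cblinfun_apply ::
  "('a::complex_normed_vector \<Rightarrow>\<^sub>C\<^sub>L 'b::complex_normed_vector) \<Rightarrow> 'a \<Rightarrow> 'b"
  is blinfun_apply .

declare [[coercion
  "cblinfun_apply :: ('a::complex_normed_vector \<Rightarrow>\<^sub>C\<^sub>L 'b::complex_normed_vector) \<Rightarrow> 'a \<Rightarrow> 'b"]]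

text \<open>The norm is inherited from the type of bounded real-linear functions, where it is the
  operator norm \<^const>\<open>onorm\<close>.\<close>

instantiation cblinfun :: (complex_normed_vector, complex_normed_vector) complex_normed_vector
begin

lift_definition zero_cblinfun :: "'a \<Rightarrow>\<^sub>C\<^sub>L 'b" is 0 by simp

lift_definition plus_cblinfun :: "('a \<Rightarrow>\<^sub>C\<^sub>L 'b) \<Rightarrow> ('a \<Rightarrow>\<^sub>C\<^sub>L 'b) \<Rightarrow> 'a \<Rightarrow>\<^sub>C\<^sub>L 'b" is "(+)"
  by (simp add: blinfun.add_left scaleC_add_right)

lift_definition minus_cblinfun :: "('a \<Rightarrow>\<^sub>C\<^sub>L 'b) \<Rightarrow> ('a \<Rightarrow>\<^sub>C\<^sub>L 'b) \<Rightarrow> 'a \<Rightarrow>\<^sub>C\<^sub>L 'b" is "(-)"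
  by (simp add: blinfun.diff_left scaleC_diff_right)

lift_definition uminus_cblinfun :: "('a \<Rightarrow>\<^sub>C\<^sub>L 'b) \<Rightarrow> 'a \<Rightarrow>\<^sub>C\<^sub>L 'b" is uminus
  by (simp add: blinfun.minus_left scaleC_minus_right)

lift_definition scaleR_cblinfun :: "real \<Rightarrow> ('a \<Rightarrow>\<^sub>C\<^sub>L 'b) \<Rightarrow> 'a \<Rightarrow>\<^sub>C\<^sub>L 'b" is scaleR
  by (simp add: blinfun.scaleR_left scaleC_scaleR_commute)

lift_definition scaleC_cblinfun :: "complex \<Rightarrow> ('a \<Rightarrow>\<^sub>C\<^sub>L 'b) \<Rightarrow> 'a \<Rightarrow>\<^sub>C\<^sub>L 'b"
  is "\<lambda>a f. Blinfun (\<lambda>x. a *\<^sub>C blinfun_apply f x)"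
  by (simp add: bounded_linear_Blinfun_apply scaleC_scaleC mult.commute
      bounded_linear_compose[OF bounded_linear_scaleC blinfun.bounded_linear_right])

lift_definition norm_cblinfun :: "('a \<Rightarrow>\<^sub>C\<^sub>L 'b) \<Rightarrow> real" is norm .

definition dist_cblinfun :: "('a \<Rightarrow>\<^sub>C\<^sub>L 'b) \<Rightarrow> ('a \<Rightarrow>\<^sub>C\<^sub>L 'b) \<Rightarrow> real" where
  "dist_cblinfun f g = norm (f - g)"

definition sgn_cblinfun :: "('a \<Rightarrow>\<^sub>C\<^sub>L 'b) \<Rightarrow> 'a \<Rightarrow>\<^sub>C\<^sub>L 'b" where
  "sgn_cblinfun f = scaleR (inverse (norm f)) f"

definition [code del]:
  "(uniformity :: (('a \<Rightarrow>\<^sub>C\<^sub>L 'b) \<times> ('a \<Rightarrow>\<^sub>C\<^sub>L 'b)) filter) =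
     (INF e\<in>{0<..}. principal {(x, y). dist x y < e})"

definition open_cblinfun :: "('a \<Rightarrow>\<^sub>C\<^sub>L 'b) set \<Rightarrow> bool" where
  [code del]: "open_cblinfun S =
     (\<forall>x\<in>S. \<forall>\<^sub>F (x', y) in uniformity. x' = x \<longrightarrow> y \<in> S)"

lemma blinfun_apply_scaleC:
  "blinfun_apply (Blinfun (\<lambda>x. a *\<^sub>C blinfun_apply f x)) x = a *\<^sub>C blinfun_apply f x"
  for f :: "'c::complex_normed_vector \<Rightarrow>\<^sub>L 'd::complex_normed_vector"
  by (simp add: bounded_linear_Blinfun_apply
      bounded_linear_compose[OF bounded_linear_scaleC blinfun.bounded_linear_right])

instance
proof
  fix a b :: complex and r s :: real and x y z :: "'a \<Rightarrow>\<^sub>C\<^sub>L 'b"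
  show "x + y + z = x + (y + z)" by transfer (simp add: algebra_simps)
  show "x + y = y + x" by transfer (simp add: algebra_simps)
  show "0 + x = x" by transfer simp
  show "- x + x = 0" by transfer simp
  show "x - y = x + - y" by transfer simp
  show "r *\<^sub>R (x + y) = r *\<^sub>R x + r *\<^sub>R y" by transfer (simp add: algebra_simps)
  show "(r + s) *\<^sub>R x = r *\<^sub>R x + s *\<^sub>R x" by transfer (simp add: algebra_simps)
  show "r *\<^sub>R s *\<^sub>R x = (r * s) *\<^sub>R x" by transfer simp
  show "1 *\<^sub>R x = x" by transfer simp
  show "dist x y = norm (x - y)" by (simp add: dist_cblinfun_def)
  show "sgn x = inverse (norm x) *\<^sub>R x" by (simp add: sgn_cblinfun_def)
  show "(uniformity :: (('a \<Rightarrow>\<^sub>C\<^sub>L 'b) \<times> ('a \<Rightarrow>\<^sub>C\<^sub>L 'b)) filter) =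
      (INF e\<in>{0<..}. principal {(x, y). dist x y < e})"
    by (rule uniformity_cblinfun_def)
  show "open S = (\<forall>x\<in>S. \<forall>\<^sub>F (x', y) in uniformity. x' = x \<longrightarrow> y \<in> S)"
    for S :: "('a \<Rightarrow>\<^sub>C\<^sub>L 'b) set"
    by (rule open_cblinfun_def)
  show "norm x = 0 \<longleftrightarrow> x = 0" by transfer simp
  show "norm (x + y) \<le> norm x + norm y" by transfer (rule norm_triangle_ineq)
  show "norm (r *\<^sub>R x) = \<bar>r\<bar> * norm x" by transfer simp
  show "r *\<^sub>R x = complex_of_real r *\<^sub>C x"
    by transfer (rule blinfun_eqI, unfold blinfun_apply_scaleC,
        simp add: blinfun_apply_scaleC blinfun.scaleR_left scaleR_scaleC)
  show "a *\<^sub>C (x + y) = a *\<^sub>C x + a *\<^sub>C y"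
    by transfer (rule blinfun_eqI, unfold blinfun_apply_scaleC,
        simp add: blinfun_apply_scaleC blinfun.add_left scaleC_add_right)
  show "(a + b) *\<^sub>C x = a *\<^sub>C x + b *\<^sub>C x"
    by transfer (rule blinfun_eqI, unfold blinfun_apply_scaleC,
        simp add: blinfun_apply_scaleC blinfun.add_left scaleC_add_left)
  show "a *\<^sub>C b *\<^sub>C x = (a * b) *\<^sub>C x"
    by transfer (rule blinfun_eqI, unfold blinfun_apply_scaleC,
        simp add: blinfun_apply_scaleC scaleC_scaleC)
  show "1 *\<^sub>C x = x"
    by transfer (rule blinfun_eqI, unfold blinfun_apply_scaleC,
        simp add: blinfun_apply_scaleC scaleC_one)
  show "norm (a *\<^sub>C x) = cmod a * norm x"
  proof transfer
    fix a :: complex and f :: "'a \<Rightarrow>\<^sub>L 'b"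
    have le: "norm (Blinfun (\<lambda>x. c *\<^sub>C blinfun_apply g x)) \<le> cmod c * norm g"
      for c and g :: "'a \<Rightarrow>\<^sub>L 'b"
      by (rule norm_blinfun_bound)
        (auto simp: blinfun_apply_scaleC norm_scaleC mult.assoc intro!: mult_left_mono norm_blinfun)
    show "norm (Blinfun (\<lambda>x. a *\<^sub>C blinfun_apply f x)) = cmod a * norm f"
    proof (cases "a = 0")
      case True
      then show ?thesis using le[of 0 f] by simp
    next
      case False
      let ?g = "Blinfun (\<lambda>x. a *\<^sub>C blinfun_apply f x)"
      have "f = Blinfun (\<lambda>x. inverse a *\<^sub>C blinfun_apply ?g x)"
        by (rule blinfun_eqI) (simp add: blinfun_apply_scaleC scaleC_scaleC scaleC_one False
            blinfun_apply_inverse)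
      then have "norm f \<le> cmod (inverse a) * norm ?g"
        using le[of "inverse a" ?g] by simp
      then have "cmod a * norm f \<le> norm ?g"
        using False by (simp add: norm_divide field_simps)
      with le[of a f] show ?thesis by simp
    qed
  qed
qed

end

type_synonym 'a cdual = "('a, complex) cblinfun"

lift_definition cblinfun_compose ::
  "('b::complex_normed_vector \<Rightarrow>\<^sub>C\<^sub>L 'c::complex_normed_vector) \<Rightarrow>
   ('a::complex_normed_vector \<Rightarrow>\<^sub>C\<^sub>L 'b) \<Rightarrow> ('a \<Rightarrow>\<^sub>C\<^sub>L 'c)" (infixl \<open>o\<^sub>C\<^sub>L\<close> 55)
  is blinfun_compose
  by simp

definition cadjoint ::
  "('a::complex_normed_vector \<Rightarrow>\<^sub>C\<^sub>L 'b::complex_normed_vector) \<Rightarrow> ('b cdual \<Rightarrow>\<^sub>C\<^sub>L 'a cdual)" where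
  "cadjoint T = Abs_cblinfun (Blinfun (\<lambda>\<phi>. \<phi> o\<^sub>C\<^sub>L T))"

lemma cblinfun_eqI: "(\<And>x. cblinfun_apply f x = cblinfun_apply g x) \<Longrightarrow> f = g"
  by transfer (rule blinfun_eqI)

lemma cblinfun_compose_apply [simp]:
  "cblinfun_apply (f o\<^sub>C\<^sub>L g) x = cblinfun_apply f (cblinfun_apply g x)"
  by transfer simp

lemma cblinfun_apply_scaleC_left [simp]:
  "cblinfun_apply (c *\<^sub>C f) x = c *\<^sub>C cblinfun_apply f x"
  by transfer (rule blinfun_apply_scaleC)

lemma norm_cblinfun_compose: "norm (f o\<^sub>C\<^sub>L g) \<le> norm f * norm g"
  by transfer (rule norm_blinfun_compose)

lemma bounded_linear_cblinfun_compose_left: "bounded_linear (\<lambda>\<phi>. \<phi> o\<^sub>C\<^sub>L T)"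
proof (rule bounded_linear_intro[where K = "norm T"])
  show "(f + g) o\<^sub>C\<^sub>L T = (f o\<^sub>C\<^sub>L T) + (g o\<^sub>C\<^sub>L T)" for f g
    by transfer (rule blinfun_eqI, simp add: blinfun.add_left)
  show "(r *\<^sub>R f) o\<^sub>C\<^sub>L T = r *\<^sub>R (f o\<^sub>C\<^sub>L T)" for r f
    by transfer (rule blinfun_eqI, simp add: blinfun.scaleR_left)
  show "norm (f o\<^sub>C\<^sub>L T) \<le> norm f * norm T" for f
    by (rule norm_cblinfun_compose)
qed

lemma cadjoint_apply [simp]:
  fixes T :: "'a::complex_normed_vector \<Rightarrow>\<^sub>C\<^sub>L 'b::complex_normed_vector" and \<phi> :: "'b cdual"
  shows "cblinfun_apply (cadjoint T) \<phi> = \<phi> o\<^sub>C\<^sub>L T"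
proof -
  have *: "blinfun_apply (Blinfun (\<lambda>\<phi>::'b cdual. \<phi> o\<^sub>C\<^sub>L T)) = (\<lambda>\<phi>. \<phi> o\<^sub>C\<^sub>L T)"
    by (rule bounded_linear_Blinfun_apply) (rule bounded_linear_cblinfun_compose_left)
  have "(c *\<^sub>C \<phi>) o\<^sub>C\<^sub>L T = c *\<^sub>C (\<phi> o\<^sub>C\<^sub>L T)" for c and \<phi> :: "'b cdual"
    by (rule cblinfun_eqI) simp
  then show ?thesis
    by (simp add: cadjoint_def cblinfun_apply.rep_eq Abs_cblinfun_inverse *)
qed

definition norming :: "real \<Rightarrow> 'b::complex_normed_vector cdual set \<Rightarrow> bool" where
  "norming \<tau> Z \<longleftrightarrow>
     (\<forall>y. norm y \<le> \<tau> * (SUP \<phi>\<in>{\<phi>\<in>Z. norm \<phi> \<le> 1}. cmod (cblinfun_apply \<phi> y)))"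


section \<open>Bochner integration without separability\<close>

text \<open>The Bochner integral of the library is restricted to second countable spaces. The predicate
  \<open>simple_bochner_integrable\<close> (a finitely-valued measurable function whose support has finite
  measure) and \<open>simple_bochner_integral\<close> are not, and serve as the starting point here.\<close>

definition strongly_measurable :: "'t measure \<Rightarrow> ('t \<Rightarrow> 'b::real_normed_vector) \<Rightarrow> bool" where
  "strongly_measurable M f \<longleftrightarrow>
     (\<exists>s. (\<forall>i. Bochner_Integration.simple_bochner_integrable M (s i)) \<and>
          (AE t in M. (\<lambda>i::nat. s i t) \<longlonglongrightarrow> f t))"

definition has_Bochner_integral ::
  "'t measure \<Rightarrow> ('t \<Rightarrow> 'b::real_normed_vector) \<Rightarrow> 'b \<Rightarrow> bool" where
  "has_Bochner_integral M f z \<longleftrightarrow>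
     strongly_measurable M f \<and>
     (\<exists>s. (\<forall>i. Bochner_Integration.simple_bochner_integrable M (s i)) \<and>
          (\<lambda>i::nat. \<integral>\<^sup>+ t. ennreal (norm (f t - s i t)) \<partial>M) \<longlonglongrightarrow> 0 \<and>
          (\<lambda>i. Bochner_Integration.simple_bochner_integral M (s i)) \<longlonglongrightarrow> z)"

definition Bochner_integrable :: "'t measure \<Rightarrow> ('t \<Rightarrow> 'b::real_normed_vector) \<Rightarrow> bool" where
  "Bochner_integrable M f \<longleftrightarrow> (\<exists>z. has_Bochner_integral M f z)"

definition Bochner_integral :: "'t measure \<Rightarrow> ('t \<Rightarrow> 'b::real_normed_vector) \<Rightarrow> 'b" where
  "Bochner_integral M f = (THE z. has_Bochner_integral M f z)"


section \<open>Bochner spaces\<close>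

text \<open>The extended norm for a finite exponent. It is defined for every function; measurability is
  required separately, and without it \<^const>\<open>nn_integral\<close> is the lower integral.\<close>

definition Lp_norm :: "'t measure \<Rightarrow> real \<Rightarrow> ('t \<Rightarrow> 'b::real_normed_vector) \<Rightarrow> ennreal" where
  "Lp_norm M p f =
     (let I = (\<integral>\<^sup>+ t. ennreal (norm (f t) powr p) \<partial>M)
      in if I = \<infinity> then \<infinity> else ennreal (enn2real I powr (1 / p)))"

definition Lp_space :: "'t measure \<Rightarrow> real \<Rightarrow> ('t \<Rightarrow> 'b::real_normed_vector) set" where
  "Lp_space M p = {f. strongly_measurable M f \<and> Lp_norm M p f < \<infinity>}"

text \<open>Operators between Bochner spaces act on representatives: the second conjunct says that they
  descend to almost-everywhere classes, and identities between values hold almost everywhere.\<close>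

definition bounded_Lp_operator ::
  "'t measure \<Rightarrow> real \<Rightarrow> real \<Rightarrow>
   (('t \<Rightarrow> 'a::complex_normed_vector) \<Rightarrow> ('t \<Rightarrow> 'b::complex_normed_vector)) \<Rightarrow> bool" where
  "bounded_Lp_operator M q p K \<longleftrightarrow>
     (\<forall>f\<in>Lp_space M q. K f \<in> Lp_space M p) \<and>
     (\<forall>f\<in>Lp_space M q. \<forall>g\<in>Lp_space M q.
        (AE t in M. f t = g t) \<longrightarrow> (AE t in M. K f t = K g t)) \<and>
     (\<forall>f\<in>Lp_space M q. \<forall>g\<in>Lp_space M q.
        AE t in M. K (\<lambda>s. f s + g s) t = K f t + K g t) \<and>
     (\<forall>c. \<forall>f\<in>Lp_space M q. AE t in M. K (\<lambda>s. c *\<^sub>C f s) t = c *\<^sub>C K f t) \<and>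
     (\<exists>B::real. \<forall>f\<in>Lp_space M q. Lp_norm M p (K f) \<le> ennreal B * Lp_norm M q f)"

definition Lp_operator_norm ::
  "'t measure \<Rightarrow> real \<Rightarrow> real \<Rightarrow>
   (('t \<Rightarrow> 'a::real_normed_vector) \<Rightarrow> ('t \<Rightarrow> 'b::real_normed_vector)) \<Rightarrow> ennreal" where
  "Lp_operator_norm M q p K =
     (SUP f\<in>{f \<in> Lp_space M q. Lp_norm M q f \<le> 1}. Lp_norm M p (K f))"

definition step_functions :: "'t measure \<Rightarrow> ('t \<Rightarrow> 'a::real_normed_vector) set" where
  "step_functions M =
     {f. \<exists>(N::nat) x A. (\<forall>i<N. A i \<in> sets M \<and> emeasure M (A i) < \<infinity>) \<and>
           f = (\<lambda>t. \<Sum>i<N. indicator (A i) t *\<^sub>R x i)}"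

definition convolution ::
  "(real ^ 'n \<Rightarrow> ('a::complex_normed_vector \<Rightarrow>\<^sub>C\<^sub>L 'b::complex_normed_vector)) \<Rightarrow>
   (real ^ 'n \<Rightarrow> 'a) \<Rightarrow> real ^ 'n \<Rightarrow> 'b" where
  "convolution k f t = Bochner_integral lebesgue (\<lambda>s. cblinfun_apply (k (t - s)) (f s))"

definition conjugate_exponent :: "real \<Rightarrow> ereal" where
  "conjugate_exponent \<theta> = (if \<theta> = 1 then \<infinity> else ereal (\<theta> / (\<theta> - 1)))"

end

theory Submission
  imports Defs
begin

text \<open>The estimate on simple functions is proved directly, as in Young's inequality. For fixed \<open>t\<close>
  choose by Hahn--Banach a functional \<open>\<phi>\<close> of norm at most 1 with \<open>\<phi> ((K f) t) = \<parallel>(K f) t\<parallel>\<close> and write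
  \<open>f s = \<parallel>f s\<parallel> g s\<close> with \<open>\<parallel>g s\<parallel> \<le> 1\<close>. Then
  \<open>\<bar>\<phi> (k (t - s) (f s))\<bar> \<le> u\<^sup>a v\<^sup>b w\<^sup>c\<close> with \<open>u = \<parallel>k (t - s) (g s)\<parallel>\<^sup>\<theta> \<parallel>f s\<parallel>\<^sup>q\<close>,
  \<open>v = \<bar>\<phi> (k (t - s) (g s))\<bar>\<^sup>\<theta>\<close>, \<open>w = \<parallel>f s\<parallel>\<^sup>q\<close> and exponents \<open>a = 1/p\<close>, \<open>b = 1/\<theta> - 1/p\<close>,
  \<open>c = 1/q - 1/p\<close> of sum 1. By Hoelder's inequality \<open>\<parallel>(K f) t\<parallel>\<^sup>p\<close> is at most \<open>\<integral> u\<close> times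
  \<open>C2\<close> to the power \<open>p - \<theta>\<close> times \<open>\<parallel>f\<parallel>\<^sub>q\<close> to the power \<open>p - q\<close>, because \<open>v \<le> \<parallel>k\<^sup>* \<phi>\<parallel>\<^sup>\<theta>\<close>; integrating
  \<open>\<integral> u\<close> over \<open>t\<close> with Tonelli gives the factor \<open>C1\<^sup>\<theta> \<parallel>f\<parallel>\<^sub>q\<^sup>q\<close>. The operator is then extended by density
  of the simple functions and completeness of the Bochner spaces.\<close>

section \<open>Norming functionals\<close>

text \<open>Two obstacles shape the argument. The spaces need not be separable and \<open>k\<close>
  is only strongly measurable, so neither \<open>\<lambda>t. norm (k t)\<close> nor
  \<open>k (t - s) (f s)\<close> as a function of both variables is known to be measurable. Hence
  the restriction to simple \<open>f\<close>, where each nonzero value is one fixed vector, and the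
  use of unit vectors \<open>sgn (f s)\<close> in place of operator norms. Moreover the functional
  \<phi> depends on \<open>t\<close>, yet no measurable choice of it is made: after Hoelder's
  inequality the only factor varying with \<open>t\<close> is the integral of \<open>u\<close>, in
  which \<phi> does not occur, while the integral of \<open>v\<close> is bounded uniformly.

  The constants can be read off the exponents. The factor \<open>u\<close> carries the power
  \<open>1 / p\<close>, so that the \<open>p\<close>-th power is linear in its integral and can be
  integrated over \<open>t\<close>; this gives \<open>C1\<close> the exponent
  \<open>\<theta> / p\<close>. The factor \<open>v\<close> leaves \<open>C2\<close> with
  \<open>\<theta> * (1 / \<theta> - 1 / p) = 1 - \<theta> / p\<close>.\<close>

definition sublinear :: "('a::real_vector \<Rightarrow> real) \<Rightarrow> bool" where
  "sublinear P \<longleftrightarrow>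
     (\<forall>x y. P (x + y) \<le> P x + P y) \<and> (\<forall>r x. 0 \<le> r \<longrightarrow> P (r *\<^sub>R x) = r * P x)"

lemma sublinear_add: "sublinear P \<Longrightarrow> P (x + y) \<le> P x + P y"
  and sublinear_scale: "sublinear P \<Longrightarrow> 0 \<le> r \<Longrightarrow> P (r *\<^sub>R x) = r * P x"
  by (auto simp: sublinear_def)

lemma sublinear_zero: "sublinear P \<Longrightarrow> P 0 = 0"
  using sublinear_scale[of P 0 0] by simp

lemma sublinear_uminus: "sublinear P \<Longrightarrow> - P (- x) \<le> P x"
  using sublinear_add[of P x "- x"] sublinear_zero[of P] by simp

text \<open>A minimal sublinear functional coincides with all its shifts, which forces additivity; so
  Zorn's lemma yields linear functionals without extending from subspaces.\<close>

definition sublinear_shift :: "('a::real_vector \<Rightarrow> real) \<Rightarrow> 'a \<Rightarrow> 'a \<Rightarrow> real" where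
  "sublinear_shift P z x = (INF t\<in>{0..}. P (x + t *\<^sub>R z) - t * P z)"

text \<open>Subadditivity for \<open>t *\<^sub>R z = (x + t *\<^sub>R z) + (- x)\<close> yields the
  bound \<open>- P (- x)\<close>, uniform in \<open>t\<close>. Without it the real-valued
  \<open>INF\<close> in \<open>sublinear_shift\<close> would carry no information.\<close>

lemma sublinear_shift_bdd_below:
  assumes "sublinear P"
  shows "bdd_below ((\<lambda>t. P (x + t *\<^sub>R z) - t * P z) ` {0..})"
proof (rule bdd_belowI2)
  fix t :: real
  assume t: "t \<in> {0..}"
  have "P ((x + t *\<^sub>R z) + (- x)) \<le> P (x + t *\<^sub>R z) + P (- x)"
    by (rule sublinear_add[OF assms])
  then show "- P (- x) \<le> P (x + t *\<^sub>R z) - t * P z"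
    using sublinear_scale[OF assms, of t z] t by simp
qed

lemma sublinear_shift_le:
  assumes "sublinear P" "0 \<le> t"
  shows "sublinear_shift P z x \<le> P (x + t *\<^sub>R z) - t * P z"
  unfolding sublinear_shift_def
  using assms by (intro cINF_lower sublinear_shift_bdd_below) auto

lemma sublinear_shift_le_self: "sublinear P \<Longrightarrow> sublinear_shift P z x \<le> P x"
  using sublinear_shift_le[of P 0 z x] by simp

text \<open>Near-optimal parameters \<open>t\<close> for \<open>x\<close> and \<open>u\<close> for
  \<open>y\<close> combine to the competitor \<open>t + u\<close> for \<open>x + y\<close>. For
  homogeneity with \<open>r > 0\<close>, replacing \<open>t\<close> by \<open>r * t\<close> matches
  the two families of competitors.\<close>

lemma sublinear_sublinear_shift:
  assumes P: "sublinear P"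
  shows "sublinear (sublinear_shift P z)"
  unfolding sublinear_def
proof (intro conjI allI impI)
  let ?S = "sublinear_shift P z"
  have approx: "\<exists>t\<ge>0. P (x + t *\<^sub>R z) - t * P z < ?S x + e" if "e > 0" for x e
  proof -
    have "?S x < ?S x + e" using that by simp
    then show ?thesis
      unfolding sublinear_shift_def
      by (subst (asm) cINF_less_iff[OF _ sublinear_shift_bdd_below[OF P]]) auto
  qed
  fix x y
  show "?S (x + y) \<le> ?S x + ?S y"
  proof (rule field_le_epsilon)
    fix e :: real assume "e > 0"
    then obtain t u where t: "t \<ge> 0" "P (x + t *\<^sub>R z) - t * P z < ?S x + e / 2"
      and u: "u \<ge> 0" "P (y + u *\<^sub>R z) - u * P z < ?S y + e / 2"
      using approx[of "e / 2" x] approx[of "e / 2" y] by auto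
    have "?S (x + y) \<le> P ((x + y) + (t + u) *\<^sub>R z) - (t + u) * P z"
      using t u by (intro sublinear_shift_le P) auto
    also have "(x + y) + (t + u) *\<^sub>R z = (x + t *\<^sub>R z) + (y + u *\<^sub>R z)"
      by (simp add: algebra_simps)
    finally show "?S (x + y) \<le> ?S x + ?S y + e"
      using sublinear_add[OF P, of "x + t *\<^sub>R z" "y + u *\<^sub>R z"] t u by (simp add: algebra_simps)
  qed
next
  let ?S = "sublinear_shift P z"
  have le: "?S (r *\<^sub>R x) \<le> r * ?S x" if r: "0 < r" for r x
  proof -
    have "inverse r * ?S (r *\<^sub>R x) \<le> ?S x"
      unfolding sublinear_shift_def[of P z x]
    proof (rule cINF_greatest)
      fix t :: real assume t: "t \<in> {0..}"
      have "?S (r *\<^sub>R x) \<le> P (r *\<^sub>R x + (r * t) *\<^sub>R z) - (r * t) * P z"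
        using t r by (intro sublinear_shift_le P) auto
      also have "r *\<^sub>R x + (r * t) *\<^sub>R z = r *\<^sub>R (x + t *\<^sub>R z)"
        by (simp add: algebra_simps)
      also have "P \<dots> - (r * t) * P z = r * (P (x + t *\<^sub>R z) - t * P z)"
        using r by (simp only: sublinear_scale[OF P] less_imp_le) (simp add: algebra_simps)
      finally show "inverse r * ?S (r *\<^sub>R x) \<le> P (x + t *\<^sub>R z) - t * P z"
        using r by (simp add: field_simps)
    qed simp
    then show ?thesis using r by (simp add: field_simps)
  qed
  fix r :: real and x
  assume "0 \<le> r"
  show "?S (r *\<^sub>R x) = r * ?S x"
  proof (cases "r = 0")
    case True
    have "0 \<le> ?S 0"
      unfolding sublinear_shift_def by (rule cINF_greatest) (auto simp: sublinear_scale[OF P])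
    moreover have "?S 0 \<le> 0"
      using sublinear_shift_le_self[OF P, of z 0] by (simp add: sublinear_zero[OF P])
    ultimately show ?thesis using True by simp
  next
    case False
    with \<open>0 \<le> r\<close> have r: "0 < r" by simp
    \<comment> \<open>Only one direction was proved in \<open>le\<close>; the other is
      \<open>le\<close> for the factor \<open>inverse r\<close> at the point
      \<open>r *\<^sub>R x\<close>.\<close>
    have "r * ?S (inverse r *\<^sub>R r *\<^sub>R x) \<le> r * (inverse r * ?S (r *\<^sub>R x))"
      using r le[of "inverse r" "r *\<^sub>R x"] by (intro mult_left_mono) auto
    then show ?thesis using le[OF r, of x] r by (simp add: field_simps)
  qed
qed

text \<open>The competitor \<open>t = 1\<close> in the shift along \<open>y\<close> is the reverse
  of subadditivity.\<close>

lemma minimal_sublinear_additive: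
  assumes P: "sublinear P"
    and min: "\<And>Q. sublinear Q \<Longrightarrow> Q \<le> P \<Longrightarrow> Q = P"
  shows "P (x + y) = P x + P y"
proof -
  have "sublinear_shift P y = P"
    by (rule min) (auto simp: le_fun_def sublinear_sublinear_shift[OF P] sublinear_shift_le_self[OF P])
  then have "P x \<le> P (x + y) - P y"
    using sublinear_shift_le[OF P, of 1 y x] by simp
  with sublinear_add[OF P, of x y] show ?thesis by simp
qed

text \<open>Homogeneity survives any infimum, subadditivity does not: near-minimisers
  \<open>P\<close> at \<open>x\<close> and \<open>Q\<close> at \<open>y\<close> have to be replaced
  by a single functional, and in a chain the smaller of the two serves.\<close>

lemma sublinear_INF_chain:
  fixes C :: "('a::real_vector \<Rightarrow> real) set"
  assumes ne: "C \<noteq> {}" and sub: "\<And>P. P \<in> C \<Longrightarrow> sublinear P"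
    and chain: "\<And>P Q. P \<in> C \<Longrightarrow> Q \<in> C \<Longrightarrow> P \<le> Q \<or> Q \<le> P"
    and bdd: "\<And>x. bdd_below ((\<lambda>P. P x) ` C)"
  shows "sublinear (\<lambda>x. INF P\<in>C. P x)"
  unfolding sublinear_def
proof (intro conjI allI impI)
  let ?I = "\<lambda>x. INF P\<in>C. P x"
  have low: "?I x \<le> P x" if "P \<in> C" for P x
    using that bdd by (intro cINF_lower)
  have approx: "\<exists>P\<in>C. P x < ?I x + e" if "e > 0" for x e
  proof -
    have "?I x < ?I x + e" using that by simp
    then show ?thesis by (subst (asm) cINF_less_iff[OF ne bdd])
  qed
  fix x y
  show "?I (x + y) \<le> ?I x + ?I y"
  proof (rule field_le_epsilon)
    fix e :: real assume "e > 0"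
    then obtain P Q where P: "P \<in> C" "P x < ?I x + e / 2" and Q: "Q \<in> C" "Q y < ?I y + e / 2"
      using approx[of "e / 2" x] approx[of "e / 2" y] by auto
    obtain R where R: "R \<in> C" "R \<le> P" "R \<le> Q"
      using chain[OF P(1) Q(1)] P Q by auto
    have "?I (x + y) \<le> R x + R y"
      using low[OF R(1), of "x + y"] sublinear_add[OF sub[OF R(1)], of x y] by simp
    also have "\<dots> \<le> P x + Q y"
      using R by (intro add_mono) (auto simp: le_fun_def)
    finally show "?I (x + y) \<le> ?I x + ?I y + e" using P Q by simp
  qed
next
  fix r :: real and x assume r: "0 \<le> r"
  have "(INF P\<in>C. P (r *\<^sub>R x)) = (INF P\<in>C. r * P x)"
    using sub r by (intro INF_cong refl) (simp add: sublinear_scale)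
  also have "\<dots> = r * (INF P\<in>C. P x)"
  proof (cases "r = 0")
    case True then show ?thesis using ne by simp
  next
    case False
    with r have r: "0 < r" by simp
    have "(INF P\<in>C. r * P x) = Inf ((\<lambda>u. r * u) ` (\<lambda>P. P x) ` C)"
      by (simp add: image_image)
    also have "\<dots> = r * Inf ((\<lambda>P. P x) ` C)"
      using r bdd ne
      by (intro continuous_at_Inf_mono[symmetric]) (auto simp: mono_def intro!: continuous_intros)
    finally show ?thesis .
  qed
  finally show "(INF P\<in>C. P (r *\<^sub>R x)) = r * (INF P\<in>C. P x)" .
qed

text \<open>A minimal sublinear functional below \<open>P\<close> is additive, additivity makes it
  odd, and oddness extends homogeneity to negative scalars.\<close>

lemma ex_linear_le_sublinear:
  fixes P :: "'a::real_vector \<Rightarrow> real"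
  assumes P: "sublinear P"
  shows "\<exists>f. linear f \<and> (\<forall>x. f x \<le> P x)"
proof -
  define A where "A = {Q. sublinear Q \<and> Q \<le> P}"
  have "\<exists>m\<in>A. \<forall>a\<in>A. a \<le> m \<longrightarrow> a = m"
  \<comment> \<open>Zorn's lemma delivers a maximal element, so the order is reversed; the bound of
    a chain is then its pointwise infimum.\<close>
  proof (rule predicate_Zorn[of A "\<lambda>a b. b \<le> a"])
    show "partial_order_on A (relation_of (\<lambda>a b. b \<le> a) A)"
      by (rule partial_order_on_relation_ofI) auto
    fix C assume C: "C \<in> Chains (relation_of (\<lambda>a b. b \<le> a) A)"
    then have CA: "C \<subseteq> A" and chain: "\<And>a b. a \<in> C \<Longrightarrow> b \<in> C \<Longrightarrow> a \<le> b \<or> b \<le> a"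
      unfolding Chains_def relation_of_def by blast+
    show "\<exists>u\<in>A. \<forall>a\<in>C. u \<le> a"
    proof (cases "C = {}")
      case True then show ?thesis using P by (auto simp: A_def)
    next
      case False
      \<comment> \<open>From \<open>Q \<le> P\<close> an upper bound for \<open>Q (- x)\<close>
        follows, hence a lower bound for \<open>Q x\<close> that is independent of
        \<open>Q\<close>.\<close>
      have bdd: "bdd_below ((\<lambda>Q. Q x) ` C)" for x
      proof (rule bdd_belowI2)
        fix Q assume "Q \<in> C"
        with CA have "sublinear Q" "Q (- x) \<le> P (- x)" by (auto simp: A_def le_fun_def)
        then show "- P (- x) \<le> Q x" using sublinear_uminus[of Q x] by simp
      qed
      let ?I = "\<lambda>x. INF Q\<in>C. Q x"
      have "sublinear ?I"
        by (rule sublinear_INF_chain[OF False _ chain bdd]) (use CA in \<open>auto simp: A_def\<close>)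
      moreover have low: "\<forall>a\<in>C. ?I \<le> a"
        by (auto simp: le_fun_def intro!: cINF_lower bdd)
      moreover have "?I \<le> P"
      proof -
        obtain Q where "Q \<in> C" using False by auto
        with low CA have "?I \<le> Q" "Q \<le> P" by (auto simp: A_def)
        then show ?thesis by (rule order_trans)
      qed
      ultimately show ?thesis by (intro bexI[of _ ?I]) (auto simp: A_def)
    qed
  qed
  then obtain m where m: "sublinear m" "m \<le> P" and min: "\<And>a. a \<in> A \<Longrightarrow> a \<le> m \<Longrightarrow> a = m"
    by (auto simp: A_def)
  have add: "m (x + y) = m x + m y" for x y
    by (rule minimal_sublinear_additive[OF m(1)])
      (use m in \<open>auto intro!: min simp: A_def intro: order_trans\<close>)
  have neg: "m (- x) = - m x" for x
    using add[of x "- x"] sublinear_zero[OF m(1)] by simp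
  have "linear m"
  proof (rule linearI)
    fix r :: real and x
    show "m (r *\<^sub>R x) = r *\<^sub>R m x"
    proof (cases "0 \<le> r")
      case True then show ?thesis by (simp add: sublinear_scale[OF m(1)])
    next
      case False
      then have "m ((- r) *\<^sub>R x) = (- r) * m x" by (intro sublinear_scale m) auto
      then show ?thesis using neg[of "r *\<^sub>R x"] by simp
    qed
  qed (rule add)
  with m(2) show ?thesis by (auto simp: le_fun_def)
qed

text \<open>The linear minorant is taken of the shifted norm rather than of the norm itself. At
  \<open>- y\<close> the competitor \<open>t = 1\<close> has the value \<open>0 - norm y\<close>, so
  \<open>f (- y) \<le> - norm y\<close>, which forces \<open>f y = norm y\<close>.\<close>

lemma ex_real_norming_functional:
  fixes y :: "'a::real_normed_vector"
  shows "\<exists>f. linear f \<and> (\<forall>x. f x \<le> norm x) \<and> f y = norm y"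
proof -
  have N: "sublinear (norm :: 'a \<Rightarrow> real)"
    by (auto simp: sublinear_def norm_triangle_ineq)
  obtain f where f: "linear f" "\<And>x. f x \<le> sublinear_shift norm y x"
    using ex_linear_le_sublinear[OF sublinear_sublinear_shift[OF N]] by blast
  have le: "f x \<le> norm x" for x
    using f(2)[of x] sublinear_shift_le_self[OF N, of y x] by simp
  have "f (- y) \<le> - norm y"
    using f(2)[of "- y"] sublinear_shift_le[OF N, of 1 y "- y"] by simp
  then have "norm y \<le> f y" by (simp add: linear_neg[OF f(1)])
  with le[of y] have "f y = norm y" by simp
  with f(1) le show ?thesis by blast
qed

section \<open>Bounded complex-linear functionals\<close>

lemma cblinfun_apply_add: "cblinfun_apply f (x + y) = cblinfun_apply f x + cblinfun_apply f y"
  by transfer (rule blinfun.add_right)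

lemma cblinfun_apply_scaleC: "cblinfun_apply f (c *\<^sub>C x) = c *\<^sub>C cblinfun_apply f x"
  by transfer simp

lemma bounded_linear_cblinfun_apply: "bounded_linear (cblinfun_apply f)"
  by transfer (rule blinfun.bounded_linear_right)

lemma norm_cblinfun_apply_le: "norm (cblinfun_apply f x) \<le> norm f * norm x"
  by transfer (rule norm_blinfun)

lemma scaleC_minus_left: "(- a) *\<^sub>C x = - (a *\<^sub>C (x::'a::complex_normed_vector))"
proof -
  have "(-1) *\<^sub>C (a *\<^sub>C x) = (- 1) *\<^sub>R (a *\<^sub>C x)"
    unfolding scaleR_scaleC by simp
  then show ?thesis by (simp add: scaleC_scaleC)
qed

text \<open>Bohnenblust-Sobczyk complexification: a complex functional is determined by its real
  part \<open>f\<close>, namely as \<open>f x - \<i> * f (\<i> *\<^sub>C x)\<close>, and the passage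
  from \<open>f\<close> to it does not enlarge the norm.\<close>

theorem ex_norming_functional:
  fixes y :: "'a::complex_normed_vector"
  shows "\<exists>\<phi>::'a cdual. norm \<phi> \<le> 1 \<and> cblinfun_apply \<phi> y = complex_of_real (norm y)"
proof -
  obtain f :: "'a \<Rightarrow> real" where f: "linear f" "\<And>x. f x \<le> norm x" "f y = norm y"
    using ex_real_norming_functional[of y] by blast
  define h where "h x = Complex (f x) (- f (\<i> *\<^sub>C x))" for x
  have i_scaleR: "\<i> *\<^sub>C (r *\<^sub>R x) = r *\<^sub>R (\<i> *\<^sub>C x)" for r and x :: 'a
    by (rule scaleC_scaleR_commute)
  have h_add: "h (x + z) = h x + h z" for x z
    by (simp add: h_def scaleC_add_right linear_add[OF f(1)] complex_eq_iff)
  have h_scaleR: "h (r *\<^sub>R x) = r *\<^sub>R h x" for r x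
    by (simp add: h_def i_scaleR linear_scale[OF f(1)] complex_eq_iff)
  have h_i: "h (\<i> *\<^sub>C x) = \<i> * h x" for x
    by (simp add: h_def scaleC_scaleC scaleC_minus_left scaleC_one linear_neg[OF f(1)] complex_eq_iff)
  have h_scaleC: "h (c *\<^sub>C x) = c * h x" for c x
  proof -
    have "c *\<^sub>C x = (complex_of_real (Re c) + \<i> * complex_of_real (Im c)) *\<^sub>C x"
      using complex_eq[of c] by simp
    also have "\<dots> = Re c *\<^sub>R x + \<i> *\<^sub>C (Im c *\<^sub>R x)"
      by (simp only: scaleC_add_left scaleC_scaleC[symmetric] scaleR_scaleC)
    finally have "h (c *\<^sub>C x) = Re c *\<^sub>R h x + \<i> * (Im c *\<^sub>R h x)"
      by (simp only: h_add h_scaleR h_i)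
    also have "\<dots> = c * h x"
      by (simp add: complex_eq_iff algebra_simps)
    finally show ?thesis .
  qed
  have h_norm: "cmod (h x) \<le> norm x" for x
  proof (cases "h x = 0")
    case False
    \<comment> \<open>This scalar rotates \<open>h x\<close> onto the positive real axis, where
      \<open>h\<close> coincides with its real part \<open>f\<close>.\<close>
    define c where "c = cnj (h x) / cmod (h x)"
    have c: "cmod c = 1" using False by (simp add: c_def norm_divide)
    have "h (c *\<^sub>C x) = complex_of_real (cmod (h x))"
      using False complex_norm_square[of "h x"]
      by (simp add: h_scaleC c_def field_simps power2_eq_square)
    then have "cmod (h x) = f (c *\<^sub>C x)" by (simp add: h_def complex_eq_iff)
    also have "\<dots> \<le> norm (c *\<^sub>C x)" by (rule f)
    also have "\<dots> = norm x" by (simp add: norm_scaleC c)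
    finally show ?thesis .
  qed simp
  have bl: "bounded_linear h"
    by (rule bounded_linear_intro[where K = 1]) (simp_all add: h_add h_scaleR h_norm)
  define \<phi> where "\<phi> = Abs_cblinfun (Blinfun h)"
  have rep: "Rep_cblinfun \<phi> = Blinfun h"
    unfolding \<phi>_def
    by (rule Abs_cblinfun_inverse)
      (simp add: bounded_linear_Blinfun_apply[OF bl] h_scaleC scaleC_complex_def)
  have app: "cblinfun_apply \<phi> x = h x" for x
    by (simp add: cblinfun_apply.rep_eq rep bounded_linear_Blinfun_apply[OF bl])
  have "norm (Blinfun h) \<le> 1"
    by (rule norm_blinfun_bound) (auto simp: bounded_linear_Blinfun_apply[OF bl] h_norm)
  then have "norm \<phi> \<le> 1" by (simp add: norm_cblinfun.rep_eq rep)
  moreover have "h y = complex_of_real (norm y)"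
  proof -
    \<comment> \<open>The real part of \<open>h y\<close> already exhausts the bound
      \<open>norm y\<close> for the modulus, so the imaginary part must vanish.\<close>
    have re: "Re (h y) = norm y" by (simp add: h_def f)
    have "(cmod (h y))\<^sup>2 \<le> (norm y)\<^sup>2" by (rule power_mono[OF h_norm]) simp
    then have "(Im (h y))\<^sup>2 \<le> 0" using re by (simp add: cmod_power2)
    then have "Im (h y) = 0" by simp
    with re show ?thesis by (simp add: complex_eq_iff)
  qed
  ultimately show ?thesis using app by (intro exI[of _ \<phi>]) simp
qed

section \<open>Strongly measurable functions\<close>

abbreviation "simple_integrable \<equiv> Bochner_Integration.simple_bochner_integrable"
abbreviation "simple_Bochner_integral \<equiv> Bochner_Integration.simple_bochner_integral"

lemma simple_integrable_borel_measurable: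
  "simple_integrable M f \<Longrightarrow> f \<in> borel_measurable M"
  by (auto intro: borel_measurable_simple_function elim: simple_bochner_integrable.cases)

lemma borel_measurable_norm_compose:
  assumes "f \<in> borel_measurable M"
  shows "(\<lambda>t. norm (f t :: 'b::real_normed_vector)) \<in> borel_measurable M"
  by (rule measurable_compose[OF assms])
    (intro borel_measurable_continuous_onI continuous_intros)

lemma simple_integrable_finite_image: "simple_integrable M f \<Longrightarrow> finite (f ` space M)"
  by (auto simp: simple_function_def elim: simple_bochner_integrable.cases)

lemma simple_integrable_compose:
  assumes "h 0 = 0" "simple_integrable M f"
  shows "simple_integrable M (\<lambda>t. h (f t))"
  using simple_bochner_integrable_compose2[of "\<lambda>x y. h x" M f f] assms by simp

lemma simple_integrable_zero: "simple_integrable M (\<lambda>_. 0)"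
  by (auto simp: simple_bochner_integrable.simps)

lemma simple_integrable_add:
  "simple_integrable M f \<Longrightarrow> simple_integrable M g \<Longrightarrow> simple_integrable M (\<lambda>t. f t + g t)"
  by (rule simple_bochner_integrable_compose2[where p = "(+)"]) auto

lemma simple_integrable_diff:
  "simple_integrable M f \<Longrightarrow> simple_integrable M g \<Longrightarrow> simple_integrable M (\<lambda>t. f t - g t)"
  by (rule simple_bochner_integrable_compose2[where p = "(-)"]) auto

lemma simple_integrable_sum:
  "(\<And>i. i \<in> I \<Longrightarrow> simple_integrable M (f i)) \<Longrightarrow> simple_integrable M (\<lambda>t. \<Sum>i\<in>I. f i t)"
  by (induction I rule: infinite_finite_induct) (auto simp: simple_integrable_zero simple_integrable_add)

lemma simple_integrable_indicator:
  assumes A: "A \<in> sets M" "emeasure M A < \<infinity>"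
  shows "simple_integrable M (\<lambda>t. indicator A t *\<^sub>R x)"
proof -
  have "simple_integrable M (indicator A :: _ \<Rightarrow> real)"
  proof
    have "{y \<in> space M. indicator A y \<noteq> (0::real)} = A"
      using sets.sets_into_space[OF A(1)] by (auto split: split_indicator)
    then show "emeasure M {y \<in> space M. indicator A y \<noteq> (0::real)} \<noteq> \<infinity>"
      using A by auto
  qed (rule simple_function_indicator A)+
  then show ?thesis by (rule simple_integrable_compose[rotated]) simp
qed

lemma simple_integrable_step_function:
  "f \<in> step_functions M \<Longrightarrow> simple_integrable M f"
  unfolding step_functions_def
  by clarify (intro simple_integrable_sum simple_integrable_indicator; simp)

lemma strongly_measurable_simple: "simple_integrable M f \<Longrightarrow> strongly_measurable M f"
  unfolding strongly_measurable_def by (rule exI[of _ "\<lambda>_. f"]) auto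

text \<open>Continuity carries the a.e. limits over; \<open>h 0 0 = 0\<close> keeps the supports of
  the composed approximants of finite measure.\<close>

lemma strongly_measurable_compose2:
  assumes h: "continuous_on UNIV (\<lambda>z. h (fst z) (snd z))" "h 0 0 = 0"
    and f: "strongly_measurable M f" and g: "strongly_measurable M g"
  shows "strongly_measurable M (\<lambda>t. h (f t) (g t))"
proof -
  obtain u v where u: "\<And>i. simple_integrable M (u i)" "AE t in M. (\<lambda>i::nat. u i t) \<longlonglongrightarrow> f t"
    and v: "\<And>i. simple_integrable M (v i)" "AE t in M. (\<lambda>i::nat. v i t) \<longlonglongrightarrow> g t"
    using f g by (auto simp: strongly_measurable_def)
  have "AE t in M. (\<lambda>i. h (u i t) (v i t)) \<longlonglongrightarrow> h (f t) (g t)"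
    using u(2) v(2)
  proof eventually_elim
    fix t assume "(\<lambda>i. u i t) \<longlonglongrightarrow> f t" "(\<lambda>i. v i t) \<longlonglongrightarrow> g t"
    then have "(\<lambda>i. (u i t, v i t)) \<longlonglongrightarrow> (f t, g t)" by (rule tendsto_Pair)
    from continuous_on_tendsto_compose[OF h(1) this]
    show "(\<lambda>i. h (u i t) (v i t)) \<longlonglongrightarrow> h (f t) (g t)" by simp
  qed
  then show ?thesis
    unfolding strongly_measurable_def
    by (intro exI[of _ "\<lambda>i t. h (u i t) (v i t)"] conjI allI
        simple_bochner_integrable_compose2[where p = h] u v h(2))
qed

lemma strongly_measurable_compose:
  assumes "continuous_on UNIV h" "h 0 = 0" "strongly_measurable M f"
  shows "strongly_measurable M (\<lambda>t. h (f t))"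
  by (rule strongly_measurable_compose2[where h = "\<lambda>x y. h x" and g = f])
    (use assms in \<open>auto intro!: continuous_on_compose2[OF assms(1)] continuous_intros\<close>)

lemma strongly_measurable_add:
  "strongly_measurable M f \<Longrightarrow> strongly_measurable M g \<Longrightarrow> strongly_measurable M (\<lambda>t. f t + g t)"
  by (rule strongly_measurable_compose2[where h = "(+)"]) (auto intro!: continuous_intros)

lemma strongly_measurable_diff:
  "strongly_measurable M f \<Longrightarrow> strongly_measurable M g \<Longrightarrow> strongly_measurable M (\<lambda>t. f t - g t)"
  by (rule strongly_measurable_compose2[where h = "(-)"]) (auto intro!: continuous_intros)

lemma strongly_measurable_scaleR:
  "strongly_measurable M f \<Longrightarrow> strongly_measurable M g \<Longrightarrow> strongly_measurable M (\<lambda>t. f t *\<^sub>R g t)"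
  by (rule strongly_measurable_compose2[where h = "(*\<^sub>R)"]) (auto intro!: continuous_intros)

lemma strongly_measurable_bounded_linear:
  "bounded_linear T \<Longrightarrow> strongly_measurable M f \<Longrightarrow> strongly_measurable M (\<lambda>t. T (f t))"
  by (rule strongly_measurable_compose)
    (auto simp: linear_simps intro: linear_continuous_on bounded_linear.linear linear_0)

lemma strongly_measurable_zero: "strongly_measurable M (\<lambda>_. 0)"
  by (rule strongly_measurable_simple[OF simple_integrable_zero])

lemma strongly_measurable_sum:
  "(\<And>i. i \<in> I \<Longrightarrow> strongly_measurable M (f i)) \<Longrightarrow> strongly_measurable M (\<lambda>t. \<Sum>i\<in>I. f i t)"
  by (induction I rule: infinite_finite_induct)
    (auto simp: strongly_measurable_zero strongly_measurable_add)

text \<open>Completeness makes a.e. modifications and a.e. limits of measurable functions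
  measurable; sigma-finiteness supplies the sets of finite measure that support the
  approximants.\<close>

locale complete_sigma_finite_measure = complete_measure M + sigma_finite_measure M
  for M :: "'t measure"
begin

lemma borel_measurable_cong_AE:
  fixes f g :: "'t \<Rightarrow> 'b::topological_space"
  assumes f: "f \<in> borel_measurable M" and eq: "AE t in M. f t = g t"
  shows "g \<in> borel_measurable M"
proof (rule measurableI)
  fix A :: "'b set" assume "A \<in> sets borel"
  then have A: "f -` A \<inter> space M \<in> sets M" by (rule measurable_sets[OF f])
  show "g -` A \<inter> space M \<in> sets M"
  proof (rule in_sets_AE[OF _ A])
    show "AE t in M. t \<in> f -` A \<inter> space M \<longleftrightarrow> t \<in> g -` A \<inter> space M"
      using eq by eventually_elim auto
  qed simp
qed simp

lemma borel_measurable_AE_LIMSEQ: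
  fixes f :: "'t \<Rightarrow> 'b::{metric_space,zero}"
  assumes s: "\<And>i::nat. s i \<in> borel_measurable M" and lim: "AE t in M. (\<lambda>i. s i t) \<longlonglongrightarrow> f t"
  shows "f \<in> borel_measurable M"
proof -
  from lim obtain N where N: "N \<in> null_sets M" "{t \<in> space M. \<not> (\<lambda>i. s i t) \<longlonglongrightarrow> f t} \<subseteq> N"
    by (auto simp: eventually_ae_filter)
  have Ns: "N \<in> sets M" using N(1) by auto
  have "(\<lambda>t. if t \<in> N then 0 else f t) \<in> borel_measurable M"
  proof (rule borel_measurable_LIMSEQ_metric)
    show "(\<lambda>t. if t \<in> N then 0 else s i t) \<in> borel_measurable M" for i
      using Ns s by (intro measurable_If_set) (auto intro: sets.Int)
    fix t assume "t \<in> space M"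
    then show "(\<lambda>i. if t \<in> N then 0 else s i t) \<longlonglongrightarrow> (if t \<in> N then 0 else f t)"
      using N(2) by auto
  qed
  moreover have "AE t in M. (if t \<in> N then 0 else f t) = f t"
    using AE_not_in[OF N(1)] by eventually_elim simp
  ultimately show ?thesis by (rule borel_measurable_cong_AE)
qed

text \<open>One half of Pettis' measurability theorem: \<open>s n t\<close> is a nearest point to
  \<open>f t\<close> among the first \<open>n + 1\<close> members of an enumeration of
  \<open>D\<close> and 0, cut off outside a set of finite measure.\<close>

lemma strongly_measurableI:
  fixes f :: "'t \<Rightarrow> 'b::real_normed_vector"
  assumes f: "f \<in> borel_measurable M" and D: "countable D" "AE t in M. f t \<in> closure D"
  shows "strongly_measurable M f"
proof -
  obtain A :: "nat \<Rightarrow> 't set" where A: "range A \<subseteq> sets M" "(\<Union>i. A i) = space M"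
      "\<And>i. emeasure M (A i) \<noteq> \<infinity>" "incseq A"
    using sigma_finite_incseq by blast
  \<comment> \<open>Inserting 0 makes the set nonempty, hence the range of a sequence; an extra
    point cannot worsen the approximation.\<close>
  define d where "d = from_nat_into (insert 0 D)"
  have ranged: "range d = insert 0 D"
    unfolding d_def using D(1) by (intro range_from_nat_into) auto
  define r where "r i t = dist (f t) (d i)" for i t
  have r[measurable]: "r i \<in> borel_measurable M" for i
    unfolding r_def
    by (rule measurable_compose[OF f]) (intro borel_measurable_continuous_onI continuous_intros)
  \<comment> \<open>Ties between equally near points are broken by the least index, which makes the
    choice measurable in \<open>t\<close>.\<close>
  define j where "j n t = (LEAST j. j \<le> n \<and> (\<forall>i\<in>{..n}. r j t \<le> r i t))" for n t
  have j: "j n t \<le> n \<and> (\<forall>i\<in>{..n}. r (j n t) t \<le> r i t)" for n t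
    unfolding j_def
  proof (rule LeastI_ex)
    have "Min ((\<lambda>i. r i t) ` {..n}) \<in> (\<lambda>i. r i t) ` {..n}" by (rule Min_in) auto
    then obtain k where "k \<le> n" "Min ((\<lambda>i. r i t) ` {..n}) = r k t"
      by (elim imageE) (simp only: atMost_iff)
    then show "\<exists>j. j \<le> n \<and> (\<forall>i\<in>{..n}. r j t \<le> r i t)"
      by (intro exI[of _ k]) (metis Min_le finite_atMost finite_imageI image_eqI)
  qed
  have jm[measurable]: "j n \<in> measurable M (count_space UNIV)" for n
    unfolding j_def by measurable
  define s where "s n t = (if t \<in> A n then d (j n t) else 0)" for n t
  have Am[measurable]: "A n \<in> sets M" for n using A(1) by auto
  have "simple_integrable M (s n)" for n
  proof
    have "s n \<in> measurable M (count_space UNIV)"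
      unfolding s_def by measurable
    moreover have "finite (s n ` space M)"
      by (rule finite_subset[of _ "insert 0 (d ` {..n})"]) (use j in \<open>auto simp: s_def\<close>)
    ultimately show "simple_function M (s n)"
      unfolding simple_function_def by (auto intro: measurable_sets)
    have "emeasure M {y \<in> space M. s n y \<noteq> 0} \<le> emeasure M (A n)"
      by (rule emeasure_mono) (auto simp: s_def split: if_splits)
    then show "emeasure M {y \<in> space M. s n y \<noteq> 0} \<noteq> \<infinity>"
      using A(3)[of n] by (auto simp: top_unique)
  qed
  moreover have "AE t in M. (\<lambda>n. s n t) \<longlonglongrightarrow> f t"
    using D(2) AE_space
  proof eventually_elim
    fix t assume t: "f t \<in> closure D" "t \<in> space M"
    obtain n0 where n0: "t \<in> A n0" using A(2) t(2) by auto
    show "(\<lambda>n. s n t) \<longlonglongrightarrow> f t"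
    proof (rule tendstoI)
      fix e :: real assume "e > 0"
      then obtain y where "y \<in> D" "dist y (f t) < e"
        using t(1) by (auto simp: closure_approachable)
      then obtain i0 where i0: "r i0 t < e"
        using ranged by (metis dist_commute insertI2 r_def rangeE)
      show "\<forall>\<^sub>F n in sequentially. dist (s n t) (f t) < e"
        using eventually_ge_at_top[of n0] eventually_ge_at_top[of i0]
      proof eventually_elim
        fix n assume n: "n0 \<le> n" "i0 \<le> n"
        then have "t \<in> A n" using A(4) n0 by (auto simp: incseq_def)
        then have "dist (s n t) (f t) = r (j n t) t" by (simp add: s_def r_def dist_commute)
        also have "\<dots> \<le> r i0 t" using j[of n t] n by auto
        finally show "dist (s n t) (f t) < e" using i0 by simp
      qed
    qed
  qed
  ultimately show ?thesis unfolding strongly_measurable_def by blast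
qed

lemma strongly_measurable_borel:
  fixes f :: "'t \<Rightarrow> 'b::real_normed_vector"
  assumes "strongly_measurable M f"
  shows "f \<in> borel_measurable M"
proof -
  obtain s where s: "\<And>i. simple_integrable M (s i)" "AE t in M. (\<lambda>i::nat. s i t) \<longlonglongrightarrow> f t"
    using assms by (auto simp: strongly_measurable_def)
  show ?thesis
    by (rule borel_measurable_AE_LIMSEQ[OF simple_integrable_borel_measurable[OF s(1)] s(2)])
qed

text \<open>The other half of Pettis' theorem: the approximants have finite ranges, and the union of
  these is countable.\<close>

lemma strongly_measurable_separable:
  fixes f :: "'t \<Rightarrow> 'b::real_normed_vector"
  assumes "strongly_measurable M f"
  shows "\<exists>D. countable D \<and> (AE t in M. f t \<in> closure D)"
proof -
  obtain s where s: "\<And>i. simple_integrable M (s i)" "AE t in M. (\<lambda>i::nat. s i t) \<longlonglongrightarrow> f t"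
    using assms by (auto simp: strongly_measurable_def)
  let ?D = "\<Union>i. s i ` space M"
  have "countable ?D"
    by (intro countable_UN countableI_type countable_finite simple_integrable_finite_image s(1))
  moreover have "AE t in M. f t \<in> closure ?D"
    using s(2) AE_space
  proof eventually_elim
    fix t assume "(\<lambda>i. s i t) \<longlonglongrightarrow> f t" "t \<in> space M"
    then show "f t \<in> closure ?D"
      unfolding closure_sequential by (intro exI[of _ "\<lambda>i. s i t"]) auto
  qed
  ultimately show ?thesis by blast
qed

text \<open>With Pettis' criterion no diagonal sequence of simple functions has to be built: Borel
  measurability and an essentially separable range both pass to a.e. limits, the latter by uniting
  the countable sets.\<close>

lemma strongly_measurable_LIMSEQ:
  fixes f :: "'t \<Rightarrow> 'b::real_normed_vector"
  assumes s: "\<And>i::nat. strongly_measurable M (s i)" and lim: "AE t in M. (\<lambda>i. s i t) \<longlonglongrightarrow> f t"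
  shows "strongly_measurable M f"
proof -
  have "\<forall>i. \<exists>D. countable D \<and> (AE t in M. s i t \<in> closure D)"
    using strongly_measurable_separable[OF s] by blast
  then obtain D where D: "\<And>i. countable (D i)" "\<And>i. AE t in M. s i t \<in> closure (D i)"
    by metis
  have "AE t in M. \<forall>i. s i t \<in> closure (D i)"
    using D(2) by (subst AE_all_countable) auto
  then have "AE t in M. f t \<in> closure (\<Union>i. D i)"
    using lim
  proof eventually_elim
    fix t assume t: "\<forall>i. s i t \<in> closure (D i)" and lim: "(\<lambda>i. s i t) \<longlonglongrightarrow> f t"
    have "s i t \<in> closure (\<Union>i. D i)" for i
      using t closure_mono[of "D i" "\<Union>i. D i"] by blast
    with lim show "f t \<in> closure (\<Union>i. D i)"
      using closed_sequentially[of "closure (\<Union>i. D i)" "\<lambda>i. s i t"] by auto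
  qed
  then show ?thesis
    using D(1) borel_measurable_AE_LIMSEQ[OF strongly_measurable_borel[OF s] lim]
    by (intro strongly_measurableI[of f "\<Union>i. D i"]) auto
qed

lemma strongly_measurable_second_countable:
  fixes f :: "'t \<Rightarrow> 'b::{real_normed_vector,second_countable_topology}"
  assumes "f \<in> borel_measurable M"
  shows "strongly_measurable M f"
proof -
  obtain D :: "'b set" where D: "countable D" "\<And>X. open X \<Longrightarrow> X \<noteq> {} \<Longrightarrow> \<exists>d\<in>D. d \<in> X"
    by (erule countable_dense_setE)
  have "x \<in> closure D" for x
    unfolding closure_approachable using D(2)[of "ball x e" for e]
    by (metis ball_eq_empty dist_commute linorder_not_le mem_ball open_ball)
  with assms D(1) show ?thesis by (intro strongly_measurableI) auto
qed

lemma strongly_measurable_norm_borel: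
  "strongly_measurable M f \<Longrightarrow> (\<lambda>t. norm (f t)) \<in> borel_measurable M"
  by (intro borel_measurable_norm_compose strongly_measurable_borel)

text \<open>Approximants are set to 0 wherever they exceed \<open>2 * norm (f t)\<close>. Where
  \<open>f t \<noteq> 0\<close> this eventually changes nothing, since \<open>norm (u i t)\<close>
  tends to \<open>norm (f t)\<close>; where \<open>f t = 0\<close> only the correct value 0 is left.
  The result is made for dominated convergence.\<close>

lemma strongly_measurable_dominated_approximation:
  assumes f: "strongly_measurable M f"
  shows "\<exists>s. (\<forall>i::nat. simple_integrable M (s i)) \<and> (AE t in M. (\<lambda>i. s i t) \<longlonglongrightarrow> f t) \<and>
    (\<forall>i t. norm (s i t) \<le> 2 * norm (f t))"
proof -
  obtain u where u: "\<And>i. simple_integrable M (u i)" "AE t in M. (\<lambda>i::nat. u i t) \<longlonglongrightarrow> f t"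
    using f by (auto simp: strongly_measurable_def)
  define s where "s i t = (if norm (u i t) \<le> 2 * norm (f t) then u i t else 0)" for i t
  have fm[measurable]: "(\<lambda>t. norm (f t)) \<in> borel_measurable M"
    by (rule strongly_measurable_norm_borel[OF f])
  have "simple_integrable M (s i)" for i
  proof
    have sf: "simple_function M (u i)" "emeasure M {y \<in> space M. u i y \<noteq> 0} \<noteq> \<infinity>"
      using u(1)[of i] by (auto elim: simple_bochner_integrable.cases)
    have [measurable]: "u i \<in> measurable M (count_space UNIV)"
      by (rule measurable_simple_function[OF sf(1)])
    have [measurable]: "(\<lambda>t. norm (u i t)) \<in> borel_measurable M"
      by (intro borel_measurable_norm_compose simple_integrable_borel_measurable u)
    have "s i \<in> measurable M (count_space UNIV)"
      unfolding s_def by measurable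
    moreover have "finite (s i ` space M)"
      by (rule finite_subset[of _ "insert 0 (u i ` space M)"])
        (use simple_integrable_finite_image[OF u(1)] in \<open>auto simp: s_def\<close>)
    ultimately show "simple_function M (s i)"
      unfolding simple_function_def by (auto intro: measurable_sets)
    have "emeasure M {y \<in> space M. s i y \<noteq> 0} \<le> emeasure M {y \<in> space M. u i y \<noteq> 0}"
      by (rule emeasure_mono) (auto simp: s_def split: if_splits)
    then show "emeasure M {y \<in> space M. s i y \<noteq> 0} \<noteq> \<infinity>"
      using sf(2) by (auto simp: top_unique)
  qed
  moreover have "AE t in M. (\<lambda>i. s i t) \<longlonglongrightarrow> f t"
    using u(2)
  proof eventually_elim
    fix t assume lim: "(\<lambda>i. u i t) \<longlonglongrightarrow> f t"
    show "(\<lambda>i. s i t) \<longlonglongrightarrow> f t"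
    proof (cases "f t = 0")
      case True
      then have "s i t = 0" for i by (simp add: s_def)
      with True show ?thesis by simp
    next
      case False
      then have "norm (f t) < 2 * norm (f t)" by simp
      then have "\<forall>\<^sub>F i in sequentially. norm (u i t) < 2 * norm (f t)"
        using order_tendstoD(2)[OF tendsto_norm[OF lim]] by blast
      then have "\<forall>\<^sub>F i in sequentially. u i t = s i t"
        by eventually_elim (simp add: s_def)
      then show ?thesis by (rule Lim_transform_eventually[OF lim])
    qed
  qed
  moreover have "norm (s i t) \<le> 2 * norm (f t)" for i t
    by (simp add: s_def)
  ultimately show ?thesis by blast
qed

end

section \<open>Bochner spaces\<close>

text \<open>The \<open>p\<close>-th power of the norm, kept free of roots of extended reals. A
  quasi-triangle inequality with factor \<open>2 powr p\<close> then stands in for Minkowski's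
  inequality in arguments about convergence to 0.\<close>

definition power_integral :: "'t measure \<Rightarrow> real \<Rightarrow> ('t \<Rightarrow> 'b::real_normed_vector) \<Rightarrow> ennreal" where
  "power_integral M p f = (\<integral>\<^sup>+ t. ennreal (norm (f t) powr p) \<partial>M)"

lemma Lp_norm_le_iff:
  assumes p: "0 < p" and c: "0 \<le> c"
  shows "Lp_norm M p f \<le> ennreal c \<longleftrightarrow> power_integral M p f \<le> ennreal (c powr p)"
proof (cases "power_integral M p f")
  case (real r)
  have "Lp_norm M p f = ennreal (r powr (1 / p))"
    using real by (simp add: Lp_norm_def power_integral_def[symmetric])
  moreover have "r powr (1 / p) \<le> c \<longleftrightarrow> r \<le> c powr p"
  proof
    assume "r powr (1 / p) \<le> c"
    then have "(r powr (1 / p)) powr p \<le> c powr p"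
      using p by (intro powr_mono2) auto
    then show "r \<le> c powr p" using p real by (simp add: powr_powr)
  next
    assume "r \<le> c powr p"
    then have "r powr (1 / p) \<le> (c powr p) powr (1 / p)"
      using p real by (intro powr_mono2) auto
    then show "r powr (1 / p) \<le> c" using p c by (simp add: powr_powr)
  qed
  ultimately show ?thesis using real c by (simp add: ennreal_le_iff)
next
  case top
  then show ?thesis by (simp add: Lp_norm_def power_integral_def[symmetric] top_unique)
qed

lemma Lp_norm_less_top_iff: "Lp_norm M p f < \<infinity> \<longleftrightarrow> power_integral M p f < \<infinity>"
  by (simp add: Lp_norm_def power_integral_def[symmetric] less_top[symmetric] Let_def)

lemma Lp_space_iff:
  "f \<in> Lp_space M p \<longleftrightarrow> strongly_measurable M f \<and> power_integral M p f < \<infinity>"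
  by (simp only: Lp_space_def Lp_norm_less_top_iff mem_Collect_eq)

lemma power_integral_cong_AE:
  "AE t in M. f t = g t \<Longrightarrow> power_integral M p f = power_integral M p g"
  unfolding power_integral_def by (rule nn_integral_cong_AE) auto

lemma power_integral_minus_commute:
  "power_integral M p (\<lambda>t. f t - g t) = power_integral M p (\<lambda>t. g t - f t)"
  by (simp add: power_integral_def norm_minus_commute)

lemma power_integral_simple_finite:
  assumes f: "simple_integrable M f" and p: "0 < p"
  shows "power_integral M p f < \<infinity>"
proof -
  have "simple_integrable M (\<lambda>t. norm (f t) powr p)"
    by (rule simple_integrable_compose[where h = "\<lambda>x. norm x powr p"]) (use f p in auto)
  from simple_bochner_integral_eq_nn_integral[OF this] show ?thesis
    unfolding power_integral_def by (metis ennreal_less_top infinity_ennreal_def powr_ge_zero)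
qed

lemma powr_add_le:
  fixes a b :: real
  assumes "0 \<le> a" "0 \<le> b" "0 < p"
  shows "(a + b) powr p \<le> 2 powr p * (a powr p + b powr p)"
proof -
  have "(a + b) powr p \<le> (2 * max a b) powr p"
    using assms by (intro powr_mono2) auto
  also have "\<dots> = 2 powr p * (max a b powr p)"
    using assms by (simp add: powr_mult)
  also have "\<dots> \<le> 2 powr p * (a powr p + b powr p)"
    by (intro mult_left_mono) (auto simp: max_def)
  finally show ?thesis .
qed

section \<open>Limits, density and completeness for power integrals\<close>

context complete_sigma_finite_measure
begin

lemma strongly_measurable_norm_powr:
  "strongly_measurable M f \<Longrightarrow> (\<lambda>t. ennreal (norm (f t) powr p)) \<in> borel_measurable M"
  using strongly_measurable_norm_borel[of f] by measurable

lemma power_integral_add_le: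
  assumes f: "strongly_measurable M f" and g: "strongly_measurable M g" and p: "0 < p"
  shows "power_integral M p (\<lambda>t. f t + g t)
    \<le> ennreal (2 powr p) * (power_integral M p f + power_integral M p g)"
proof -
  note fm = strongly_measurable_norm_powr[OF f, of p] and gm = strongly_measurable_norm_powr[OF g, of p]
  have "power_integral M p (\<lambda>t. f t + g t)
      \<le> (\<integral>\<^sup>+ t. ennreal (2 powr p) * (ennreal (norm (f t) powr p) + ennreal (norm (g t) powr p)) \<partial>M)"
    unfolding power_integral_def
  proof (rule nn_integral_mono)
    fix t
    have "norm (f t + g t) powr p \<le> (norm (f t) + norm (g t)) powr p"
      using p by (intro powr_mono2 norm_triangle_ineq) auto
    also have "\<dots> \<le> 2 powr p * (norm (f t) powr p + norm (g t) powr p)"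
      using p by (intro powr_add_le) auto
    finally show "ennreal (norm (f t + g t) powr p)
        \<le> ennreal (2 powr p) * (ennreal (norm (f t) powr p) + ennreal (norm (g t) powr p))"
      by (simp add: ennreal_leI flip: ennreal_mult' ennreal_plus)
  qed
  also have "\<dots> = ennreal (2 powr p) * (power_integral M p f + power_integral M p g)"
    by (simp only: power_integral_def nn_integral_cmult[OF borel_measurable_add[OF fm gm]]
        nn_integral_add[OF fm gm])
  finally show ?thesis .
qed

lemma power_integral_diff_le:
  assumes "strongly_measurable M f" "strongly_measurable M g" "strongly_measurable M h" "0 < p"
  shows "power_integral M p (\<lambda>t. f t - h t)
    \<le> ennreal (2 powr p) * (power_integral M p (\<lambda>t. f t - g t) + power_integral M p (\<lambda>t. g t - h t))"
  using power_integral_add_le[of "\<lambda>t. f t - g t" "\<lambda>t. g t - h t" p] assms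
  by (simp add: strongly_measurable_diff)

lemma power_integral_eq_0_AE:
  assumes f: "strongly_measurable M f" and "power_integral M p f = 0"
  shows "AE t in M. f t = 0"
proof -
  have "AE t in M. ennreal (norm (f t) powr p) = 0"
    using assms nn_integral_0_iff_AE[OF strongly_measurable_norm_powr[OF f, of p]]
    by (simp add: power_integral_def)
  then show ?thesis by eventually_elim simp
qed

text \<open>Sharp constants pass to limits through this lemma; the quasi-triangle inequality would
  lose a factor.\<close>

lemma power_integral_Fatou:
  assumes s: "\<And>i::nat. strongly_measurable M (s i)" and lim: "AE t in M. (\<lambda>i. s i t) \<longlonglongrightarrow> f t"
    and p: "0 < p" and bound: "\<forall>\<^sub>F i in sequentially. power_integral M p (s i) \<le> C"
  shows "power_integral M p f \<le> C"
proof -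
  have "power_integral M p f = (\<integral>\<^sup>+ t. liminf (\<lambda>i. ennreal (norm (s i t) powr p)) \<partial>M)"
    unfolding power_integral_def
  proof (rule nn_integral_cong_AE, use lim in eventually_elim)
    fix t assume "(\<lambda>i. s i t) \<longlonglongrightarrow> f t"
    then have "(\<lambda>i. ennreal (norm (s i t) powr p)) \<longlonglongrightarrow> ennreal (norm (f t) powr p)"
      using p by (intro tendsto_ennrealI tendsto_powr' tendsto_norm tendsto_const) auto
    then show "ennreal (norm (f t) powr p) = liminf (\<lambda>i. ennreal (norm (s i t) powr p))"
      using lim_imp_Liminf[OF sequentially_bot] by metis
  qed
  also have "\<dots> \<le> liminf (\<lambda>i. power_integral M p (s i))"
    unfolding power_integral_def
    by (rule nn_integral_liminf) (rule strongly_measurable_norm_powr[OF s])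
  also have "\<dots> \<le> liminf (\<lambda>i::nat. C)"
    by (rule Liminf_mono[OF bound])
  also have "\<dots> = C" by (simp add: Liminf_const)
  finally show ?thesis .
qed

text \<open>The convergence of the power integrals themselves is recorded as well: the exact
  operator norm of the extension depends on it, and the quasi-triangle inequality is too weak to
  deduce it from the first limit.\<close>

lemma simple_dense:
  assumes f: "strongly_measurable M f" "power_integral M p f < \<infinity>" and p: "0 < p"
  shows "\<exists>s. (\<forall>i::nat. simple_integrable M (s i)) \<and>
    (\<lambda>i. power_integral M p (\<lambda>t. s i t - f t)) \<longlonglongrightarrow> 0 \<and>
    (\<lambda>i. power_integral M p (s i)) \<longlonglongrightarrow> power_integral M p f"
proof -
  obtain s where s: "\<And>i::nat. simple_integrable M (s i)" "AE t in M. (\<lambda>i. s i t) \<longlonglongrightarrow> f t"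
      "\<And>i t. norm (s i t) \<le> 2 * norm (f t)"
    using strongly_measurable_dominated_approximation[OF f(1)] by blast
  note sm = strongly_measurable_simple[OF s(1)]
  \<comment> \<open>The factor 3 is 1 for \<open>f\<close> plus 2 for its dominated
    approximants.\<close>
  have fm: "(\<lambda>t. ennreal (3 powr p) * ennreal (norm (f t) powr p)) \<in> borel_measurable M"
    by (intro borel_measurable_times_ennreal borel_measurable_const strongly_measurable_norm_powr f)
  have fin: "(\<integral>\<^sup>+ t. ennreal (3 powr p) * ennreal (norm (f t) powr p) \<partial>M) < \<infinity>"
    using f(2) strongly_measurable_norm_powr[OF f(1), of p]
    by (simp add: nn_integral_cmult power_integral_def ennreal_mult_less_top)
  have dom: "ennreal (norm x powr p) \<le> ennreal (3 powr p) * ennreal (norm (f t) powr p)"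
    if "norm x \<le> 3 * norm (f t)" for x :: 'a and t
  proof -
    have "norm x powr p \<le> (3 * norm (f t)) powr p"
      using that p by (intro powr_mono2) auto
    then show ?thesis by (simp add: powr_mult ennreal_leI flip: ennreal_mult')
  qed
  have "(\<lambda>i. power_integral M p (\<lambda>t. s i t - f t)) \<longlonglongrightarrow> (\<integral>\<^sup>+ t. 0 \<partial>M)"
    unfolding power_integral_def
  proof (rule nn_integral_dominated_convergence[OF _ _ fm _ fin])
    show "(\<lambda>t. ennreal (norm (s i t - f t) powr p)) \<in> borel_measurable M" for i
      by (intro strongly_measurable_norm_powr strongly_measurable_diff sm f)
    show "AE t in M. ennreal (norm (s i t - f t) powr p)
        \<le> ennreal (3 powr p) * ennreal (norm (f t) powr p)" for i
    proof (rule AE_I2, rule dom)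
      fix t
      show "norm (s i t - f t) \<le> 3 * norm (f t)"
        using norm_triangle_ineq4[of "s i t" "f t"] s(3)[of i t] by simp
    qed
    show "AE t in M. (\<lambda>i. ennreal (norm (s i t - f t) powr p)) \<longlonglongrightarrow> 0"
      using s(2)
    proof eventually_elim
      fix t assume "(\<lambda>i. s i t) \<longlonglongrightarrow> f t"
      then have "(\<lambda>i. norm (s i t - f t) powr p) \<longlonglongrightarrow> 0 powr p"
        using p by (intro tendsto_powr' tendsto_norm_zero tendsto_const) (auto simp: LIM_zero_iff)
      then have "(\<lambda>i. ennreal (norm (s i t - f t) powr p)) \<longlonglongrightarrow> ennreal 0"
        by (intro tendsto_ennrealI) simp
      then show "(\<lambda>i. ennreal (norm (s i t - f t) powr p)) \<longlonglongrightarrow> 0" by simp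
    qed
  qed simp
  moreover have "(\<lambda>i. power_integral M p (s i)) \<longlonglongrightarrow> power_integral M p f"
    unfolding power_integral_def
  proof (rule nn_integral_dominated_convergence[OF _ _ fm _ fin])
    show "AE t in M. ennreal (norm (s i t) powr p)
        \<le> ennreal (3 powr p) * ennreal (norm (f t) powr p)" for i
    proof (rule AE_I2, rule dom)
      fix t
      show "norm (s i t) \<le> 3 * norm (f t)"
        using s(3)[of i t] norm_ge_zero[of "f t"] by linarith
    qed
    show "AE t in M. (\<lambda>i. ennreal (norm (s i t) powr p)) \<longlonglongrightarrow> ennreal (norm (f t) powr p)"
      using s(2) by eventually_elim
        (use p in \<open>auto intro!: tendsto_ennrealI tendsto_powr' tendsto_norm\<close>)
  qed (intro strongly_measurable_norm_powr sm f)+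
  ultimately show ?thesis using s(1) by auto
qed

text \<open>The Riesz-Fischer argument without a triangle inequality. Of the decay
  \<open>(1/4) ^ n\<close> of the increments one factor \<open>(1/2) ^ n\<close> makes the integrals
  of the weighted increments summable; the other remains as a pointwise rate, so that a.e. a
  geometric series dominates.\<close>

lemma AE_convergent_of_rapid:
  fixes g :: "nat \<Rightarrow> 't \<Rightarrow> 'b::banach"
  assumes g: "\<And>n. strongly_measurable M (g n)" and p: "0 < p"
    and rapid: "\<And>n. power_integral M p (\<lambda>t. g (Suc n) t - g n t) \<le> ennreal (((1/4) ^ n) powr p)"
  shows "AE t in M. convergent (\<lambda>n. g n t)"
proof -
  define h where "h n t = ennreal ((2 ^ n * norm (g (Suc n) t - g n t)) powr p)" for n t
  have h_eq: "h n t = ennreal ((2 ^ n) powr p) * ennreal (norm (g (Suc n) t - g n t) powr p)" for n t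
    by (simp add: h_def powr_mult ennreal_mult')
  have hm[measurable]: "h n \<in> borel_measurable M" for n
    unfolding h_eq
    by (intro borel_measurable_times_ennreal borel_measurable_const
        strongly_measurable_norm_powr strongly_measurable_diff g)
  have hi: "(\<integral>\<^sup>+ t. h n t \<partial>M) \<le> ennreal ((1/2) powr p) ^ n" for n
  proof -
    have "(\<integral>\<^sup>+ t. h n t \<partial>M)
        = ennreal ((2 ^ n) powr p) * power_integral M p (\<lambda>t. g (Suc n) t - g n t)"
      unfolding h_eq power_integral_def
      by (intro nn_integral_cmult strongly_measurable_norm_powr strongly_measurable_diff g)
    also have "\<dots> \<le> ennreal ((2 ^ n) powr p) * ennreal (((1/4) ^ n) powr p)"
      by (intro mult_left_mono rapid) simp
    also have "\<dots> = ennreal ((2 ^ n * (1/4) ^ n) powr p)"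
      by (simp add: powr_mult flip: ennreal_mult')
    also have "2 ^ n * (1/4) ^ n = ((1/2::real)) ^ n"
      by (simp flip: power_mult_distrib)
    also have "((1/2::real) ^ n) powr p = ((1/2) powr p) ^ n"
      by (simp add: powr_powr mult.commute flip: powr_realpow)
    finally show ?thesis by (simp add: ennreal_power)
  qed
  have "(\<integral>\<^sup>+ t. (\<Sum>n. h n t) \<partial>M) = (\<Sum>n. \<integral>\<^sup>+ t. h n t \<partial>M)"
    by (rule nn_integral_suminf) (rule hm)
  also have "\<dots> \<le> (\<Sum>n. ennreal (((1/2) powr p) ^ n))"
    using hi by (intro suminf_le) (auto simp: ennreal_power)
  also have "\<dots> < \<infinity>"
  proof -
    have "(1/2::real) powr p < 1" using powr_less_mono2[of p "1/2" 1] p by simp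
    then have "summable (\<lambda>n. ((1/2::real) powr p) ^ n)" by (intro summable_geometric) simp
    then show ?thesis by (subst suminf_ennreal2) auto
  qed
  finally have "(\<integral>\<^sup>+ t. (\<Sum>n. h n t) \<partial>M) \<noteq> \<infinity>" by simp
  then have "AE t in M. (\<Sum>n. h n t) \<noteq> \<infinity>"
    by (intro nn_integral_noteq_infinite) auto
  then show ?thesis
  proof eventually_elim
    fix t assume fin: "(\<Sum>n. h n t) \<noteq> \<infinity>"
    \<comment> \<open>No single term exceeds the finite sum, so one constant serves for all
      \<open>n\<close>.\<close>
    define C where "C = enn2real (\<Sum>n. h n t) powr (1 / p)"
    have le: "norm (g (Suc n) t - g n t) \<le> C * (1/2) ^ n" for n
    proof -
      have "h n t \<le> (\<Sum>n. h n t)"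
        using sum_le_suminf[of "\<lambda>n. h n t" "{n}"] by simp
      also have "\<dots> = ennreal (enn2real (\<Sum>n. h n t))"
        using fin by (simp add: less_top)
      finally have "(2 ^ n * norm (g (Suc n) t - g n t)) powr p \<le> enn2real (\<Sum>n. h n t)"
        unfolding h_def by (subst (asm) ennreal_le_iff) (auto simp: enn2real_nonneg)
      then have "((2 ^ n * norm (g (Suc n) t - g n t)) powr p) powr (1 / p) \<le> C"
        unfolding C_def using p by (intro powr_mono2) auto
      then have "2 ^ n * norm (g (Suc n) t - g n t) \<le> C"
        using p by (simp add: powr_powr)
      then show ?thesis by (simp add: field_simps)
    qed
    have "summable (\<lambda>n. C * (1/2) ^ n)"
      by (intro summable_mult summable_geometric) simp
    then have "summable (\<lambda>n. g (Suc n) t - g n t)"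
      by (rule summable_comparison_test'[where N = 0]) (rule le)
    then have "convergent (\<lambda>n. \<Sum>i<n. g (Suc i) t - g i t)"
      by (simp add: summable_iff_convergent)
    then have "convergent (\<lambda>n. (g n t - g 0 t) + g 0 t)"
      by (intro convergent_add convergent_const) (simp add: sum_lessThan_telescope[of "\<lambda>n. g n t"])
    then show "convergent (\<lambda>n. g n t)" by simp
  qed
qed

text \<open>A rapidly convergent subsequence provides the a.e. limit \<open>G\<close>. Fatou's lemma
  along it gives both the convergence of the whole sequence and the last clause, which hands bounds
  to the limit without loss.\<close>

lemma power_integral_complete:
  fixes g :: "nat \<Rightarrow> 't \<Rightarrow> 'b::banach"
  assumes g: "\<And>n. strongly_measurable M (g n)" and p: "0 < p"
    and cauchy: "\<And>e. 0 < e \<Longrightarrow> \<exists>N. \<forall>m\<ge>N. \<forall>n\<ge>N. power_integral M p (\<lambda>t. g m t - g n t) \<le> ennreal e"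
  shows "\<exists>G. strongly_measurable M G \<and> (\<lambda>n. power_integral M p (\<lambda>t. g n t - G t)) \<longlonglongrightarrow> 0 \<and>
    (\<forall>C. (\<forall>\<^sub>F n in sequentially. power_integral M p (g n) \<le> C) \<longrightarrow> power_integral M p G \<le> C)"
proof -
  have "\<exists>N. \<forall>m\<ge>N. \<forall>n\<ge>N. power_integral M p (\<lambda>t. g m t - g n t) \<le> ennreal (((1/4) ^ k) powr p)"
    for k :: nat
    by (rule cauchy) simp
  then obtain N where N: "\<And>k m n. N k \<le> m \<Longrightarrow> N k \<le> n \<Longrightarrow>
      power_integral M p (\<lambda>t. g m t - g n t) \<le> ennreal (((1/4) ^ k) powr p)"
    by metis
  \<comment> \<open>The sum over all indices up to \<open>k\<close> makes \<open>r\<close> monotone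
    and at least \<open>N k\<close>; the summand \<open>k\<close> makes it tend to infinity.\<close>
  define r where "r k = k + (\<Sum>i\<le>k. N i)" for k :: nat
  have rN: "N k \<le> r k" for k unfolding r_def by (simp add: trans_le_add2 member_le_sum)
  have rr: "r k \<le> r (Suc k)" for k by (simp add: r_def)
  have rk: "k \<le> r k" for k by (simp add: r_def)
  have top: "filterlim r sequentially sequentially"
    by (rule filterlim_at_top_mono[OF filterlim_ident]) (simp add: rk)
  have "AE t in M. convergent (\<lambda>k. g (r k) t)"
    by (rule AE_convergent_of_rapid[where p = p])
      (use g p in \<open>auto intro!: N intro: rN order_trans[OF rN rr]\<close>)
  then have lim: "AE t in M. (\<lambda>k. g (r k) t) \<longlonglongrightarrow> lim (\<lambda>k. g (r k) t)"
    by eventually_elim (simp add: convergent_LIMSEQ_iff)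
  define G where "G t = lim (\<lambda>k. g (r k) t)" for t
  note lim = lim[folded G_def]
  have G: "strongly_measurable M G"
    by (rule strongly_measurable_LIMSEQ[OF g lim])
  moreover have "(\<lambda>n. power_integral M p (\<lambda>t. g n t - G t)) \<longlonglongrightarrow> 0"
  proof (rule order_tendstoI)
    fix a :: ennreal assume "0 < a"
    have "\<exists>e>0. ennreal e < a"
    proof (cases a)
      case (real x)
      with \<open>0 < a\<close> have "0 < x / 2" "ennreal (x / 2) < a" by (auto intro!: ennreal_lessI)
      then show ?thesis by blast
    next
      case top
      then show ?thesis by (intro exI[of _ 1]) simp
    qed
    then obtain e where e: "0 < e" "ennreal e < a" by blast
    obtain K where K: "\<forall>m\<ge>K. \<forall>n\<ge>K. power_integral M p (\<lambda>t. g m t - g n t) \<le> ennreal e"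
      using cauchy[OF e(1)] by blast
    show "\<forall>\<^sub>F n in sequentially. power_integral M p (\<lambda>t. g n t - G t) < a"
      using eventually_ge_at_top[of K]
    proof eventually_elim
      fix n assume n: "K \<le> n"
      \<comment> \<open>Here \<open>n\<close> stays fixed while the second index runs through the
        subsequence.\<close>
      have "power_integral M p (\<lambda>t. g n t - G t) \<le> ennreal e"
      proof (rule power_integral_Fatou[where s = "\<lambda>k t. g n t - g (r k) t"])
        show "AE t in M. (\<lambda>k. g n t - g (r k) t) \<longlonglongrightarrow> g n t - G t"
          using lim by eventually_elim (intro tendsto_intros)
        show "\<forall>\<^sub>F k in sequentially. power_integral M p (\<lambda>t. g n t - g (r k) t) \<le> ennreal e"
          using eventually_ge_at_top[of K]
        proof eventually_elim
          fix k assume "K \<le> k"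
          then have "K \<le> r k" using rk[of k] by linarith
          with K n show "power_integral M p (\<lambda>t. g n t - g (r k) t) \<le> ennreal e" by blast
        qed
      qed (use g p in \<open>auto intro: strongly_measurable_diff\<close>)
      with e(2) show "power_integral M p (\<lambda>t. g n t - G t) < a" by simp
    qed
  qed simp
  moreover have "power_integral M p G \<le> C"
    if "\<forall>\<^sub>F n in sequentially. power_integral M p (g n) \<le> C" for C
    by (rule power_integral_Fatou[OF g lim p eventually_compose_filterlim[OF that top]])
  ultimately show ?thesis by blast
qed

end

section \<open>The Bochner integral\<close>

text \<open>A norming functional for \<open>x - y\<close> decides. Identities for the vector-valued
  integral are reduced by this to the scalar integral.\<close>

lemma cdual_separates:
  fixes x y :: "'a::complex_normed_vector"
  assumes "\<And>\<phi>::'a cdual. cblinfun_apply \<phi> x = cblinfun_apply \<phi> y"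
  shows "x = y"
proof -
  obtain \<phi> :: "'a cdual" where "cblinfun_apply \<phi> (x - y) = complex_of_real (norm (x - y))"
    using ex_norming_functional[of "x - y"] by blast
  moreover have "cblinfun_apply \<phi> (x - y) = cblinfun_apply \<phi> x - cblinfun_apply \<phi> y"
    by (rule linear_diff[OF bounded_linear.linear[OF bounded_linear_cblinfun_apply]])
  ultimately show ?thesis using assms[of \<phi>] by simp
qed

context complete_sigma_finite_measure
begin

text \<open>The bridge between the two notions of integral: \<open>T\<close> maps an approximating
  sequence to one that is admissible for \<open>has_bochner_integral\<close>, the error growing at
  most by the bound of \<open>T\<close>.\<close>

lemma has_Bochner_integral_bounded_linear:
  fixes T :: "'b::real_normed_vector \<Rightarrow> 'c::{real_normed_vector,second_countable_topology}"
  assumes T: "bounded_linear T" and f: "has_Bochner_integral M f z"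
  shows "has_bochner_integral M (\<lambda>t. T (f t)) (T z)"
proof -
  interpret T: bounded_linear T by fact
  obtain s where fm: "strongly_measurable M f" and s: "\<And>i::nat. simple_integrable M (s i)"
    and lim: "(\<lambda>i. \<integral>\<^sup>+ t. ennreal (norm (f t - s i t)) \<partial>M) \<longlonglongrightarrow> 0"
    and lims: "(\<lambda>i. simple_Bochner_integral M (s i)) \<longlonglongrightarrow> z"
    using f by (auto simp: has_Bochner_integral_def)
  obtain K where K: "K > 0" "\<And>x. norm (T x) \<le> norm x * K"
    using T.pos_bounded by blast
  show ?thesis
  proof (rule has_bochner_integral.intros)
    show "(\<lambda>t. T (f t)) \<in> borel_measurable M"
      by (intro strongly_measurable_borel strongly_measurable_bounded_linear[OF T] fm)
    show "simple_integrable M (\<lambda>t. T (s i t))" for i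
      by (rule simple_integrable_compose[where h = T, OF T.zero s])
    show "(\<lambda>i. \<integral>\<^sup>+ t. ennreal (norm (T (f t) - T (s i t))) \<partial>M) \<longlonglongrightarrow> 0"
    proof (rule tendsto_sandwich[where f = "\<lambda>_. 0"])
      show "\<forall>\<^sub>F i in sequentially. (\<integral>\<^sup>+ t. ennreal (norm (T (f t) - T (s i t))) \<partial>M)
          \<le> ennreal K * (\<integral>\<^sup>+ t. ennreal (norm (f t - s i t)) \<partial>M)"
      proof (intro always_eventually allI)
        fix i
        have "(\<integral>\<^sup>+ t. ennreal (norm (T (f t) - T (s i t))) \<partial>M)
            \<le> (\<integral>\<^sup>+ t. ennreal K * ennreal (norm (f t - s i t)) \<partial>M)"
          using K by (intro nn_integral_mono)
            (simp add: ennreal_leI mult.commute flip: ennreal_mult T.diff)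
        also have "\<dots> = ennreal K * (\<integral>\<^sup>+ t. ennreal (norm (f t - s i t)) \<partial>M)"
          using strongly_measurable_norm_borel[OF strongly_measurable_diff[OF fm
              strongly_measurable_simple[OF s[of i]]]]
          by (intro nn_integral_cmult measurable_compose[OF _ measurable_ennreal])
        finally show "(\<integral>\<^sup>+ t. ennreal (norm (T (f t) - T (s i t))) \<partial>M)
          \<le> ennreal K * (\<integral>\<^sup>+ t. ennreal (norm (f t - s i t)) \<partial>M)" .
      qed
      show "(\<lambda>i. ennreal K * (\<integral>\<^sup>+ t. ennreal (norm (f t - s i t)) \<partial>M)) \<longlonglongrightarrow> 0"
        using ennreal_tendsto_cmult[OF _ lim, of "ennreal K"] by simp
    qed auto
    show "(\<lambda>i. simple_Bochner_integral M (\<lambda>t. T (s i t))) \<longlonglongrightarrow> T z"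
      using T.tendsto[OF lims] by (simp add: simple_bochner_integral_linear[OF T.linear_axioms s])
  qed
qed

text \<open>Inherited from the scalar integral by testing with functionals; it justifies the
  \<open>THE\<close> in \<open>Bochner_integral\<close>.\<close>

lemma has_Bochner_integral_unique:
  fixes f :: "'t \<Rightarrow> 'b::complex_normed_vector"
  assumes "has_Bochner_integral M f y" "has_Bochner_integral M f z"
  shows "y = z"
proof (rule cdual_separates)
  fix \<phi> :: "'b cdual"
  show "cblinfun_apply \<phi> y = cblinfun_apply \<phi> z"
    using assms[THEN has_Bochner_integral_bounded_linear[OF bounded_linear_cblinfun_apply[of \<phi>]]]
    by (rule has_bochner_integral_eq)
qed

lemma has_Bochner_integral_Bochner_integral:
  fixes f :: "'t \<Rightarrow> 'b::complex_normed_vector"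
  assumes "Bochner_integrable M f"
  shows "has_Bochner_integral M f (Bochner_integral M f)"
proof -
  obtain z where z: "has_Bochner_integral M f z"
    using assms by (auto simp: Bochner_integrable_def)
  show ?thesis
    unfolding Bochner_integral_def
    by (rule theI[of _ z]) (fact z, rule has_Bochner_integral_unique[OF _ z])
qed

lemma Bochner_integral_functional:
  fixes f :: "'t \<Rightarrow> 'b::complex_normed_vector" and \<phi> :: "'b cdual"
  assumes "Bochner_integrable M f"
  shows "integrable M (\<lambda>t. cblinfun_apply \<phi> (f t))"
    and "cblinfun_apply \<phi> (Bochner_integral M f) = (\<integral> t. cblinfun_apply \<phi> (f t) \<partial>M)"
  using has_Bochner_integral_bounded_linear[OF bounded_linear_cblinfun_apply
      has_Bochner_integral_Bochner_integral[OF assms], of \<phi>]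
  by (auto simp: has_bochner_integral_iff)

text \<open>Simple functions that approximate \<open>f\<close> in the mean have integrals forming a
  Cauchy sequence, and completeness of the target supplies the value.\<close>

lemma Bochner_integrableI:
  fixes f :: "'t \<Rightarrow> 'b::banach"
  assumes f: "strongly_measurable M f" and fin: "(\<integral>\<^sup>+ t. ennreal (norm (f t)) \<partial>M) < \<infinity>"
  shows "Bochner_integrable M f"
proof -
  have pi: "power_integral M 1 h = (\<integral>\<^sup>+ t. ennreal (norm (h t)) \<partial>M)" for h :: "'t \<Rightarrow> 'b"
    by (simp add: power_integral_def)
  obtain s where s: "\<And>i::nat. simple_integrable M (s i)"
    and lim: "(\<lambda>i. power_integral M 1 (\<lambda>t. s i t - f t)) \<longlonglongrightarrow> 0"
    using simple_dense[OF f, of 1] fin by (auto simp: pi)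
  note sm = strongly_measurable_simple[OF s]
  have diff: "ennreal (norm (simple_Bochner_integral M (s m) - simple_Bochner_integral M (s n)))
      \<le> power_integral M 1 (\<lambda>t. s m t - f t) + power_integral M 1 (\<lambda>t. s n t - f t)" for m n
  proof -
    have sd: "simple_integrable M (\<lambda>t. s m t - s n t)"
      by (rule simple_integrable_diff[OF s s])
    have "ennreal (norm (simple_Bochner_integral M (s m) - simple_Bochner_integral M (s n)))
        = ennreal (norm (simple_Bochner_integral M (\<lambda>t. s m t - s n t)))"
      by (simp add: simple_bochner_integral_diff[OF s s])
    also have "\<dots> \<le> ennreal (simple_Bochner_integral M (\<lambda>t. norm (s m t - s n t)))"
      by (rule ennreal_leI[OF simple_bochner_integral_norm_bound[OF sd]])
    also have "\<dots> = (\<integral>\<^sup>+ t. ennreal (norm (s m t - s n t)) \<partial>M)"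
      by (rule simple_bochner_integral_eq_nn_integral)
        (rule simple_integrable_compose[where h = norm, OF norm_zero sd], simp)
    also have "\<dots> \<le> (\<integral>\<^sup>+ t. ennreal (norm (s m t - f t)) + ennreal (norm (s n t - f t)) \<partial>M)"
    proof (rule nn_integral_mono)
      fix t
      have "norm (s m t - s n t) \<le> norm (s m t - f t) + norm (s n t - f t)"
        using norm_triangle_ineq4[of "s m t - f t" "s n t - f t"] by simp
      then show "ennreal (norm (s m t - s n t)) \<le> ennreal (norm (s m t - f t)) + ennreal (norm (s n t - f t))"
        by (simp add: ennreal_leI flip: ennreal_plus)
    qed
    also have "\<dots> = power_integral M 1 (\<lambda>t. s m t - f t) + power_integral M 1 (\<lambda>t. s n t - f t)"
      unfolding pi using strongly_measurable_norm_borel[OF strongly_measurable_diff[OF sm f]]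
      by (intro nn_integral_add) auto
    finally show ?thesis .
  qed
  have "Cauchy (\<lambda>i. simple_Bochner_integral M (s i))"
  proof (rule metric_CauchyI)
    fix e :: real assume e: "0 < e"
    then have "\<forall>\<^sub>F i in sequentially. power_integral M 1 (\<lambda>t. s i t - f t) < ennreal (e / 2)"
      by (intro order_tendstoD(2)[OF lim]) simp
    then obtain N where N: "\<And>i. N \<le> i \<Longrightarrow> power_integral M 1 (\<lambda>t. s i t - f t) < ennreal (e / 2)"
      by (auto simp: eventually_sequentially)
    show "\<exists>N. \<forall>m\<ge>N. \<forall>n\<ge>N. dist (simple_Bochner_integral M (s m)) (simple_Bochner_integral M (s n)) < e"
    proof (intro exI[of _ N] allI impI)
      fix m n assume mn: "N \<le> m" "N \<le> n"
      have "ennreal (norm (simple_Bochner_integral M (s m) - simple_Bochner_integral M (s n)))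
          < ennreal (e / 2) + ennreal (e / 2)"
        using diff[of m n] add_strict_mono[OF N[OF mn(1)] N[OF mn(2)]] by (rule le_less_trans)
      also have "\<dots> = ennreal e" using e by (simp flip: ennreal_plus)
      finally show "dist (simple_Bochner_integral M (s m)) (simple_Bochner_integral M (s n)) < e"
        by (simp add: dist_norm ennreal_less_iff)
    qed
  qed
  then obtain z where "(\<lambda>i. simple_Bochner_integral M (s i)) \<longlonglongrightarrow> z"
    by (auto simp: Cauchy_convergent_iff convergent_def)
  moreover have "(\<lambda>i. \<integral>\<^sup>+ t. ennreal (norm (f t - s i t)) \<partial>M) \<longlonglongrightarrow> 0"
    using lim unfolding pi by (simp add: norm_minus_commute)
  ultimately show ?thesis
    unfolding Bochner_integrable_def has_Bochner_integral_def using f s by blast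
qed

text \<open>A functional that attains the norm of the integral reduces the estimate to
  scalars.\<close>

lemma norm_Bochner_integral_le:
  fixes f :: "'t \<Rightarrow> 'b::complex_normed_vector"
  assumes f: "Bochner_integrable M f"
  shows "ennreal (norm (Bochner_integral M f)) \<le> (\<integral>\<^sup>+ t. ennreal (norm (f t)) \<partial>M)"
proof -
  obtain \<phi> :: "'b cdual" where \<phi>: "norm \<phi> \<le> 1"
      "cblinfun_apply \<phi> (Bochner_integral M f) = complex_of_real (norm (Bochner_integral M f))"
    using ex_norming_functional by blast
  have "ennreal (norm (Bochner_integral M f)) = ennreal (norm (\<integral> t. cblinfun_apply \<phi> (f t) \<partial>M))"
    unfolding Bochner_integral_functional(2)[OF f, symmetric] \<phi>(2) by simp
  also have "\<dots> \<le> (\<integral>\<^sup>+ t. ennreal (norm (cblinfun_apply \<phi> (f t))) \<partial>M)"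
    by (rule integral_norm_bound_ennreal[OF Bochner_integral_functional(1)[OF f]])
  also have "\<dots> \<le> (\<integral>\<^sup>+ t. ennreal (norm (f t)) \<partial>M)"
  proof (intro nn_integral_mono ennreal_leI)
    fix t
    show "norm (cblinfun_apply \<phi> (f t)) \<le> norm (f t)"
      using norm_cblinfun_apply_le[of \<phi> "f t"] mult_right_mono[OF \<phi>(1), of "norm (f t)"] by simp
  qed
  finally show ?thesis .
qed

lemma Bochner_integral_add:
  fixes f g :: "'t \<Rightarrow> 'b::complex_normed_vector"
  assumes f: "Bochner_integrable M f" and g: "Bochner_integrable M g"
    and fg: "Bochner_integrable M (\<lambda>t. f t + g t)"
  shows "Bochner_integral M (\<lambda>t. f t + g t) = Bochner_integral M f + Bochner_integral M g"
  by (rule cdual_separates)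
    (simp add: Bochner_integral_functional f g fg cblinfun_apply_add)

lemma Bochner_integral_scaleC:
  fixes f :: "'t \<Rightarrow> 'b::complex_normed_vector"
  assumes f: "Bochner_integrable M f" and cf: "Bochner_integrable M (\<lambda>t. c *\<^sub>C f t)"
  shows "Bochner_integral M (\<lambda>t. c *\<^sub>C f t) = c *\<^sub>C Bochner_integral M f"
  by (rule cdual_separates)
    (simp add: Bochner_integral_functional f cf cblinfun_apply_scaleC scaleC_complex_def)

lemma Bochner_integral_diff:
  fixes f g :: "'t \<Rightarrow> 'b::complex_normed_vector"
  assumes f: "Bochner_integrable M f" and g: "Bochner_integrable M g"
    and fg: "Bochner_integrable M (\<lambda>t. f t - g t)"
  shows "Bochner_integral M (\<lambda>t. f t - g t) = Bochner_integral M f - Bochner_integral M g"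
  using Bochner_integral_add[OF fg g] f by simp

end

section \<open>Extension of bounded operators from simple functions\<close>

lemma ennreal_tendsto_zero_le:
  fixes a b c :: "nat \<Rightarrow> ennreal"
  assumes le: "\<And>i. a i \<le> ennreal C * (b i + c i)" and "b \<longlonglongrightarrow> 0" "c \<longlonglongrightarrow> 0"
  shows "a \<longlonglongrightarrow> 0"
proof (rule tendsto_sandwich[where f = "\<lambda>_. 0"])
  have "(\<lambda>i. b i + c i) \<longlonglongrightarrow> 0"
    using tendsto_add[OF assms(2,3)] by simp
  then show "(\<lambda>i. ennreal C * (b i + c i)) \<longlonglongrightarrow> 0"
    using ennreal_tendsto_cmult[of "ennreal C" "\<lambda>i. b i + c i" 0] by simp
qed (use le in auto)

context complete_sigma_finite_measure
begin

text \<open>The operator is the closure of the graph of \<open>L\<close>: each \<open>f\<close>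
  receives some limit by choice, and uniqueness of limits up to null sets gives linearity and
  independence of the representative. Stating \<open>L_bound\<close> for every majorant
  \<open>c\<close> of the norm avoids roots and normalisation.\<close>

theorem extend_from_simple:
  fixes L :: "('t \<Rightarrow> 'a::complex_normed_vector) \<Rightarrow> 't \<Rightarrow> 'b::complex_banach"
  assumes p: "0 < p" and q: "0 < q" and B: "0 \<le> B"
    and L_meas: "\<And>f. simple_integrable M f \<Longrightarrow> strongly_measurable M (L f)"
    and L_add: "\<And>f g t. simple_integrable M f \<Longrightarrow> simple_integrable M g \<Longrightarrow>
      L (\<lambda>s. f s + g s) t = L f t + L g t"
    and L_scale: "\<And>c f t. simple_integrable M f \<Longrightarrow> L (\<lambda>s. c *\<^sub>C f s) t = c *\<^sub>C L f t"
    and L_bound: "\<And>f c. simple_integrable M f \<Longrightarrow> 0 \<le> c \<Longrightarrow>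
      power_integral M q f \<le> ennreal (c powr q) \<Longrightarrow>
      power_integral M p (L f) \<le> ennreal ((B * c) powr p)"
  shows "\<exists>K. bounded_Lp_operator M q p K \<and>
    (\<forall>f. simple_integrable M f \<longrightarrow> (AE t in M. K f t = L f t)) \<and>
    Lp_operator_norm M q p K \<le> ennreal B"
proof -
  have scaleC_simple: "simple_integrable M (\<lambda>t. c *\<^sub>C f t)"
    if "simple_integrable M f" for c and f :: "'t \<Rightarrow> 'a"
    by (rule simple_integrable_compose[where h = "\<lambda>x. c *\<^sub>C x"]) (use that in auto)
  have neg: "(-1) *\<^sub>C x = - x" for x :: "'c::complex_normed_vector"
    by (simp add: scaleC_minus_left scaleC_one)
  have L_diff: "L (\<lambda>s. f s - g s) t = L f t - L g t"
    if f: "simple_integrable M f" and g: "simple_integrable M g" for f g t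
    using L_add[OF f scaleC_simple[OF g, of "-1"], of t] L_scale[OF g, of "-1" t] by (simp add: neg)
  have small: "\<exists>c>0. (B * c) powr p \<le> e" if "0 < e" for e
  proof (intro exI conjI)
    \<comment> \<open>\<open>B\<close> may vanish, hence \<open>B + 1\<close> in the
      denominator.\<close>
    show "0 < e powr (1 / p) / (B + 1)" using that B by simp
    have "B * (e powr (1 / p) / (B + 1)) \<le> e powr (1 / p)"
      using B that by (simp add: field_simps)
    then have "(B * (e powr (1 / p) / (B + 1))) powr p \<le> (e powr (1 / p)) powr p"
      using p B by (intro powr_mono2) auto
    also have "\<dots> = e" using p that by (simp add: powr_powr)
    finally show "(B * (e powr (1 / p) / (B + 1))) powr p \<le> e" .
  qed
  have L_cont: "(\<lambda>i. power_integral M p (L (u i))) \<longlonglongrightarrow> 0"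
    if u: "\<And>i::nat. simple_integrable M (u i)" and lim: "(\<lambda>i. power_integral M q (u i)) \<longlonglongrightarrow> 0"
    for u
  proof (rule order_tendstoI)
    fix a :: ennreal assume "0 < a"
    have "\<exists>e>0. ennreal e < a"
    proof (cases a)
      case (real x)
      with \<open>0 < a\<close> have "0 < x / 2" "ennreal (x / 2) < a" by (auto intro!: ennreal_lessI)
      then show ?thesis by blast
    next
      case top
      then show ?thesis by (intro exI[of _ 1]) simp
    qed
    then obtain e where e: "0 < e" "ennreal e < a" by blast
    obtain c where c: "0 < c" "(B * c) powr p \<le> e" using small[OF e(1)] by blast
    have "\<forall>\<^sub>F i in sequentially. power_integral M q (u i) < ennreal (c powr q)"
      using c by (intro order_tendstoD(2)[OF lim]) simp
    then show "\<forall>\<^sub>F i in sequentially. power_integral M p (L (u i)) < a"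
    proof eventually_elim
      fix i assume "power_integral M q (u i) < ennreal (c powr q)"
      then have "power_integral M p (L (u i)) \<le> ennreal ((B * c) powr p)"
        using c by (intro L_bound u) auto
      also have "\<dots> \<le> ennreal e" using c by (intro ennreal_leI)
      also note e(2)
      finally show "power_integral M p (L (u i)) < a" .
    qed
  qed simp
  \<comment> \<open>The pair of \<open>f\<close> and \<open>g\<close> lies in the closure of the
    graph of \<open>L\<close>, with the simple functions \<open>s\<close> as witnesses.\<close>
  define approx where "approx f g s \<longleftrightarrow> strongly_measurable M g \<and> (\<forall>i::nat. simple_integrable M (s i)) \<and>
      (\<lambda>i. power_integral M q (\<lambda>t. s i t - f t)) \<longlonglongrightarrow> 0 \<and>
      (\<lambda>i. power_integral M p (\<lambda>t. L (s i) t - g t)) \<longlonglongrightarrow> 0" for f g s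
  have approx_ex: "\<exists>g s. approx f g s \<and> (\<forall>c\<ge>0. power_integral M q f \<le> ennreal (c powr q) \<longrightarrow>
      power_integral M p g \<le> ennreal ((B * c) powr p))"
    if f: "f \<in> Lp_space M q" for f
  proof -
    have fm: "strongly_measurable M f" and ff: "power_integral M q f < \<infinity>"
      using f by (auto simp: Lp_space_iff)
    obtain s where s: "\<And>i::nat. simple_integrable M (s i)"
      and lim0: "(\<lambda>i. power_integral M q (\<lambda>t. s i t - f t)) \<longlonglongrightarrow> 0"
      and lim: "(\<lambda>i. power_integral M q (s i)) \<longlonglongrightarrow> power_integral M q f"
      using simple_dense[OF fm ff q] by blast
    note sm = strongly_measurable_simple[OF s]
    have "\<exists>N. \<forall>m\<ge>N. \<forall>n\<ge>N. power_integral M p (\<lambda>t. L (s m) t - L (s n) t) \<le> ennreal e"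
      if e: "0 < e" for e
    proof -
      obtain c where c: "0 < c" "(B * c) powr p \<le> e" using small[OF e] by blast
      \<comment> \<open>Chosen so that the quasi-triangle inequality gives exactly
        \<open>2 powr q * (d + d) = c powr q\<close>.\<close>
      define d where "d = c powr q / (2 * 2 powr q)"
      have "0 < d" using c by (simp add: d_def)
      then have "\<forall>\<^sub>F i in sequentially. power_integral M q (\<lambda>t. s i t - f t) < ennreal d"
        by (intro order_tendstoD(2)[OF lim0]) simp
      then obtain N where N: "\<And>i. N \<le> i \<Longrightarrow> power_integral M q (\<lambda>t. s i t - f t) < ennreal d"
        by (auto simp: eventually_sequentially)
      have "power_integral M p (\<lambda>t. L (s m) t - L (s n) t) \<le> ennreal e" if mn: "N \<le> m" "N \<le> n" for m n
      proof -
        have "power_integral M q (\<lambda>t. s m t - s n t)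
            \<le> ennreal (2 powr q) * (power_integral M q (\<lambda>t. s m t - f t) + power_integral M q (\<lambda>t. s n t - f t))"
          using power_integral_diff_le[OF sm fm sm q, of m n]
          by (simp add: power_integral_minus_commute[of M q f])
        also have "\<dots> \<le> ennreal (2 powr q) * (ennreal d + ennreal d)"
          by (intro mult_left_mono add_mono less_imp_le N mn) simp
        also have "\<dots> = ennreal (2 powr q * (d + d))"
          using \<open>0 < d\<close> by (simp add: ennreal_mult flip: ennreal_plus)
        also have "2 powr q * (d + d) = c powr q" by (simp add: d_def)
        finally have "power_integral M p (L (\<lambda>t. s m t - s n t)) \<le> ennreal ((B * c) powr p)"
          using c by (intro L_bound simple_integrable_diff s) auto
        also have "\<dots> \<le> ennreal e" using c by (intro ennreal_leI)
        also have "L (\<lambda>t. s m t - s n t) = (\<lambda>t. L (s m) t - L (s n) t)"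
          by (rule ext) (rule L_diff[OF s s])
        finally show ?thesis .
      qed
      then show ?thesis by blast
    qed
    from power_integral_complete[OF L_meas[OF s] p this]
    obtain g where g: "strongly_measurable M g"
      "(\<lambda>n. power_integral M p (\<lambda>t. L (s n) t - g t)) \<longlonglongrightarrow> 0"
      and gC: "\<And>C. \<forall>\<^sub>F n in sequentially. power_integral M p (L (s n)) \<le> C \<Longrightarrow> power_integral M p g \<le> C"
      by blast
    \<comment> \<open>The power integrals of \<open>s n\<close> converge to that of \<open>f\<close>
      but may exceed it. So the bound is first obtained for every \<open>c' > c\<close>, and then
      \<open>c'\<close> decreases to \<open>c\<close>.\<close>
    have "power_integral M p g \<le> ennreal ((B * c) powr p)"
      if c: "0 \<le> c" "power_integral M q f \<le> ennreal (c powr q)" for c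
    proof (rule tendsto_lowerbound)
      show "((\<lambda>c. ennreal ((B * c) powr p)) \<longlongrightarrow> ennreal ((B * c) powr p)) (at_right c)"
      proof (intro tendsto_ennrealI tendsto_powr' tendsto_intros)
        have "\<forall>\<^sub>F x in at_right c. 0 \<le> B * x"
          using eventually_at_right_less[of c] by eventually_elim (use B c in auto)
        with p show "B * c \<noteq> 0 \<or> 0 < p \<and> (\<forall>\<^sub>F x in at_right c. 0 \<le> B * x)" by simp
      qed
      show "\<forall>\<^sub>F c in at_right c. power_integral M p g \<le> ennreal ((B * c) powr p)"
        using eventually_at_right_less[of c]
      proof eventually_elim
        fix c' assume "c < c'"
        then have "ennreal (c powr q) < ennreal (c' powr q)"
          using c q by (intro ennreal_lessI powr_less_mono2) auto
        with c(2) have "power_integral M q f < ennreal (c' powr q)" by simp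
        then have ev: "\<forall>\<^sub>F n in sequentially. power_integral M q (s n) < ennreal (c' powr q)"
          by (rule order_tendstoD(2)[OF lim])
        show "power_integral M p g \<le> ennreal ((B * c') powr p)"
          by (rule gC, use ev in eventually_elim)
            (use c \<open>c < c'\<close> in \<open>auto intro!: L_bound s\<close>)
      qed
    qed simp
    with g s lim0 show ?thesis unfolding approx_def by blast
  qed
  \<comment> \<open>Stated for two a.e. equal functions, so that it yields both uniqueness of the
    limit and compatibility with a.e. classes.\<close>
  have approx_unique: "AE t in M. g t = g' t"
    if fm: "strongly_measurable M f" and a: "approx f g s" and a': "approx f' g' s'"
      and ff: "AE t in M. f t = f' t" for f f' g g' s s'
  proof -
    have s: "\<And>i. simple_integrable M (s i)" and s': "\<And>i. simple_integrable M (s' i)"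
      and g: "strongly_measurable M g" and g': "strongly_measurable M g'"
      using a a' by (auto simp: approx_def)
    note sm = strongly_measurable_simple[OF s] and sm' = strongly_measurable_simple[OF s']
    have eq: "power_integral M q (\<lambda>t. f t - s' i t) = power_integral M q (\<lambda>t. s' i t - f' t)" for i
      unfolding power_integral_minus_commute[of M q f]
      by (rule power_integral_cong_AE) (use ff in \<open>eventually_elim, simp\<close>)
    have "(\<lambda>i. power_integral M q (\<lambda>t. s i t - s' i t)) \<longlonglongrightarrow> 0"
      by (rule ennreal_tendsto_zero_le[OF power_integral_diff_le[OF sm fm sm' q]])
        (use a a' in \<open>simp_all add: approx_def eq\<close>)
    then have "(\<lambda>i. power_integral M p (L (\<lambda>t. s i t - s' i t))) \<longlonglongrightarrow> 0"
      by (intro L_cont simple_integrable_diff s s')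
    then have 1: "(\<lambda>i. power_integral M p (\<lambda>t. L (s i) t - L (s' i) t)) \<longlonglongrightarrow> 0"
      by (simp only: L_diff[OF s s', abs_def])
    have 2: "(\<lambda>i. power_integral M p (\<lambda>t. L (s i) t - g' t)) \<longlonglongrightarrow> 0"
      by (rule ennreal_tendsto_zero_le[OF power_integral_diff_le[OF L_meas[OF s] L_meas[OF s'] g' p] 1])
        (use a' in \<open>simp add: approx_def\<close>)
    have "(\<lambda>i::nat. power_integral M p (\<lambda>t. g t - g' t)) \<longlonglongrightarrow> 0"
      by (rule ennreal_tendsto_zero_le[OF power_integral_diff_le[OF g L_meas[OF s] g' p] _ 2])
        (use a in \<open>simp add: approx_def power_integral_minus_commute[of M p g]\<close>)
    then have "power_integral M p (\<lambda>t. g t - g' t) = 0"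
      by (rule LIMSEQ_unique[OF tendsto_const])
    from power_integral_eq_0_AE[OF strongly_measurable_diff[OF g g'] this]
    show ?thesis by eventually_elim simp
  qed
  have approx_add: "approx (\<lambda>t. f t + f' t) (\<lambda>t. g t + g' t) (\<lambda>i t. s i t + s' i t)"
    if fm: "strongly_measurable M f" "strongly_measurable M f'"
      and a: "approx f g s" and a': "approx f' g' s'" for f f' g g' s s'
  proof -
    have s: "\<And>i. simple_integrable M (s i)" and s': "\<And>i. simple_integrable M (s' i)"
      and g: "strongly_measurable M g" and g': "strongly_measurable M g'"
      using a a' by (auto simp: approx_def)
    note sm = strongly_measurable_simple[OF s] and sm' = strongly_measurable_simple[OF s']
    have "(\<lambda>i. power_integral M q (\<lambda>t. (s i t - f t) + (s' i t - f' t))) \<longlonglongrightarrow> 0"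
      by (rule ennreal_tendsto_zero_le[OF power_integral_add_le[OF strongly_measurable_diff[OF sm fm(1)]
            strongly_measurable_diff[OF sm' fm(2)] q]])
        (use a a' in \<open>simp_all add: approx_def\<close>)
    moreover have "(\<lambda>i. power_integral M p (\<lambda>t. (L (s i) t - g t) + (L (s' i) t - g' t))) \<longlonglongrightarrow> 0"
      by (rule ennreal_tendsto_zero_le[OF power_integral_add_le[OF
            strongly_measurable_diff[OF L_meas[OF s] g] strongly_measurable_diff[OF L_meas[OF s'] g'] p]])
        (use a a' in \<open>simp_all add: approx_def\<close>)
    moreover have "L (\<lambda>t. s i t + s' i t) t - (g t + g' t) = (L (s i) t - g t) + (L (s' i) t - g' t)" for i t
      by (simp add: L_add[OF s s'])
    moreover have "s i t + s' i t - (f t + f' t) = (s i t - f t) + (s' i t - f' t)" for i t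
      by simp
    ultimately show ?thesis
      unfolding approx_def by (simp only: strongly_measurable_add g g' simple_integrable_add s s' simp_thms)
  qed
  have scale: "power_integral M r (\<lambda>t. c *\<^sub>C f t) = ennreal (cmod c powr r) * power_integral M r f"
    if "strongly_measurable M f" for c r and f :: "'t \<Rightarrow> 'c::complex_normed_vector"
    unfolding power_integral_def norm_scaleC
    by (simp add: powr_mult ennreal_mult nn_integral_cmult strongly_measurable_norm_powr[OF that])
  have approx_scale: "approx (\<lambda>t. c *\<^sub>C f t) (\<lambda>t. c *\<^sub>C g t) (\<lambda>i t. c *\<^sub>C s i t)"
    if fm: "strongly_measurable M f" and a: "approx f g s" for f g s c
  proof -
    have s: "\<And>i. simple_integrable M (s i)" and g: "strongly_measurable M g"
      using a by (auto simp: approx_def)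
    note sm = strongly_measurable_simple[OF s]
    have "(\<lambda>i. power_integral M q (\<lambda>t. c *\<^sub>C (s i t - f t))) \<longlonglongrightarrow> 0"
      using ennreal_tendsto_cmult[of "ennreal (cmod c powr q)" "\<lambda>i. power_integral M q (\<lambda>t. s i t - f t)" 0] a
      by (simp add: approx_def scale[OF strongly_measurable_diff[OF sm fm]])
    moreover have "(\<lambda>i. power_integral M p (\<lambda>t. c *\<^sub>C (L (s i) t - g t))) \<longlonglongrightarrow> 0"
      using ennreal_tendsto_cmult[of "ennreal (cmod c powr p)" "\<lambda>i. power_integral M p (\<lambda>t. L (s i) t - g t)" 0] a
      by (simp add: approx_def scale[OF strongly_measurable_diff[OF L_meas[OF s] g]])
    ultimately show ?thesis
      unfolding approx_def
      by (auto simp: L_scale[OF s] scaleC_diff_right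
          intro: strongly_measurable_bounded_linear[OF bounded_linear_scaleC] g scaleC_simple s)
  qed
  \<comment> \<open>The choices for different functions are unrelated; linearity is recovered a.e.
    from \<open>approx_unique\<close>.\<close>
  define K where "K f = (SOME g. \<exists>s. approx f g s)" for f
  have K: "\<exists>s. approx f (K f) s" if f: "f \<in> Lp_space M q" for f
    unfolding K_def using approx_ex[OF f] by (intro someI_ex[of "\<lambda>g. \<exists>s. approx f g s"]) blast
  have Km: "strongly_measurable M (K f)" if "f \<in> Lp_space M q" for f
    using K[OF that] by (auto simp: approx_def)
  have K_bound: "power_integral M p (K f) \<le> ennreal ((B * c) powr p)"
    if f: "f \<in> Lp_space M q" and c: "0 \<le> c" "power_integral M q f \<le> ennreal (c powr q)" for f c
  proof -
    obtain g s where g: "approx f g s" "power_integral M p g \<le> ennreal ((B * c) powr p)"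
      using approx_ex[OF f] c by blast
    obtain s' where "approx f (K f) s'" using K[OF f] by blast
    then have "AE t in M. K f t = g t"
      using f g(1) by (intro approx_unique[of f "K f" s' f g s]) (auto simp: Lp_space_iff)
    then show ?thesis using g(2) by (simp add: power_integral_cong_AE)
  qed
  have Lp_norm_K: "Lp_norm M p (K f) \<le> ennreal B * Lp_norm M q f" if f: "f \<in> Lp_space M q" for f
  proof -
    define c where "c = enn2real (Lp_norm M q f)"
    have c: "0 \<le> c" "Lp_norm M q f = ennreal c"
      using f by (auto simp: c_def Lp_space_def less_top)
    then have "power_integral M q f \<le> ennreal (c powr q)"
      using Lp_norm_le_iff[OF q c(1), of M f] by simp
    from K_bound[OF f c(1) this] have "Lp_norm M p (K f) \<le> ennreal (B * c)"
      using B c p by (subst Lp_norm_le_iff) auto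
    then show ?thesis using B c by (simp add: ennreal_mult)
  qed
  have LpK: "K f \<in> Lp_space M p" if f: "f \<in> Lp_space M q" for f
  proof -
    have "Lp_norm M p (K f) < \<infinity>"
      using Lp_norm_K[OF f] f
      by (rule_tac le_less_trans) (auto simp: ennreal_mult_less_top Lp_space_def)
    with Km[OF f] show ?thesis by (simp add: Lp_space_def)
  qed
  have Lp_add: "(\<lambda>t. f t + g t) \<in> Lp_space M q" if "f \<in> Lp_space M q" "g \<in> Lp_space M q"
    for f g :: "'t \<Rightarrow> 'a"
  proof -
    have "power_integral M q (\<lambda>t. f t + g t) < \<infinity>"
      using that by (intro le_less_trans[OF power_integral_add_le[OF _ _ q]])
        (auto simp: Lp_space_iff ennreal_mult_less_top)
    with that show ?thesis by (auto simp: Lp_space_iff strongly_measurable_add)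
  qed
  have Lp_scale: "(\<lambda>t. c *\<^sub>C f t) \<in> Lp_space M q" if "f \<in> Lp_space M q" for c and f :: "'t \<Rightarrow> 'a"
    using that by (auto simp: Lp_space_iff scale ennreal_mult_less_top
        intro: strongly_measurable_bounded_linear[OF bounded_linear_scaleC])
  have "bounded_Lp_operator M q p K"
    unfolding bounded_Lp_operator_def
  proof (intro conjI ballI impI allI)
    fix f g :: "'t \<Rightarrow> 'a" assume f: "f \<in> Lp_space M q" and g: "g \<in> Lp_space M q"
    obtain u v w where u: "approx f (K f) u" and v: "approx g (K g) v"
      and w: "approx (\<lambda>t. f t + g t) (K (\<lambda>t. f t + g t)) w"
      using K[OF f] K[OF g] K[OF Lp_add[OF f g]] by blast
    have m: "strongly_measurable M f" "strongly_measurable M g"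
      using f g by (auto simp: Lp_space_iff)
    show "AE t in M. K f t = K g t" if "AE t in M. f t = g t"
      by (rule approx_unique[OF m(1) u v that])
    show "AE t in M. K (\<lambda>s. f s + g s) t = K f t + K g t"
      by (rule approx_unique[OF strongly_measurable_add[OF m] w approx_add[OF m u v]]) simp
  next
    fix c and f :: "'t \<Rightarrow> 'a" assume f: "f \<in> Lp_space M q"
    obtain u w where u: "approx f (K f) u" and w: "approx (\<lambda>t. c *\<^sub>C f t) (K (\<lambda>t. c *\<^sub>C f t)) w"
      using K[OF f] K[OF Lp_scale[OF f]] by blast
    have m: "strongly_measurable M f" using f by (auto simp: Lp_space_iff)
    show "AE t in M. K (\<lambda>s. c *\<^sub>C f s) t = c *\<^sub>C K f t"
      by (rule approx_unique[OF _ w approx_scale[OF m u]])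
        (use Lp_scale[OF f, of c] in \<open>auto simp: Lp_space_iff\<close>)
  qed (use LpK Lp_norm_K in auto)
  moreover have "AE t in M. K f t = L f t" if f: "simple_integrable M f" for f
  proof -
    have fL: "f \<in> Lp_space M q"
      using strongly_measurable_simple[OF f] power_integral_simple_finite[OF f q]
      by (simp add: Lp_space_iff)
    obtain u where u: "approx f (K f) u" using K[OF fL] by blast
    \<comment> \<open>For simple \<open>f\<close> the constant sequence shows that
      \<open>L f\<close> is an admissible limit.\<close>
    have "approx f (L f) (\<lambda>_. f)"
      using f p q by (auto simp: approx_def L_meas power_integral_def)
    then show ?thesis
      by (intro approx_unique[OF strongly_measurable_simple[OF f] u]) auto
  qed
  moreover have "Lp_operator_norm M q p K \<le> ennreal B"
    unfolding Lp_operator_norm_def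
  proof (rule SUP_least)
    fix f :: "'t \<Rightarrow> 'a" assume "f \<in> {f \<in> Lp_space M q. Lp_norm M q f \<le> 1}"
    then have f: "f \<in> Lp_space M q" "Lp_norm M q f \<le> 1" by auto
    have "ennreal B * Lp_norm M q f \<le> ennreal B * 1"
      by (rule mult_left_mono[OF f(2)]) simp
    with Lp_norm_K[OF f(1)] show "Lp_norm M p (K f) \<le> ennreal B" by simp
  qed
  ultimately show ?thesis by blast
qed

end

section \<open>Reflections of Lebesgue measure\<close>

interpretation lebesgue: complete_sigma_finite_measure "lebesgue :: 'e::euclidean_space measure"
proof
  obtain A :: "'e set set" where A: "countable A" "A \<subseteq> sets lborel" "\<Union> A = space lborel"
      "\<forall>a\<in>A. emeasure lborel a \<noteq> \<infinity>"
    using sigma_finite_measure.sigma_finite_countable[OF sigma_finite_lborel] by blast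
  have "emeasure lebesgue a \<noteq> \<infinity>" if "a \<in> A" for a
  proof -
    have "a \<in> sets lborel" using A that by blast
    then have "emeasure lebesgue a = emeasure lborel a"
      by (simp only: emeasure_completion sets_completionI_sets main_part)
    with A that show ?thesis by simp
  qed
  with A show "\<exists>A::'e set set. countable A \<and> A \<subseteq> sets lebesgue \<and> \<Union> A = space lebesgue \<and>
      (\<forall>a\<in>A. emeasure lebesgue a \<noteq> \<infinity>)"
    by (intro exI[of _ A]) (auto intro: sets_completionI_sets)
qed

lemma distr_lborel_reflect: "distr lborel lborel (\<lambda>s. t - s) = (lborel :: 'e::euclidean_space measure)"
proof -
  have "lborel = density (distr lborel borel (\<lambda>s. t - s)) (\<lambda>_::'e. 1)"
    using lborel_affine[of "-1" t] by simp
  also have "\<dots> = distr lborel borel (\<lambda>s. t - s)" by (rule density_1)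
  also have "\<dots> = distr lborel lborel (\<lambda>s. t - s)" by (rule distr_cong) auto
  finally show ?thesis by simp
qed

lemma measurable_reflect_lborel: "(\<lambda>s::'e::euclidean_space. t - s) \<in> measurable lebesgue lborel"
  by (rule measurable_completion) simp

lemma distr_lebesgue_lborel_reflect:
  "distr lebesgue lborel (\<lambda>s. t - s) = (lborel :: 'e::euclidean_space measure)"
  by (subst distr_completion) (simp_all add: distr_lborel_reflect)

text \<open>Borel sets are covered by the previous measurability result; Lebesgue null sets need
  null preimages, and this is where invariance of the measure enters.\<close>

lemma measurable_reflect_lebesgue:
  "(\<lambda>s::'e::euclidean_space. t - s) \<in> measurable lebesgue lebesgue"
  by (rule completion.measurable_completion2[OF measurable_reflect_lborel])
    (simp add: distr_lebesgue_lborel_reflect)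

lemma distr_lebesgue_reflect:
  "distr lebesgue lebesgue (\<lambda>s. t - s) = (lebesgue :: 'e::euclidean_space measure)"
  using completion.completion_distr_eq[OF measurable_reflect_lborel, of t]
  by (simp add: distr_lebesgue_lborel_reflect)

lemma AE_lebesgue_reflect:
  fixes t :: "'e::euclidean_space"
  assumes "AE s in lebesgue. P s"
  shows "AE s in lebesgue. P (t - s)"
proof (rule AE_distrD[OF measurable_reflect_lebesgue])
  show "AE s in distr lebesgue lebesgue (\<lambda>s. t - s). P s"
    unfolding distr_lebesgue_reflect by (rule assms)
qed

lemma nn_integral_lebesgue_reflect:
  fixes t :: "'e::euclidean_space"
  assumes "g \<in> borel_measurable lebesgue"
  shows "(\<integral>\<^sup>+ s. g (t - s) \<partial>lebesgue) = (\<integral>\<^sup>+ s. g s \<partial>lebesgue)"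
  using nn_integral_distr[OF measurable_reflect_lebesgue, of g t] assms
  by (simp add: distr_lebesgue_reflect)

text \<open>By Pettis' criterion: reflection preserves measurability, and the values stay a.e. in
  the same separable set.\<close>

lemma strongly_measurable_reflect:
  fixes f :: "'e::euclidean_space \<Rightarrow> 'b::real_normed_vector"
  assumes f: "strongly_measurable lebesgue f"
  shows "strongly_measurable lebesgue (\<lambda>s. f (t - s))"
proof -
  obtain D where D: "countable D" "AE s in lebesgue. f s \<in> closure D"
    using lebesgue.strongly_measurable_separable[OF f] by blast
  show ?thesis
    by (rule lebesgue.strongly_measurableI[OF _ D(1) AE_lebesgue_reflect[OF D(2)]])
      (rule measurable_compose[OF measurable_reflect_lebesgue lebesgue.strongly_measurable_borel[OF f]])
qed

text \<open>Tonelli's theorem needs joint measurability of \<open>a s * g (t - s)\<close>, which is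
  immediate for Borel functions only. Hence both factors are replaced by Borel versions before the
  order of integration is changed; translation invariance then separates the integrals.\<close>

lemma convolution_nn_integral_borel:
  fixes a g :: "'e::euclidean_space \<Rightarrow> ennreal"
  assumes a: "a \<in> borel_measurable lebesgue" and g: "g \<in> borel_measurable lebesgue"
  shows "(\<lambda>t. \<integral>\<^sup>+ s. a s * g (t - s) \<partial>lebesgue) \<in> borel_measurable lborel"
    and "(\<integral>\<^sup>+ t. (\<integral>\<^sup>+ s. a s * g (t - s) \<partial>lebesgue) \<partial>lebesgue)
      = (\<integral>\<^sup>+ s. a s \<partial>lebesgue) * (\<integral>\<^sup>+ s. g s \<partial>lebesgue)"
proof -
  obtain a' where a'[measurable]: "a' \<in> borel_measurable lborel" and aa': "AE s in lborel. a s = a' s"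
    using completion_ex_borel_measurable[OF a] by blast
  obtain g' where g'[measurable]: "g' \<in> borel_measurable lborel" and gg': "AE s in lborel. g s = g' s"
    using completion_ex_borel_measurable[OF g] by blast
  have [measurable]: "a' \<in> borel_measurable borel" "g' \<in> borel_measurable borel"
    using a' g' by simp_all
  \<comment> \<open>Equality holds for every \<open>t\<close>, not merely almost every one, because
    the exceptional set of \<open>g\<close> stays null under each reflection.\<close>
  have eq: "(\<integral>\<^sup>+ s. a s * g (t - s) \<partial>lebesgue) = (\<integral>\<^sup>+ s. a' s * g' (t - s) \<partial>lborel)" for t
  proof -
    have "(\<integral>\<^sup>+ s. a s * g (t - s) \<partial>lebesgue) = (\<integral>\<^sup>+ s. a' s * g' (t - s) \<partial>lebesgue)"
    proof (rule nn_integral_cong_AE)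
      show "AE s in lebesgue. a s * g (t - s) = a' s * g' (t - s)"
        using AE_completion[OF aa'] AE_lebesgue_reflect[OF AE_completion[OF gg'], of t]
        by eventually_elim simp
    qed
    then show ?thesis by (simp add: nn_integral_completion)
  qed
  show "(\<lambda>t. \<integral>\<^sup>+ s. a s * g (t - s) \<partial>lebesgue) \<in> borel_measurable lborel"
    unfolding eq by measurable
  have "(\<integral>\<^sup>+ t. (\<integral>\<^sup>+ s. a s * g (t - s) \<partial>lebesgue) \<partial>lebesgue)
      = (\<integral>\<^sup>+ t. (\<integral>\<^sup>+ s. a' s * g' (t - s) \<partial>lborel) \<partial>lborel)"
    unfolding eq by (rule nn_integral_completion)
  also have "\<dots> = (\<integral>\<^sup>+ s. (\<integral>\<^sup>+ t. a' s * g' (t - s) \<partial>lborel) \<partial>lborel)"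
    by (rule lborel_pair.Fubini') measurable
  also have "\<dots> = (\<integral>\<^sup>+ s. a' s * (\<integral>\<^sup>+ t. g' t \<partial>lborel) \<partial>lborel)"
  proof (rule nn_integral_cong)
    fix s :: 'e
    have "(\<integral>\<^sup>+ t. g' (t - s) \<partial>lborel) = (\<integral>\<^sup>+ t. g' t \<partial>lborel)"
    proof -
      have "(\<integral>\<^sup>+ t. g' t \<partial>lborel) = (\<integral>\<^sup>+ t. g' t \<partial>density (distr lborel borel (\<lambda>x. - s + 1 *\<^sub>R x)) (\<lambda>_. 1))"
        using lborel_affine[of 1 "- s"] by simp
      also have "\<dots> = (\<integral>\<^sup>+ t. g' (t - s) \<partial>lborel)"
        by (simp add: density_1 nn_integral_distr)
      finally show ?thesis by simp
    qed
    then show "(\<integral>\<^sup>+ t. a' s * g' (t - s) \<partial>lborel) = a' s * (\<integral>\<^sup>+ t. g' t \<partial>lborel)"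
      by (subst nn_integral_cmult) auto
  qed
  also have "\<dots> = (\<integral>\<^sup>+ s. a' s \<partial>lborel) * (\<integral>\<^sup>+ t. g' t \<partial>lborel)"
    by (rule nn_integral_multc) measurable
  also have "(\<integral>\<^sup>+ s. a' s \<partial>lborel) = (\<integral>\<^sup>+ s. a s \<partial>lebesgue)"
    unfolding nn_integral_completion by (rule nn_integral_cong_AE) (use aa' in \<open>eventually_elim, simp\<close>)
  also have "(\<integral>\<^sup>+ s. g' s \<partial>lborel) = (\<integral>\<^sup>+ s. g s \<partial>lebesgue)"
    unfolding nn_integral_completion by (rule nn_integral_cong_AE) (use gg' in \<open>eventually_elim, simp\<close>)
  finally show "(\<integral>\<^sup>+ t. (\<integral>\<^sup>+ s. a s * g (t - s) \<partial>lebesgue) \<partial>lebesgue)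
      = (\<integral>\<^sup>+ s. a s \<partial>lebesgue) * (\<integral>\<^sup>+ s. g s \<partial>lebesgue)" .
qed

section \<open>Convolution of simple functions\<close>

context complete_sigma_finite_measure
begin

definition norm_integrable :: "('t \<Rightarrow> 'b::real_normed_vector) \<Rightarrow> bool" where
  "norm_integrable f \<longleftrightarrow> strongly_measurable M f \<and> (\<integral>\<^sup>+ t. ennreal (norm (f t)) \<partial>M) < \<infinity>"

lemma norm_integrable_Bochner:
  fixes f :: "'t \<Rightarrow> 'b::banach"
  shows "norm_integrable f \<Longrightarrow> Bochner_integrable M f"
  by (simp add: norm_integrable_def Bochner_integrableI)

lemma norm_integrable_zero: "norm_integrable (\<lambda>_. 0)"
  by (simp add: norm_integrable_def strongly_measurable_zero)

lemma norm_integrable_add: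
  assumes "norm_integrable f" "norm_integrable g"
  shows "norm_integrable (\<lambda>t. f t + g t)"
  using power_integral_add_le[of f g 1] assms
  by (auto simp: norm_integrable_def power_integral_def strongly_measurable_add
      ennreal_mult_less_top elim!: le_less_trans)

lemma norm_integrable_sum:
  "(\<And>i. i \<in> I \<Longrightarrow> norm_integrable (f i)) \<Longrightarrow> norm_integrable (\<lambda>t. \<Sum>i\<in>I. f i t)"
  by (induction I rule: infinite_finite_induct) (auto simp: norm_integrable_zero norm_integrable_add)

lemma norm_integrable_dominated:
  assumes "norm_integrable g" "strongly_measurable M f" "\<And>t. norm (f t) \<le> C * norm (g t)" "0 \<le> C"
  shows "norm_integrable f"
proof -
  have "(\<integral>\<^sup>+ t. ennreal (norm (f t)) \<partial>M) \<le> (\<integral>\<^sup>+ t. ennreal C * ennreal (norm (g t)) \<partial>M)"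
    using assms(3,4) by (intro nn_integral_mono) (simp add: ennreal_leI flip: ennreal_mult)
  also have "\<dots> = ennreal C * (\<integral>\<^sup>+ t. ennreal (norm (g t)) \<partial>M)"
    using assms(1) unfolding norm_integrable_def
    by (intro nn_integral_cmult measurable_compose[OF _ measurable_ennreal] strongly_measurable_norm_borel) simp
  also have "\<dots> < \<infinity>" using assms(1) by (simp add: norm_integrable_def ennreal_mult_less_top)
  finally show ?thesis using assms(2) by (simp add: norm_integrable_def)
qed

lemma Bochner_integral_sum:
  fixes f :: "'i \<Rightarrow> 't \<Rightarrow> 'b::complex_banach"
  assumes "\<And>i. i \<in> I \<Longrightarrow> norm_integrable (f i)"
  shows "Bochner_integral M (\<lambda>t. \<Sum>i\<in>I. f i t) = (\<Sum>i\<in>I. Bochner_integral M (f i))"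
proof (rule cdual_separates)
  fix \<phi> :: "'b cdual"
  have sum: "cblinfun_apply \<phi> (\<Sum>i\<in>I. g i) = (\<Sum>i\<in>I. cblinfun_apply \<phi> (g i))" for g :: "'i \<Rightarrow> 'b"
    by (rule linear_sum[OF bounded_linear.linear[OF bounded_linear_cblinfun_apply]])
  have "norm_integrable (\<lambda>t. \<Sum>i\<in>I. f i t)"
    by (rule norm_integrable_sum) (rule assms)
  from Bochner_integral_functional(2)[OF norm_integrable_Bochner[OF this], of \<phi>]
  show "cblinfun_apply \<phi> (Bochner_integral M (\<lambda>t. \<Sum>i\<in>I. f i t))
      = cblinfun_apply \<phi> (\<Sum>i\<in>I. Bochner_integral M (f i))"
    by (simp add: sum Bochner_integral_functional norm_integrable_Bochner[OF assms]
        Bochner_Integration.integral_sum)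
qed

lemma Bochner_integral_scaleR_const:
  fixes y :: "'b::complex_banach" and g :: "'t \<Rightarrow> real"
  assumes g: "integrable M g" and gy: "Bochner_integrable M (\<lambda>t. g t *\<^sub>R y)"
  shows "Bochner_integral M (\<lambda>t. g t *\<^sub>R y) = (\<integral> t. g t \<partial>M) *\<^sub>R y"
proof (rule cdual_separates)
  fix \<phi> :: "'b cdual"
  have sc: "cblinfun_apply \<phi> (r *\<^sub>R y) = r *\<^sub>R cblinfun_apply \<phi> y" for r
    by (rule linear_scale[OF bounded_linear.linear[OF bounded_linear_cblinfun_apply]])
  show "cblinfun_apply \<phi> (Bochner_integral M (\<lambda>t. g t *\<^sub>R y)) = cblinfun_apply \<phi> ((\<integral> t. g t \<partial>M) *\<^sub>R y)"
    unfolding Bochner_integral_functional(2)[OF gy] sc using g by simp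
qed

end

text \<open>The value 0 is left out because its level set may have infinite measure; expansions over
  these values therefore require \<open>h 0 = 0\<close>.\<close>

definition nonzero_values :: "('t \<Rightarrow> 'a::zero) \<Rightarrow> 'a set" where
  "nonzero_values f = range f - {0}"

lemma simple_integrable_nonzero_values:
  assumes f: "simple_integrable M f" and sp: "space M = UNIV"
  shows "finite (nonzero_values f)"
    and "x \<in> nonzero_values f \<Longrightarrow> f -` {x} \<in> sets M"
    and "x \<in> nonzero_values f \<Longrightarrow> emeasure M (f -` {x}) < \<infinity>"
proof -
  show "finite (nonzero_values f)"
    using simple_integrable_finite_image[OF f] sp by (simp add: nonzero_values_def)
  have sf: "simple_function M f" "emeasure M {y \<in> space M. f y \<noteq> 0} \<noteq> \<infinity>"
    using f by (auto elim: simple_bochner_integrable.cases)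
  show s: "f -` {x} \<in> sets M" if "x \<in> nonzero_values f"
    using simple_functionD(2)[OF sf(1), of "{x}"] sp by simp
  show "emeasure M (f -` {x}) < \<infinity>" if x: "x \<in> nonzero_values f"
  proof -
    have "emeasure M (f -` {x}) \<le> emeasure M {y \<in> space M. f y \<noteq> 0}"
    proof (rule emeasure_mono)
      show "f -` {x} \<subseteq> {y \<in> space M. f y \<noteq> 0}" using x sp by (auto simp: nonzero_values_def)
      have "{y \<in> space M. f y \<noteq> 0} = space M - (f -` {0} \<inter> space M)" by auto
      also have "\<dots> \<in> sets M" by (intro sets.compl_sets simple_functionD(2)[OF sf(1)])
      finally show "{y \<in> space M. f y \<noteq> 0} \<in> sets M" .
    qed
    then show ?thesis using sf(2) by (auto simp: less_top top_unique)
  qed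
qed

lemma sum_nonzero_values:
  fixes h :: "'a::zero \<Rightarrow> 'b::real_vector"
  assumes "finite (nonzero_values f)" "h 0 = 0"
  shows "h (f s) = (\<Sum>x\<in>nonzero_values f. indicator (f -` {x}) s *\<^sub>R h x)"
proof -
  have "(\<Sum>x\<in>nonzero_values f. indicator (f -` {x}) s *\<^sub>R h x)
      = (\<Sum>x\<in>nonzero_values f. if x = f s then h x else 0)"
    by (intro sum.cong) (auto split: split_indicator)
  also have "\<dots> = (if f s \<in> nonzero_values f then h (f s) else 0)"
    using assms(1) by (simp add: sum.delta)
  also have "\<dots> = h (f s)"
    using assms(2) by (auto simp: nonzero_values_def)
  finally show ?thesis by simp
qed

text \<open>From \<open>y \<le> 1 + y powr \<theta>\<close>: the finite measure of \<open>A\<close>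
  pays for the 1, the power integral of \<open>G\<close> for the rest. By reflection invariance the
  bound is the same for all \<open>t\<close>, so integrability holds everywhere.\<close>

lemma convolution_term_integrable:
  fixes G :: "'e::euclidean_space \<Rightarrow> 'b::real_normed_vector"
  assumes A: "A \<in> sets lebesgue" "emeasure lebesgue A < \<infinity>"
    and G: "strongly_measurable lebesgue G" "power_integral lebesgue \<theta> G < \<infinity>" and \<theta>: "1 \<le> \<theta>"
  shows "lebesgue.norm_integrable (\<lambda>s. indicator A s *\<^sub>R G (t - s))"
proof -
  have Gt: "strongly_measurable lebesgue (\<lambda>s. G (t - s))" by (rule strongly_measurable_reflect[OF G(1)])
  have ind: "strongly_measurable lebesgue (indicator A :: 'e \<Rightarrow> real)"
    by (rule lebesgue.strongly_measurable_second_countable) (use A in simp)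
  have "(\<integral>\<^sup>+ s. ennreal (norm (indicator A s *\<^sub>R G (t - s))) \<partial>lebesgue)
      \<le> (\<integral>\<^sup>+ s. indicator A s + ennreal (norm (G (t - s)) powr \<theta>) \<partial>lebesgue)"
  proof (rule nn_integral_mono)
    fix s
    have "y \<le> 1 + y powr \<theta>" if "0 \<le> y" for y :: real
    proof (cases "y \<le> 1")
      case True then show ?thesis using powr_ge_zero[of y \<theta>] by linarith
    next
      case False
      then have "y powr 1 \<le> y powr \<theta>" using \<theta> by (intro powr_mono) auto
      then show ?thesis using False by simp
    qed
    from this[of "norm (G (t - s))"]
    have "ennreal (norm (G (t - s))) \<le> 1 + ennreal (norm (G (t - s)) powr \<theta>)"
      by (metis ennreal_1 ennreal_leI ennreal_plus norm_ge_zero powr_ge_zero zero_le_one)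
    then show "ennreal (norm (indicator A s *\<^sub>R G (t - s)))
        \<le> indicator A s + ennreal (norm (G (t - s)) powr \<theta>)"
      by (auto split: split_indicator)
  qed
  also have "\<dots> = emeasure lebesgue A + (\<integral>\<^sup>+ s. ennreal (norm (G (t - s)) powr \<theta>) \<partial>lebesgue)"
    using A by (subst nn_integral_add[OF _ lebesgue.strongly_measurable_norm_powr[OF Gt]]) auto
  also have "(\<integral>\<^sup>+ s. ennreal (norm (G (t - s)) powr \<theta>) \<partial>lebesgue) = power_integral lebesgue \<theta> G"
    unfolding power_integral_def
    by (rule nn_integral_lebesgue_reflect[OF lebesgue.strongly_measurable_norm_powr[OF G(1)]])
  also have "emeasure lebesgue A + power_integral lebesgue \<theta> G < \<infinity>" using A(2) G(2) by simp
  finally show ?thesis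
    unfolding lebesgue.norm_integrable_def using strongly_measurable_scaleR[OF ind Gt] by simp
qed

text \<open>The vector \<open>y\<close> is constant, so the integral is \<open>y\<close> times the
  scalar convolution of two indicators, whose measurability in \<open>t\<close> comes from Tonelli's
  theorem.\<close>

lemma convolution_indicator_measurable:
  fixes y :: "'b::complex_banach" and A B :: "'e::euclidean_space set"
  assumes A: "A \<in> sets lebesgue" "emeasure lebesgue A < \<infinity>" and B: "B \<in> sets lebesgue"
  shows "strongly_measurable lebesgue
    (\<lambda>t. Bochner_integral lebesgue (\<lambda>s. indicator A s *\<^sub>R (indicator B (t - s) *\<^sub>R y)))"
proof -
  define g :: "'e \<Rightarrow> 'e \<Rightarrow> real" where "g t s = indicator A s * indicator B (t - s)" for t s
  define r where "r t = (\<integral> s. g t s \<partial>lebesgue)" for t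
  have gm: "g t \<in> borel_measurable lebesgue" for t
    unfolding g_def using A B measurable_compose[OF measurable_reflect_lebesgue, of "indicator B" borel t]
    by (intro borel_measurable_times) auto
  have gi: "integrable lebesgue (g t)" for t
    by (rule Bochner_Integration.integrable_bound[of _ "indicator A :: 'e \<Rightarrow> real"])
      (use A gm in \<open>auto simp: g_def less_top split: split_indicator\<close>)
  have r_eq: "r t = enn2real (\<integral>\<^sup>+ s. indicator A s * indicator B (t - s) \<partial>lebesgue)" for t
  proof -
    have "r t = enn2real (\<integral>\<^sup>+ s. ennreal (g t s) \<partial>lebesgue)"
      unfolding r_def by (rule integral_eq_nn_integral) (use gm in \<open>auto simp: g_def\<close>)
    also have "(\<integral>\<^sup>+ s. ennreal (g t s) \<partial>lebesgue) = (\<integral>\<^sup>+ s. indicator A s * indicator B (t - s) \<partial>lebesgue)"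
      by (intro nn_integral_cong) (auto simp: g_def split: split_indicator)
    finally show ?thesis .
  qed
  have "(\<lambda>t. \<integral>\<^sup>+ s. indicator A s * indicator B (t - s) \<partial>lebesgue) \<in> borel_measurable lborel"
    by (rule convolution_nn_integral_borel(1)) (use A B in auto)
  then have "r \<in> borel_measurable lborel" unfolding r_eq by measurable
  then have "r \<in> borel_measurable lebesgue" by (rule measurable_completion)
  then have rm: "strongly_measurable lebesgue r"
    by (rule lebesgue.strongly_measurable_second_countable)
  have "Bochner_integral lebesgue (\<lambda>s. indicator A s *\<^sub>R (indicator B (t - s) *\<^sub>R y)) = r t *\<^sub>R y" for t
  proof -
    have "strongly_measurable lebesgue (g t)"
      by (rule lebesgue.strongly_measurable_second_countable[OF gm])
    then have gy: "strongly_measurable lebesgue (\<lambda>s. g t s *\<^sub>R y)"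
      by (rule strongly_measurable_bounded_linear[OF bounded_linear_scaleR_left])
    have "(\<integral>\<^sup>+ s. ennreal (norm (indicator A s *\<^sub>R y)) \<partial>lebesgue) < \<infinity>"
      using power_integral_simple_finite[OF simple_integrable_indicator[OF A], of 1 y]
      by (simp add: power_integral_def)
    with strongly_measurable_simple[OF simple_integrable_indicator[OF A]]
    have Ay: "lebesgue.norm_integrable (\<lambda>s. indicator A s *\<^sub>R y)"
      unfolding lebesgue.norm_integrable_def by blast
    have "norm (g t s *\<^sub>R y) \<le> 1 * norm (indicator A s *\<^sub>R y)" for s
      by (auto simp: g_def split: split_indicator)
    then have "lebesgue.norm_integrable (\<lambda>s. g t s *\<^sub>R y)"
      by (rule lebesgue.norm_integrable_dominated[OF Ay gy]) simp
    from lebesgue.Bochner_integral_scaleR_const[OF gi lebesgue.norm_integrable_Bochner[OF this]]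
    show ?thesis by (simp add: g_def r_def)
  qed
  then show ?thesis
    using strongly_measurable_bounded_linear[OF bounded_linear_scaleR_left rm] by simp
qed

text \<open>A simple \<open>G\<close> splits into indicators of its level sets; for general
  \<open>G\<close> dominated approximants give convergence of the integrals at every
  \<open>t\<close>. Thus only scalar integrands ever have to be jointly measurable.\<close>

lemma convolution_term_measurable:
  fixes G :: "'e::euclidean_space \<Rightarrow> 'b::complex_banach"
  assumes A: "A \<in> sets lebesgue" "emeasure lebesgue A < \<infinity>"
    and G: "strongly_measurable lebesgue G" "power_integral lebesgue \<theta> G < \<infinity>" and \<theta>: "1 \<le> \<theta>"
  shows "strongly_measurable lebesgue (\<lambda>t. Bochner_integral lebesgue (\<lambda>s. indicator A s *\<^sub>R G (t - s)))"
proof -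
  obtain u where u: "\<And>i::nat. simple_integrable lebesgue (u i)"
      "AE t in lebesgue. (\<lambda>i. u i t) \<longlonglongrightarrow> G t" "\<And>i t. norm (u i t) \<le> 2 * norm (G t)"
    using lebesgue.strongly_measurable_dominated_approximation[OF G(1)] by blast
  have \<theta>0: "0 < \<theta>" using \<theta> by simp
  have simple_case: "strongly_measurable lebesgue
      (\<lambda>t. Bochner_integral lebesgue (\<lambda>s. indicator A s *\<^sub>R v (t - s)))"
    if v: "simple_integrable lebesgue v" for v :: "'e \<Rightarrow> 'b"
  proof -
    note nz = simple_integrable_nonzero_values[OF v]
    have summand: "lebesgue.norm_integrable (\<lambda>s. indicator A s *\<^sub>R (indicator (v -` {y}) (t - s) *\<^sub>R y))"
      if "y \<in> nonzero_values v" for y t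
    proof -
      have y: "simple_integrable lebesgue (\<lambda>t. indicator (v -` {y}) t *\<^sub>R y)"
        by (rule simple_integrable_indicator[OF nz(2,3)[OF _ that]]) simp_all
      show ?thesis
        by (rule convolution_term_integrable[OF A strongly_measurable_simple[OF y]
              power_integral_simple_finite[OF y \<theta>0] \<theta>])
    qed
    have "Bochner_integral lebesgue (\<lambda>s. indicator A s *\<^sub>R v (t - s))
        = (\<Sum>y\<in>nonzero_values v. Bochner_integral lebesgue
            (\<lambda>s. indicator A s *\<^sub>R (indicator (v -` {y}) (t - s) *\<^sub>R y)))" for t
    proof -
      have "indicator A s *\<^sub>R v (t - s)
          = (\<Sum>y\<in>nonzero_values v. indicator A s *\<^sub>R (indicator (v -` {y}) (t - s) *\<^sub>R y))" for s
        unfolding scaleR_sum_right[symmetric] using sum_nonzero_values[of v "\<lambda>x. x" "t - s"] nz(1) by simp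
      then show ?thesis by (simp only: lebesgue.Bochner_integral_sum[OF summand])
    qed
    then show ?thesis
      by (simp only:) (intro strongly_measurable_sum convolution_indicator_measurable[OF A] nz(2); simp)
  qed
  note GI = convolution_term_integrable[OF A G \<theta>]
  have uI: "lebesgue.norm_integrable (\<lambda>s. indicator A s *\<^sub>R u i (t - s))" for i t
    by (rule convolution_term_integrable[OF A strongly_measurable_simple[OF u(1)]
          power_integral_simple_finite[OF u(1) \<theta>0] \<theta>])
  show ?thesis
  proof (rule lebesgue.strongly_measurable_LIMSEQ[OF simple_case[OF u(1)]], rule AE_I2)
    fix t :: 'e
    let ?I = "Bochner_integral lebesgue"
    define d where "d i s = indicator A s *\<^sub>R u i (t - s) - indicator A s *\<^sub>R G (t - s)" for i s
    have dm: "strongly_measurable lebesgue (d i)" for i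
      unfolding d_def using uI[of i t] GI[of t]
      by (auto simp: lebesgue.norm_integrable_def intro: strongly_measurable_diff)
    have d_le: "norm (d i s) \<le> 3 * norm (indicator A s *\<^sub>R G (t - s))" for i s
      using norm_triangle_ineq4[of "u i (t - s)" "G (t - s)"] u(3)[of i "t - s"]
      by (auto simp: d_def split: split_indicator)
    have dI: "lebesgue.norm_integrable (d i)" for i
      by (rule lebesgue.norm_integrable_dominated[OF GI dm d_le]) simp
    have "(\<lambda>i. \<integral>\<^sup>+ s. ennreal (norm (d i s)) \<partial>lebesgue) \<longlonglongrightarrow> (\<integral>\<^sup>+ s. 0 \<partial>(lebesgue :: 'e measure))"
    proof (rule nn_integral_dominated_convergence
        [where w = "\<lambda>s. ennreal 3 * ennreal (norm (indicator A s *\<^sub>R G (t - s)))"])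
      have m: "(\<lambda>s. ennreal (norm (indicator A s *\<^sub>R G (t - s)))) \<in> borel_measurable lebesgue"
        using GI[of t] unfolding lebesgue.norm_integrable_def
        by (intro measurable_compose[OF _ measurable_ennreal] lebesgue.strongly_measurable_norm_borel) simp
      then show "(\<lambda>s. ennreal 3 * ennreal (norm (indicator A s *\<^sub>R G (t - s)))) \<in> borel_measurable lebesgue"
        by (intro borel_measurable_times_ennreal) auto
      show "(\<integral>\<^sup>+ s. ennreal 3 * ennreal (norm (indicator A s *\<^sub>R G (t - s))) \<partial>lebesgue) < \<infinity>"
        using GI[of t] unfolding lebesgue.norm_integrable_def
        by (subst nn_integral_cmult[OF m]) (simp add: ennreal_mult_less_top)
      show "(\<lambda>s. ennreal (norm (d i s))) \<in> borel_measurable lebesgue" for i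
        by (intro measurable_compose[OF _ measurable_ennreal] lebesgue.strongly_measurable_norm_borel dm)
      show "AE s in lebesgue. ennreal (norm (d i s)) \<le> ennreal 3 * ennreal (norm (indicator A s *\<^sub>R G (t - s)))" for i
      proof (rule AE_I2)
        show "ennreal (norm (d i s)) \<le> ennreal 3 * ennreal (norm (indicator A s *\<^sub>R G (t - s)))" for s
          using ennreal_leI[OF d_le[of i s]] by (subst (asm) ennreal_mult) simp_all
      qed
      \<comment> \<open>For the fixed \<open>t\<close>, the exceptional set of the convergence of
        \<open>u i\<close> is reflected to a null set of \<open>s\<close>.\<close>
      show "AE s in lebesgue. (\<lambda>i. ennreal (norm (d i s))) \<longlonglongrightarrow> 0"
        using AE_lebesgue_reflect[OF u(2), of t]
      proof eventually_elim
        fix s assume "(\<lambda>i. u i (t - s)) \<longlonglongrightarrow> G (t - s)"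
        then have "(\<lambda>i. indicator A s *\<^sub>R u i (t - s)) \<longlonglongrightarrow> indicator A s *\<^sub>R G (t - s)"
          by (intro tendsto_scaleR tendsto_const)
        then have "(\<lambda>i. norm (d i s)) \<longlonglongrightarrow> 0"
          unfolding d_def by (simp add: tendsto_norm_zero_iff LIM_zero_iff)
        then show "(\<lambda>i. ennreal (norm (d i s))) \<longlonglongrightarrow> 0"
          using tendsto_ennrealI by fastforce
      qed
    qed simp
    then have lim: "(\<lambda>i. \<integral>\<^sup>+ s. ennreal (norm (d i s)) \<partial>lebesgue) \<longlonglongrightarrow> 0" by simp
    have "?I (d i) = ?I (\<lambda>s. indicator A s *\<^sub>R u i (t - s)) - ?I (\<lambda>s. indicator A s *\<^sub>R G (t - s))" for i
      unfolding d_def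
      by (rule lebesgue.Bochner_integral_diff)
        (use uI[of i t] GI[of t] dI[of i, unfolded d_def[abs_def]] in \<open>auto intro: lebesgue.norm_integrable_Bochner\<close>)
    then have le: "ennreal (norm (?I (\<lambda>s. indicator A s *\<^sub>R u i (t - s)) - ?I (\<lambda>s. indicator A s *\<^sub>R G (t - s))))
        \<le> (\<integral>\<^sup>+ s. ennreal (norm (d i s)) \<partial>lebesgue)" for i
      using lebesgue.norm_Bochner_integral_le[OF lebesgue.norm_integrable_Bochner[OF dI], of i] by simp
    have "(\<lambda>i. ennreal (norm (?I (\<lambda>s. indicator A s *\<^sub>R u i (t - s)) - ?I (\<lambda>s. indicator A s *\<^sub>R G (t - s))))) \<longlonglongrightarrow> 0"
    proof (rule tendsto_sandwich[OF _ _ tendsto_const lim])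
      show "\<forall>\<^sub>F i in sequentially. ennreal (norm (?I (\<lambda>s. indicator A s *\<^sub>R u i (t - s))
          - ?I (\<lambda>s. indicator A s *\<^sub>R G (t - s)))) \<le> (\<integral>\<^sup>+ s. ennreal (norm (d i s)) \<partial>lebesgue)"
        by (rule always_eventually) (rule allI, rule le)
    qed simp
    then have "(\<lambda>i. norm (?I (\<lambda>s. indicator A s *\<^sub>R u i (t - s)) - ?I (\<lambda>s. indicator A s *\<^sub>R G (t - s)))) \<longlonglongrightarrow> 0"
      unfolding ennreal_0[symmetric] by (rule tendsto_ennrealD) simp_all
    then show "(\<lambda>i. ?I (\<lambda>s. indicator A s *\<^sub>R u i (t - s))) \<longlonglongrightarrow> ?I (\<lambda>s. indicator A s *\<^sub>R G (t - s))"
      by (rule LIM_zero_cancel[OF tendsto_norm_zero_cancel])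
  qed
qed

section \<open>The convolution inequality\<close>

text \<open>Concavity of the logarithm: its tangent at the weighted mean \<open>S\<close> lies above
  the graph, and the linear terms cancel on averaging. Zero arguments are split off first; there the
  product vanishes even for exponent 0, because \<open>0 powr 0 = 0\<close>.\<close>

lemma weighted_am_gm3:
  fixes x y z :: real
  assumes w: "0 \<le> a" "0 \<le> b" "0 \<le> c" "a + b + c = 1" and nn: "0 \<le> x" "0 \<le> y" "0 \<le> z"
  shows "x powr a * y powr b * z powr c \<le> a * x + b * y + c * z"
proof (cases "x = 0 \<or> y = 0 \<or> z = 0")
  case True
  then have "x powr a * y powr b * z powr c = 0" by auto
  moreover have "0 \<le> a * x + b * y + c * z"
    using w nn by (intro add_nonneg_nonneg mult_nonneg_nonneg)
  ultimately show ?thesis by linarith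
next
  case False
  with nn have pos: "0 < x" "0 < y" "0 < z" by auto
  define S where "S = a * x + b * y + c * z"
  have "0 \<le> a * x" "0 \<le> b * y" "0 \<le> c * z" using w pos by auto
  moreover have "0 < a * x \<or> 0 < b * y \<or> 0 < c * z"
    using w pos by (simp add: zero_less_mult_iff) linarith
  ultimately have S: "0 < S" unfolding S_def by linarith
  have l: "ln t \<le> ln S + (t / S - 1)" if "0 < t" for t
    using ln_le_minus_one[of "t / S"] that S by (simp add: ln_div)
  have "a * ln x + b * ln y + c * ln z
      \<le> a * (ln S + (x / S - 1)) + b * (ln S + (y / S - 1)) + c * (ln S + (z / S - 1))"
    using w pos by (intro add_mono mult_left_mono l) auto
  also have "\<dots> = (a + b + c) * (ln S - 1) + (a * x + b * y + c * z) / S"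
    by (simp add: algebra_simps add_divide_distrib)
  also have "\<dots> = ln S" using w(4) S by (simp add: S_def[symmetric])
  finally have "exp (a * ln x + b * ln y + c * ln z) \<le> exp (ln S)" by simp
  then show ?thesis using pos S by (simp add: powr_def exp_add S_def)
qed

text \<open>With the convention \<open>0 powr 0 = 0\<close> the inequality also holds when an exponent and the
  corresponding integral vanish.\<close>

lemma Hoelder3:
  fixes u v w h :: "'t \<Rightarrow> real"
  assumes e: "0 \<le> a" "0 \<le> b" "0 \<le> c" "a + b + c = 1"
    and m[measurable]: "u \<in> borel_measurable M" "v \<in> borel_measurable M" "w \<in> borel_measurable M"
    and nn: "\<And>s. 0 \<le> u s" "\<And>s. 0 \<le> v s" "\<And>s. 0 \<le> w s"
    and h: "\<And>s. h s \<le> u s powr a * v s powr b * w s powr c"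
    and i: "(\<integral>\<^sup>+ s. ennreal (u s) \<partial>M) \<le> ennreal U" "(\<integral>\<^sup>+ s. ennreal (v s) \<partial>M) \<le> ennreal V"
      "(\<integral>\<^sup>+ s. ennreal (w s) \<partial>M) \<le> ennreal W"
    and I: "0 \<le> U" "0 \<le> V" "0 \<le> W"
  shows "(\<integral>\<^sup>+ s. ennreal (h s) \<partial>M) \<le> ennreal (U powr a * V powr b * W powr c)"
proof (cases "U = 0 \<or> V = 0 \<or> W = 0")
  case True
  have AE0: "AE s in M. g s = 0"
    if [measurable]: "g \<in> borel_measurable M" and g: "\<And>s. 0 \<le> g s" "(\<integral>\<^sup>+ s. ennreal (g s) \<partial>M) \<le> ennreal 0"
    for g :: "'t \<Rightarrow> real"
  proof -
    have "AE s in M. ennreal (g s) = 0"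
      using g(2) by (subst nn_integral_0_iff_AE[symmetric]) auto
    then show ?thesis by eventually_elim (use g(1) in \<open>simp add: antisym\<close>)
  qed
  have "(AE s in M. u s = 0) \<or> (AE s in M. v s = 0) \<or> (AE s in M. w s = 0)"
    using True i AE0[OF m(1) nn(1)] AE0[OF m(2) nn(2)] AE0[OF m(3) nn(3)] by auto
  then have "AE s in M. u s powr a * v s powr b * w s powr c = 0"
    by (elim disjE) (auto elim: eventually_mono)
  then have "AE s in M. ennreal (h s) = 0"
  proof eventually_elim
    fix s assume "u s powr a * v s powr b * w s powr c = 0"
    with h[of s] show "ennreal (h s) = 0" by (simp add: ennreal_neg)
  qed
  then have "(\<integral>\<^sup>+ s. ennreal (h s) \<partial>M) = (\<integral>\<^sup>+ s. 0 \<partial>M)"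
    by (rule nn_integral_cong_AE)
  then show ?thesis by simp
next
  case False
  with I have pos: "0 < U" "0 < V" "0 < W" by auto
  \<comment> \<open>Normalising by \<open>U\<close>, \<open>V\<close> and \<open>W\<close> gives
    three functions of integral at most 1, so the mean inequality integrates to at most
    \<open>D * (a + b + c) = D\<close>.\<close>
  define D where "D = U powr a * V powr b * W powr c"
  have D: "0 \<le> D" by (simp add: D_def)
  have "(\<integral>\<^sup>+ s. ennreal (h s) \<partial>M)
      \<le> (\<integral>\<^sup>+ s. ennreal (D * a / U) * ennreal (u s) + (ennreal (D * b / V) * ennreal (v s)
          + ennreal (D * c / W) * ennreal (w s)) \<partial>M)"
  proof (rule nn_integral_mono)
    fix s
    have "h s \<le> u s powr a * v s powr b * w s powr c" by (rule h)
    also have "\<dots> = D * ((u s / U) powr a * (v s / V) powr b * (w s / W) powr c)"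
      using pos nn[of s] by (simp add: D_def powr_divide)
    also have "\<dots> \<le> D * (a * (u s / U) + b * (v s / V) + c * (w s / W))"
      using pos nn[of s] by (intro mult_left_mono weighted_am_gm3 e D) auto
    also have "\<dots> = D * a / U * u s + (D * b / V * v s + D * c / W * w s)"
      by (simp add: algebra_simps)
    finally have "ennreal (h s) \<le> ennreal (D * a / U * u s + (D * b / V * v s + D * c / W * w s))"
      by (rule ennreal_leI)
    then show "ennreal (h s) \<le> ennreal (D * a / U) * ennreal (u s) + (ennreal (D * b / V) * ennreal (v s)
          + ennreal (D * c / W) * ennreal (w s))"
      using D e pos nn[of s] by (simp only: ennreal_plus ennreal_mult mult_nonneg_nonneg divide_nonneg_pos add_nonneg_nonneg)
  qed
  also have "\<dots> = ennreal (D * a / U) * (\<integral>\<^sup>+ s. ennreal (u s) \<partial>M)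
      + (ennreal (D * b / V) * (\<integral>\<^sup>+ s. ennreal (v s) \<partial>M) + ennreal (D * c / W) * (\<integral>\<^sup>+ s. ennreal (w s) \<partial>M))"
    by (simp add: nn_integral_add nn_integral_cmult)
  also have "\<dots> \<le> ennreal (D * a / U) * ennreal U
      + (ennreal (D * b / V) * ennreal V + ennreal (D * c / W) * ennreal W)"
    by (intro add_mono mult_left_mono i) auto
  also have "\<dots> = ennreal (D * a + (D * b + D * c))"
    using D e pos by (simp flip: ennreal_mult ennreal_plus)
  also have "D * a + (D * b + D * c) = D"
    using e(4) by (simp add: add.assoc flip: distrib_left)
  finally show ?thesis by (simp add: D_def)
qed

section \<open>The Young-type estimate for operator-valued kernels\<close>

locale convolution_kernel =
  fixes k :: "real ^ 'n \<Rightarrow> ('x::complex_banach \<Rightarrow>\<^sub>C\<^sub>L 'y::complex_banach)"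
    and \<theta> p q C1 C2 :: real
  assumes theta: "1 \<le> \<theta>" and q: "1 \<le> q" and p: "0 < p"
    and pq: "1 / q - 1 / p = 1 - 1 / \<theta>"
    and C_nonneg: "0 \<le> C1" "0 \<le> C2"
    and k_meas: "\<And>x. strongly_measurable lebesgue (\<lambda>t. cblinfun_apply (k t) x)"
    and k_bound: "\<And>x. power_integral lebesgue \<theta> (\<lambda>t. cblinfun_apply (k t) x)
      \<le> ennreal ((C1 * norm x) powr \<theta>)"
    and k_adj_bound: "\<And>\<phi>. power_integral lebesgue \<theta> (\<lambda>t. cblinfun_apply (cadjoint (k t)) \<phi>)
      \<le> ennreal ((C2 * norm \<phi>) powr \<theta>)"
begin

text \<open>The scaling relation rewrites the last two Hoelder exponents as
  \<open>1 / \<theta> - 1 / p = 1 - 1 / q\<close> and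
  \<open>1 / q - 1 / p = 1 - 1 / \<theta>\<close>, both nonnegative.\<close>

lemma exponents: "1 / p \<le> 1 / \<theta>" "1 / p \<le> 1 / q" "\<theta> \<le> p" "q \<le> p"
proof -
  have "1 / q \<le> 1" using q by simp
  then show 1: "1 / p \<le> 1 / \<theta>" using pq by linarith
  have "1 / \<theta> \<le> 1" using theta by simp
  then show 2: "1 / p \<le> 1 / q" using pq by linarith
  show "\<theta> \<le> p" using 1 p theta by (simp add: field_simps)
  show "q \<le> p" using 2 p q by (simp add: field_simps)
qed

lemma kernel_zero: "cblinfun_apply (k t) 0 = 0"
  by (rule linear_0[OF bounded_linear.linear[OF bounded_linear_cblinfun_apply]])

lemma kernel_finite: "power_integral lebesgue \<theta> (\<lambda>t. cblinfun_apply (k t) x) < \<infinity>"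
  by (rule le_less_trans[OF k_bound]) simp

lemma kernel_sum:
  assumes "simple_integrable lebesgue f"
  shows "cblinfun_apply (k r) (f s)
    = (\<Sum>x\<in>nonzero_values f. indicator (f -` {x}) s *\<^sub>R cblinfun_apply (k r) x)"
  using sum_nonzero_values[of f "cblinfun_apply (k r)" s, OF _ kernel_zero]
    simple_integrable_nonzero_values(1)[OF assms] by simp

lemma summand_integrable:
  assumes f: "simple_integrable lebesgue f" and x: "x \<in> nonzero_values f"
  shows "lebesgue.norm_integrable (\<lambda>s. indicator (f -` {x}) s *\<^sub>R cblinfun_apply (k (t - s)) x)"
  using simple_integrable_nonzero_values(2,3)[OF f _ x]
  by (intro convolution_term_integrable[OF _ _ k_meas kernel_finite theta]) simp_all

lemma integrand_integrable:
  assumes f: "simple_integrable lebesgue f"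
  shows "lebesgue.norm_integrable (\<lambda>s. cblinfun_apply (k (t - s)) (f s))"
  unfolding kernel_sum[OF f] by (intro lebesgue.norm_integrable_sum summand_integrable f)

text \<open>The level sets of \<open>f\<close> reduce the operator to finitely many kernels
  \<open>\<lambda>t. k t x\<close> with fixed \<open>x\<close>, which is what strong measurability
  of \<open>k\<close> controls.\<close>

lemma convolution_measurable:
  assumes f: "simple_integrable lebesgue f"
  shows "strongly_measurable lebesgue (convolution k f)"
proof -
  have "convolution k f t = (\<Sum>x\<in>nonzero_values f.
      Bochner_integral lebesgue (\<lambda>s. indicator (f -` {x}) s *\<^sub>R cblinfun_apply (k (t - s)) x))" for t
    unfolding convolution_def kernel_sum[OF f]
    by (rule lebesgue.Bochner_integral_sum) (rule summand_integrable[OF f])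
  then have "convolution k f = (\<lambda>t. \<Sum>x\<in>nonzero_values f.
      Bochner_integral lebesgue (\<lambda>s. indicator (f -` {x}) s *\<^sub>R cblinfun_apply (k (t - s)) x))" by (rule ext)
  then show ?thesis
    using simple_integrable_nonzero_values(2,3)[OF f]
    by (simp only:) (intro strongly_measurable_sum
        convolution_term_measurable[OF _ _ k_meas kernel_finite theta]; simp)
qed

lemma convolution_add:
  assumes f: "simple_integrable lebesgue f" and g: "simple_integrable lebesgue g"
  shows "convolution k (\<lambda>s. f s + g s) t = convolution k f t + convolution k g t"
  using lebesgue.Bochner_integral_add[of "\<lambda>s. cblinfun_apply (k (t - s)) (f s)" "\<lambda>s. cblinfun_apply (k (t - s)) (g s)"]
    integrand_integrable[OF f, of t, THEN lebesgue.norm_integrable_Bochner]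
    integrand_integrable[OF g, of t, THEN lebesgue.norm_integrable_Bochner]
    integrand_integrable[OF simple_integrable_add[OF f g], of t, THEN lebesgue.norm_integrable_Bochner]
  by (simp add: convolution_def cblinfun_apply_add)

lemma convolution_scaleC:
  assumes f: "simple_integrable lebesgue f"
  shows "convolution k (\<lambda>s. c *\<^sub>C f s) t = c *\<^sub>C convolution k f t"
proof -
  have "simple_integrable lebesgue (\<lambda>s. c *\<^sub>C f s)"
    by (rule simple_integrable_compose[where h = "\<lambda>x. c *\<^sub>C x"]) (use f in auto)
  from integrand_integrable[OF this, of t, THEN lebesgue.norm_integrable_Bochner]
    integrand_integrable[OF f, of t, THEN lebesgue.norm_integrable_Bochner]
  show ?thesis
    using lebesgue.Bochner_integral_scaleC[of "\<lambda>s. cblinfun_apply (k (t - s)) (f s)" c]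
    by (simp add: convolution_def cblinfun_apply_scaleC)
qed

text \<open>The integral of the first Hoelder factor over \<open>s\<close>. The unit vector
  \<open>sgn (f s)\<close> takes finitely many values; where \<open>f s = 0\<close> the integrand is
  0.\<close>

definition energy :: "(real ^ 'n \<Rightarrow> 'x) \<Rightarrow> real ^ 'n \<Rightarrow> ennreal" where
  "energy f t = (\<integral>\<^sup>+ s. ennreal (norm (cblinfun_apply (k (t - s)) (sgn (f s))) powr \<theta>
      * norm (f s) powr q) \<partial>lebesgue)"

text \<open>On a level set of \<open>f\<close> the direction \<open>sgn (f s)\<close> is one fixed
  unit vector, so the energy is a finite sum of scalar convolutions. Tonelli's theorem turns each
  into a product in which the kernel part is at most \<open>C1 powr \<theta>\<close>, and the
  remaining parts add up to the power integral of \<open>f\<close>.\<close>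

lemma energy_measurable_and_integral:
  assumes f: "simple_integrable lebesgue f"
  shows "energy f \<in> borel_measurable lebesgue"
    and "(\<integral>\<^sup>+ t. energy f t \<partial>lebesgue) \<le> ennreal (C1 powr \<theta>) * power_integral lebesgue q f"
proof -
  let ?V = "nonzero_values f"
  define a :: "'x \<Rightarrow> real ^ 'n \<Rightarrow> ennreal"
    where "a x s = ennreal (norm x powr q) * indicator (f -` {x}) s" for x s
  define g :: "'x \<Rightarrow> real ^ 'n \<Rightarrow> ennreal"
    where "g x r = ennreal (norm (cblinfun_apply (k r) (sgn x)) powr \<theta>)" for x r
  have am: "a x \<in> borel_measurable lebesgue" if "x \<in> ?V" for x
    unfolding a_def using simple_integrable_nonzero_values(2)[OF f _ that]
    by (intro borel_measurable_times_ennreal borel_measurable_const borel_measurable_indicator) simp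
  have gm: "g x \<in> borel_measurable lebesgue" for x
    unfolding g_def by (rule lebesgue.strongly_measurable_norm_powr[OF k_meas])
  have gtm: "(\<lambda>s. g x (t - s)) \<in> borel_measurable lebesgue" for x t
    by (rule measurable_compose[OF measurable_reflect_lebesgue gm])
  have fin: "finite ?V" by (rule simple_integrable_nonzero_values(1)[OF f]) simp
  have split: "ennreal (h (f s)) = (\<Sum>x\<in>?V. ennreal (h x) * indicator (f -` {x}) s)"
    if "h 0 = 0" "\<And>x. 0 \<le> h x" for h :: "'x \<Rightarrow> real" and s
  proof -
    have "ennreal (h (f s)) = ennreal (\<Sum>x\<in>?V. indicator (f -` {x}) s *\<^sub>R h x)"
      using sum_nonzero_values[of f h s] fin that by simp
    also have "\<dots> = (\<Sum>x\<in>?V. ennreal (indicator (f -` {x}) s *\<^sub>R h x))"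
      using that by (intro sum_ennreal[symmetric]) simp
    also have "\<dots> = (\<Sum>x\<in>?V. ennreal (h x) * indicator (f -` {x}) s)"
      by (intro sum.cong) (auto split: split_indicator)
    finally show ?thesis .
  qed
  have energy_eq: "energy f t = (\<Sum>x\<in>?V. \<integral>\<^sup>+ s. a x s * g x (t - s) \<partial>lebesgue)" for t
  proof -
    have "energy f t = (\<integral>\<^sup>+ s. (\<Sum>x\<in>?V. a x s * g x (t - s)) \<partial>lebesgue)"
      unfolding energy_def
    proof (rule nn_integral_cong)
      fix s
      have "ennreal (norm (cblinfun_apply (k (t - s)) (sgn (f s))) powr \<theta> * norm (f s) powr q)
          = (\<Sum>x\<in>?V. ennreal (norm (cblinfun_apply (k (t - s)) (sgn x)) powr \<theta> * norm x powr q)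
              * indicator (f -` {x}) s)"
        by (rule split) auto
      also have "\<dots> = (\<Sum>x\<in>?V. a x s * g x (t - s))"
        by (simp add: a_def g_def ennreal_mult mult_ac)
      finally show "ennreal (norm (cblinfun_apply (k (t - s)) (sgn (f s))) powr \<theta> * norm (f s) powr q)
          = (\<Sum>x\<in>?V. a x s * g x (t - s))" .
    qed
    also have "\<dots> = (\<Sum>x\<in>?V. \<integral>\<^sup>+ s. a x s * g x (t - s) \<partial>lebesgue)"
      by (intro nn_integral_sum borel_measurable_times_ennreal am gtm)
    finally show ?thesis .
  qed
  have cm: "(\<lambda>t. \<integral>\<^sup>+ s. a x s * g x (t - s) \<partial>lebesgue) \<in> borel_measurable lebesgue" if "x \<in> ?V" for x
    by (rule measurable_completion[OF convolution_nn_integral_borel(1)[OF am[OF that] gm]])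
  show "energy f \<in> borel_measurable lebesgue"
    unfolding energy_eq[abs_def] by (intro borel_measurable_sum cm)
  have "(\<integral>\<^sup>+ t. energy f t \<partial>lebesgue)
      = (\<Sum>x\<in>?V. \<integral>\<^sup>+ t. (\<integral>\<^sup>+ s. a x s * g x (t - s) \<partial>lebesgue) \<partial>lebesgue)"
    unfolding energy_eq by (rule nn_integral_sum) (rule cm)
  also have "\<dots> = (\<Sum>x\<in>?V. (\<integral>\<^sup>+ s. a x s \<partial>lebesgue) * (\<integral>\<^sup>+ s. g x s \<partial>lebesgue))"
    by (intro sum.cong refl convolution_nn_integral_borel(2) am gm)
  also have "\<dots> \<le> (\<Sum>x\<in>?V. (\<integral>\<^sup>+ s. a x s \<partial>lebesgue) * ennreal (C1 powr \<theta>))"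
  proof (intro sum_mono mult_left_mono)
    fix x assume "x \<in> ?V"
    then have "norm (sgn x) = 1" by (simp add: nonzero_values_def norm_sgn)
    then show "(\<integral>\<^sup>+ s. g x s \<partial>lebesgue) \<le> ennreal (C1 powr \<theta>)"
      using k_bound[of "sgn x"] by (simp add: g_def power_integral_def)
  qed simp
  also have "\<dots> = ennreal (C1 powr \<theta>) * (\<Sum>x\<in>?V. \<integral>\<^sup>+ s. a x s \<partial>lebesgue)"
    by (simp add: sum_distrib_left mult.commute)
  also have "(\<Sum>x\<in>?V. \<integral>\<^sup>+ s. a x s \<partial>lebesgue) = (\<integral>\<^sup>+ s. (\<Sum>x\<in>?V. a x s) \<partial>lebesgue)"
    by (rule nn_integral_sum[symmetric]) (rule am)
  also have "\<dots> = power_integral lebesgue q f"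
    unfolding power_integral_def a_def
    by (intro nn_integral_cong split[symmetric]) auto
  finally show "(\<integral>\<^sup>+ t. energy f t \<partial>lebesgue) \<le> ennreal (C1 powr \<theta>) * power_integral lebesgue q f" .
qed

text \<open>The real majorant \<open>u\<close> of the energy keeps the computation in real
  arithmetic. It enters Hoelder's inequality with the exponent \<open>1 / p\<close> and so ends up
  linear after the \<open>p\<close>-th power.\<close>

lemma convolution_pointwise:
  assumes f: "simple_integrable lebesgue f"
    and c: "0 \<le> c" "power_integral lebesgue q f \<le> ennreal (c powr q)"
    and u: "energy f t \<le> ennreal u" "0 \<le> u"
  shows "norm (convolution k f t) powr p \<le> u * (C2 powr (p - \<theta>) * c powr (p - q))"
proof -
  note I = integrand_integrable[OF f, of t, THEN lebesgue.norm_integrable_Bochner]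
  obtain \<phi> :: "'y cdual" where \<phi>: "norm \<phi> \<le> 1"
      "cblinfun_apply \<phi> (convolution k f t) = complex_of_real (norm (convolution k f t))"
    using ex_norming_functional by blast
  have sg: "simple_integrable lebesgue (\<lambda>s. sgn (f s))"
    by (rule simple_integrable_compose[OF _ f]) simp
  have ksm: "strongly_measurable lebesgue (\<lambda>s. cblinfun_apply (k (t - s)) (sgn (f s)))"
    using integrand_integrable[OF sg, of t] by (simp add: lebesgue.norm_integrable_def)
  define m where "m s = norm (cblinfun_apply (k (t - s)) (sgn (f s)))" for s
  define h where "h s = norm (cblinfun_apply \<phi> (cblinfun_apply (k (t - s)) (sgn (f s))))" for s
  have mm[measurable]: "m \<in> borel_measurable lebesgue"
    unfolding m_def by (rule lebesgue.strongly_measurable_norm_borel[OF ksm])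
  have hm[measurable]: "h \<in> borel_measurable lebesgue"
    unfolding h_def by (intro lebesgue.strongly_measurable_norm_borel
        strongly_measurable_bounded_linear[OF bounded_linear_cblinfun_apply] ksm)
  have fm[measurable]: "(\<lambda>s. norm (f s)) \<in> borel_measurable lebesgue"
    by (rule lebesgue.strongly_measurable_norm_borel[OF strongly_measurable_simple[OF f]])
  have hle: "h s \<le> m s" for s
    unfolding h_def m_def
    using norm_cblinfun_apply_le[of \<phi> "cblinfun_apply (k (t - s)) (sgn (f s))"]
      mult_right_mono[OF \<phi>(1), of "norm (cblinfun_apply (k (t - s)) (sgn (f s)))"] by simp
  have nn: "0 \<le> h s" "0 \<le> m s" for s by (simp_all add: h_def m_def)
  \<comment> \<open>Only the part \<open>\<theta> / p\<close> of the exponent of \<open>h\<close> is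
    passed to the larger \<open>m\<close>; the rest must stay with \<phi>, because the adjoint bound
    controls \<open>h\<close> but not \<open>m\<close>.\<close>
  have prod_le: "norm (f s) * h s
      \<le> (m s powr \<theta> * norm (f s) powr q) powr (1 / p) * (h s powr \<theta>) powr (1 / \<theta> - 1 / p)
        * (norm (f s) powr q) powr (1 / q - 1 / p)" (is "_ \<le> ?R") for s
  proof (cases "f s = 0 \<or> h s = 0")
    case True
    then have "norm (f s) * h s = 0" by auto
    also have "0 \<le> ?R" by simp
    finally show ?thesis .
  next
    case False
    then have F: "0 < norm (f s)" and h: "0 < h s" using nn(1)[of s] by auto
    have "h s = h s powr (\<theta> / p) * h s powr (1 - \<theta> / p)"
      using h by (simp flip: powr_add)
    also have "\<dots> \<le> m s powr (\<theta> / p) * h s powr (1 - \<theta> / p)"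
      using theta p hle[of s] h by (intro mult_right_mono powr_mono2) auto
    finally have hm: "h s \<le> m s powr (\<theta> / p) * h s powr (1 - \<theta> / p)" .
    have "norm (f s) = norm (f s) powr (q / p) * norm (f s) powr (1 - q / p)"
      using F by (simp flip: powr_add)
    then have "norm (f s) * h s \<le> (norm (f s) powr (q / p) * norm (f s) powr (1 - q / p))
        * (m s powr (\<theta> / p) * h s powr (1 - \<theta> / p))"
      using hm F by (metis mult_left_mono norm_ge_zero)
    also have "\<dots> = ?R"
      using p q theta by (simp add: powr_mult powr_powr algebra_simps)
    finally show ?thesis .
  qed
  \<comment> \<open>The vector \<open>sgn (f s)\<close> moves with \<open>s\<close>, so bounds on
    \<open>k\<close> at fixed vectors do not apply. But \<phi> is fixed, and the norm of
    \<open>\<phi> o\<^sub>C\<^sub>L k s\<close> dominates for all unit vectors at once.\<close>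
  have int_v: "(\<integral>\<^sup>+ s. ennreal (h s powr \<theta>) \<partial>lebesgue) \<le> ennreal (C2 powr \<theta>)"
  proof -
    have "(\<integral>\<^sup>+ s. ennreal (h s powr \<theta>) \<partial>lebesgue) = (\<integral>\<^sup>+ s. ennreal (h (t - s) powr \<theta>) \<partial>lebesgue)"
      by (rule nn_integral_lebesgue_reflect[symmetric]) measurable
    \<comment> \<open>Reflection was applied to the measurable \<open>h\<close>; the passage to the
      adjoint is a pointwise comparison, valid for lower integrals.\<close>
    also have "\<dots> \<le> power_integral lebesgue \<theta> (\<lambda>s. cblinfun_apply (cadjoint (k s)) \<phi>)"
      unfolding power_integral_def
    proof (intro nn_integral_mono ennreal_leI powr_mono2)
      fix s
      have "h (t - s) = norm (cblinfun_apply (\<phi> o\<^sub>C\<^sub>L k s) (sgn (f (t - s))))" by (simp add: h_def)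
      also have "\<dots> \<le> norm (\<phi> o\<^sub>C\<^sub>L k s) * norm (sgn (f (t - s)))" by (rule norm_cblinfun_apply_le)
      also have "\<dots> \<le> norm (\<phi> o\<^sub>C\<^sub>L k s)" by (simp add: norm_sgn)
      finally show "h (t - s) \<le> norm (cblinfun_apply (cadjoint (k s)) \<phi>)" by simp
    qed (use theta nn in auto)
    also have "\<dots> \<le> ennreal ((C2 * norm \<phi>) powr \<theta>)" by (rule k_adj_bound)
    also have "\<dots> \<le> ennreal (C2 powr \<theta>)"
      using \<phi>(1) C_nonneg theta by (intro ennreal_leI powr_mono2) (auto intro: mult_left_le)
    finally show ?thesis .
  qed
  have "ennreal (norm (convolution k f t))
      = ennreal (norm (\<integral> s. cblinfun_apply \<phi> (cblinfun_apply (k (t - s)) (f s)) \<partial>lebesgue))"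
    using \<phi>(2) lebesgue.Bochner_integral_functional(2)[OF I, of \<phi>] by (simp add: convolution_def)
  also have "\<dots> \<le> (\<integral>\<^sup>+ s. ennreal (norm (cblinfun_apply \<phi> (cblinfun_apply (k (t - s)) (f s)))) \<partial>lebesgue)"
    by (rule integral_norm_bound_ennreal[OF lebesgue.Bochner_integral_functional(1)[OF I]])
  also have "\<dots> = (\<integral>\<^sup>+ s. ennreal (norm (f s) * h s) \<partial>lebesgue)"
  proof (rule nn_integral_cong)
    fix s
    have "f s = norm (f s) *\<^sub>R sgn (f s)" by (cases "f s = 0") (simp_all add: sgn_div_norm)
    then have "cblinfun_apply \<phi> (cblinfun_apply (k (t - s)) (f s))
        = norm (f s) *\<^sub>R cblinfun_apply \<phi> (cblinfun_apply (k (t - s)) (sgn (f s)))"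
      by (metis bounded_linear.linear bounded_linear_cblinfun_apply linear_scale)
    then show "ennreal (norm (cblinfun_apply \<phi> (cblinfun_apply (k (t - s)) (f s)))) = ennreal (norm (f s) * h s)"
      by (simp add: h_def)
  qed
  also have "\<dots> \<le> ennreal (u powr (1 / p) * (C2 powr \<theta>) powr (1 / \<theta> - 1 / p)
      * (c powr q) powr (1 / q - 1 / p))"
  proof (rule Hoelder3[OF _ _ _ _ _ _ _ _ _ _ prod_le])
    show "(\<integral>\<^sup>+ s. ennreal (m s powr \<theta> * norm (f s) powr q) \<partial>lebesgue) \<le> ennreal u"
      using u(1) by (simp add: energy_def m_def)
    show "(\<integral>\<^sup>+ s. ennreal (norm (f s) powr q) \<partial>lebesgue) \<le> ennreal (c powr q)"
      using c(2) by (simp add: power_integral_def)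
    show "1 / p + (1 / \<theta> - 1 / p) + (1 / q - 1 / p) = 1" using pq by linarith
  qed (use int_v exponents p u(2) in auto)
  finally have "norm (convolution k f t) \<le> u powr (1 / p) * (C2 powr \<theta>) powr (1 / \<theta> - 1 / p)
      * (c powr q) powr (1 / q - 1 / p)"
    by (subst (asm) ennreal_le_iff) auto
  then have "norm (convolution k f t) powr p \<le> (u powr (1 / p) * (C2 powr \<theta>) powr (1 / \<theta> - 1 / p)
      * (c powr q) powr (1 / q - 1 / p)) powr p"
    using p by (intro powr_mono2) auto
  also have "\<dots> = u powr (1 / p * p) * C2 powr (\<theta> * (1 / \<theta> - 1 / p) * p) * c powr (q * (1 / q - 1 / p) * p)"
    by (simp add: powr_mult powr_powr mult.assoc)
  also have "1 / p * p = 1" using p by simp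
  also have "\<theta> * (1 / \<theta> - 1 / p) * p = p - \<theta>" using p theta by (simp add: field_simps)
  also have "q * (1 / q - 1 / p) * p = p - q" using p q by (simp add: field_simps)
  also have "u powr 1 = u" using u(2) by simp
  finally show ?thesis by (simp add: mult.assoc)
qed

text \<open>Integrating the pointwise estimate gives
  \<open>C1 powr \<theta> * C2 powr (p - \<theta>) * c powr p\<close>, the powers of
  \<open>c\<close> from the energy and from Hoelder's inequality adding up to
  \<open>p\<close>.\<close>

lemma convolution_bound:
  assumes f: "simple_integrable lebesgue f"
    and c: "0 \<le> c" "power_integral lebesgue q f \<le> ennreal (c powr q)"
  shows "power_integral lebesgue p (convolution k f)
    \<le> ennreal ((C1 powr (\<theta> / p) * C2 powr (1 - \<theta> / p) * c) powr p)"
proof -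
  define D where "D = C2 powr (p - \<theta>) * c powr (p - q)"
  note E = energy_measurable_and_integral[OF f]
  have EI: "(\<integral>\<^sup>+ t. energy f t \<partial>lebesgue) \<le> ennreal (C1 powr \<theta> * c powr q)"
  proof -
    note E(2)
    also have "ennreal (C1 powr \<theta>) * power_integral lebesgue q f \<le> ennreal (C1 powr \<theta>) * ennreal (c powr q)"
      by (intro mult_left_mono c(2)) simp
    finally show ?thesis by (simp add: ennreal_mult)
  qed
  then have "(\<integral>\<^sup>+ t. energy f t \<partial>lebesgue) \<noteq> \<infinity>" by (auto simp: top_unique)
  \<comment> \<open>The pointwise estimate presupposes finite energy, which the integral bound
    guarantees for almost every \<open>t\<close>.\<close>
  then have fin: "AE t in lebesgue. energy f t \<noteq> \<infinity>"
    by (rule nn_integral_noteq_infinite[OF E(1)])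
  have "power_integral lebesgue p (convolution k f) \<le> (\<integral>\<^sup>+ t. energy f t * ennreal D \<partial>lebesgue)"
    unfolding power_integral_def
  proof (rule nn_integral_mono_AE, use fin in eventually_elim)
    fix t assume "energy f t \<noteq> \<infinity>"
    then obtain u where u: "energy f t = ennreal u" "0 \<le> u" by (cases "energy f t") auto
    have "norm (convolution k f t) powr p \<le> u * D"
      unfolding D_def by (rule convolution_pointwise[OF f c _ u(2)]) (simp add: u(1))
    then show "ennreal (norm (convolution k f t) powr p) \<le> energy f t * ennreal D"
      using u by (simp add: D_def ennreal_leI flip: ennreal_mult)
  qed
  also have "\<dots> = (\<integral>\<^sup>+ t. energy f t \<partial>lebesgue) * ennreal D"
    by (rule nn_integral_multc[OF E(1)])
  also have "\<dots> \<le> ennreal (C1 powr \<theta> * c powr q) * ennreal D"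
    by (intro mult_right_mono EI) simp
  also have "\<dots> = ennreal (C1 powr \<theta> * C2 powr (p - \<theta>) * (c powr q * c powr (p - q)))"
    by (simp add: D_def mult_ac flip: ennreal_mult)
  also have "c powr q * c powr (p - q) = c powr p"
    by (simp flip: powr_add)
  also have "C1 powr \<theta> * C2 powr (p - \<theta>) * c powr p
      = (C1 powr (\<theta> / p) * C2 powr (1 - \<theta> / p) * c) powr p"
    using p by (simp add: powr_mult powr_powr left_diff_distrib)
  finally show ?thesis .
qed

end

theorem corollary2p9:
  fixes k :: "real ^ 'n \<Rightarrow> ('x::complex_banach \<Rightarrow>\<^sub>C\<^sub>L 'y::complex_banach)"
    and Z :: "'y cdual set"
    and \<tau> \<theta> p q C1 C2 :: real
  assumes Z: "csubspace Z" and tau: "\<tau> \<ge> 1" and norming: "norming \<tau> Z"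
    and theta: "1 \<le> \<theta>"
    and pq: "1 / q - 1 / p = 1 - 1 / \<theta>"
    and q: "1 \<le> q" "ereal q < conjugate_exponent \<theta>"
    and k_meas: "\<And>x. strongly_measurable lebesgue (\<lambda>t. cblinfun_apply (k t) x)"
    and k_adj_meas:
      "\<And>\<phi>. \<phi> \<in> Z \<Longrightarrow> strongly_measurable lebesgue (\<lambda>t. cblinfun_apply (cadjoint (k t)) \<phi>)"
    and C_nonneg: "0 \<le> C1" "0 \<le> C2"
    and k_bound: "\<And>x. Lp_norm lebesgue \<theta> (\<lambda>t. cblinfun_apply (k t) x) \<le> ennreal (C1 * norm x)"
    and k_adj_bound:
      "\<And>\<phi>. Lp_norm lebesgue \<theta> (\<lambda>t. cblinfun_apply (cadjoint (k t)) \<phi>) \<le> ennreal (C2 * norm \<phi>)"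
  shows "(\<forall>f\<in>step_functions lebesgue. \<forall>t.
            Bochner_integrable lebesgue (\<lambda>s. cblinfun_apply (k (t - s)) (f s))) \<and>
         (\<exists>K. bounded_Lp_operator lebesgue q p K \<and>
              (\<forall>f\<in>step_functions lebesgue. AE t in lebesgue. K f t = convolution k f t) \<and>
              Lp_operator_norm lebesgue q p K \<le>
                ennreal (C1 powr (\<theta> / p) * C2 powr (1 - \<theta> / p)))"
proof -
  have p: "0 < p"
  proof -
    \<comment> \<open>The strict inequality between \<open>q\<close> and the conjugate exponent is
      exactly what makes \<open>1 / p\<close> positive.\<close>
    have "1 - 1 / \<theta> < 1 / q"
      using theta q by (auto simp: conjugate_exponent_def field_simps split: if_splits)
    then have "0 < 1 / p" using pq by linarith
    then show ?thesis by simp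
  qed
  have theta0: "0 < \<theta>" using theta by simp
  interpret convolution_kernel k \<theta> p q C1 C2
  proof
    show "power_integral lebesgue \<theta> (\<lambda>t. cblinfun_apply (k t) x) \<le> ennreal ((C1 * norm x) powr \<theta>)" for x
      using k_bound[of x] C_nonneg theta0 by (subst Lp_norm_le_iff[symmetric]) auto
    show "power_integral lebesgue \<theta> (\<lambda>t. cblinfun_apply (cadjoint (k t)) \<phi>)
        \<le> ennreal ((C2 * norm \<phi>) powr \<theta>)" for \<phi>
      using k_adj_bound[of \<phi>] C_nonneg theta0
      by (subst Lp_norm_le_iff[symmetric]) auto
  qed (use theta q p pq C_nonneg k_meas in auto)
  have "\<exists>K. bounded_Lp_operator lebesgue q p K \<and>
      (\<forall>f. simple_integrable lebesgue f \<longrightarrow> (AE t in lebesgue. K f t = convolution k f t)) \<and>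
      Lp_operator_norm lebesgue q p K \<le> ennreal (C1 powr (\<theta> / p) * C2 powr (1 - \<theta> / p))"
    using q(1) p
    by (intro lebesgue.extend_from_simple convolution_measurable convolution_add convolution_scaleC
        convolution_bound) auto
  moreover have "Bochner_integrable lebesgue (\<lambda>s. cblinfun_apply (k (t - s)) (f s))"
    if "f \<in> step_functions lebesgue" for f t
    using that by (intro lebesgue.norm_integrable_Bochner integrand_integrable
        simple_integrable_step_function)
  ultimately show ?thesis using simple_integrable_step_function by blast
qed

end
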